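(* Let $S\in\mathbb{S}^d_m$, $Y\in\mathcal{L}_2(\mathbb{R}^d)$, $\nu:=\mathrm{Law}(Y)$. Assume that the interior of the convex hull of $\operatorname{supp}\nu$ is non-empty, and (A1) $h(SY)\neq0$ a.s. for every $h\in\mathcal{H}^j_C$ with index $j\in\{1,\dots,d\}$ and compact set $C\subset\{x\in\mathbb{R}^d: x^j=1,\ S(x,x)>0\}$. Then $\nu(\Sigma_1(P_G))=0$ for every $G\in\mathcal{M}(S)$ with $\mathbb{E}[\psi_G(Y)]<\infty$. Consequently, for every optimal set $G$ of the dual problem, $X:=\mathbb{E}[Y\mid\sigma(P_G(Y))]$ is an optimal map, $\mathrm{Law}(X,Y)$ is an optimal plan, and for every $Z\in\mathcal{L}_2(\mathbb{R}^d)$ such that $\mathrm{Law}(Z,Y)$ is an optimal plan we have $Z\in P_G(Z)=P_G(Y)$, $X$ is $Z$-measurable, $X=\mathbb{E}[Z|X]$ and $S(Z-X,Z-X)=0$.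
   Context: $\mathbb{S}^d_m$: symmetric invertible $d\times d$ real matrices with exactly $m$ positive eigenvalues; $S(x,y):=\langle x,Sy\rangle$. $G\subset\mathbb{R}^d$ is $S$-monotone if $S(x-y,x-y)\ge0$ for $x,y\in G$; maximal if not a strict subset of another $S$-monotone set; $\mathcal{M}(S)$ is the family of maximal $S$-monotone sets. $\psi_G(y):=\sup_{x\in G}(S(x,y)-\frac12S(x,x))$, $P_G(y):=\operatorname{argmax}_{x\in G}(S(x,y)-\frac12S(x,x))$. $\Sigma(P_G):=\{y:P_G(y)\ne\emptyset\text{ is not a single point}\}$, $\Sigma_1(P_G):=\{y\in\Sigma(P_G):S(y_1-y_2,y_1-y_2)>0\text{ for some }y_1,y_2\in P_G(y)\}$. $\sigma(P_G)$: $\sigma$-algebra on $\mathbb{R}^d$ generated by $\{y:P_G(y)\cap U\ne\emptyset\}$, $U$ open; $\sigma(P_G(Y)):=\{Y^{-1}(A):A\in\sigma(P_G)\}$. For $x\in\mathbb{R}^d$, $x^{-j}\in\mathbb{R}^{d-1}$ is $x$ without its $j$-th coordinate. For $j\in\{1,\dots,d\}$ and a compact $C$ with $y^j=1$ for $y\in C$, $\mathcal{H}^j_C$ is the family of functions $h(x)=x^j+g_1(x^{-j})-g_2(x^{-j})$ on $\mathbb{R}^d$, where $g_1,g_2$ are convex on $\mathbb{R}^{d-1}$ with linear growth ($|g_i(z)|\le K(1+|z|)$ for some $K$) and $\nabla h(x)\in C$ whenever $g_1,g_2$ are differentiable at $x^{-j}$. $\mathcal{X}(Y):=\{X\in\mathcal{L}_2(\mathbb{R}^d):X\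 Y\text{-measurable},\ \mathbb{E}[Y|X]=X\}$; an optimal map maximizes $\frac12\mathbb{E}[S(X,Y)]$ over $\mathcal{X}(Y)$. $\Gamma(\nu)$: Borel probability measures on $\mathbb{R}^d\times\mathbb{R}^d$ (coordinates $(x,y)$) with finite second moments, second marginal $\nu$, and conditional expectation of $y$ given $x$ equal to $x$; an optimal plan maximizes $\frac12\int S(x,y)d\gamma$ over $\Gamma(\nu)$. An optimal set of the dual problem minimizes $\int\psi_G\,d\nu$ over $G\in\mathcal{M}(S)$. Relations between random variables hold a.s.; the probability space may be enlarged. *)

theory Defs
  imports "HOL-Probability.Probability" "HOL-Computational_Algebra.Polynomial"
begin

definition Sform :: "real^'n^'n \<Rightarrow> real^'n \<Rightarrow> real^'n \<Rightarrow> real" where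
  "Sform S x y = inner x (S *v y)"

definition charpoly_mat :: "real^'n^'n \<Rightarrow> real poly" where
  "charpoly_mat S = det (\<chi> i k. (if i = k then [:0, 1:] else 0) - [:S $ i $ k:])"

definition num_pos_eigenvalues :: "real^'n^'n \<Rightarrow> nat" where
  "num_pos_eigenvalues S =
     (\<Sum>t\<in>{t::real. t > 0 \<and> poly (charpoly_mat S) t = 0}. order t (charpoly_mat S))"

definition SymInv :: "nat \<Rightarrow> (real^'n^'n) set" where
  "SymInv m = {S. transpose S = S \<and> invertible S \<and> num_pos_eigenvalues S = m}"

definition S_monotone :: "real^'n^'n \<Rightarrow> (real^'n) set \<Rightarrow> bool" where
  "S_monotone S G \<longleftrightarrow> (\<forall>x\<in>G. \<forall>y\<in>G. Sform S (x - y) (x - y) \<ge> 0)"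

definition maxmon :: "real^'n^'n \<Rightarrow> (real^'n) set set" where
  "maxmon S = {G. S_monotone S G \<and> (\<forall>G'. S_monotone S G' \<and> G \<subseteq> G' \<longrightarrow> G' = G)}"

definition psiG :: "real^'n^'n \<Rightarrow> (real^'n) set \<Rightarrow> real^'n \<Rightarrow> ereal" where
  "psiG S G y = (SUP x\<in>G. ereal (Sform S x y - Sform S x x / 2))"

definition PG :: "real^'n^'n \<Rightarrow> (real^'n) set \<Rightarrow> real^'n \<Rightarrow> (real^'n) set" where
  "PG S G y = {x\<in>G. \<forall>x'\<in>G. Sform S x' y - Sform S x' x' / 2 \<le> Sform S x y - Sform S x x / 2}"

definition SigmaP :: "real^'n^'n \<Rightarrow> (real^'n) set \<Rightarrow> (real^'n) set" where
  "SigmaP S G = {y. PG S G y \<noteq> {} \<and> \<not> (\<exists>x. PG S G y = {x})}"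

definition Sigma1P :: "real^'n^'n \<Rightarrow> (real^'n) set \<Rightarrow> (real^'n) set" where
  "Sigma1P S G = {y\<in>SigmaP S G. \<exists>y1\<in>PG S G y. \<exists>y2\<in>PG S G y. Sform S (y1 - y2) (y1 - y2) > 0}"

definition sigmaPG :: "real^'n^'n \<Rightarrow> (real^'n) set \<Rightarrow> (real^'n) measure" where
  "sigmaPG S G = sigma UNIV {{y. PG S G y \<inter> U \<noteq> {}} | U. open U}"

text \<open>R^(d-1) (x without its j-th coordinate) is identified with the coordinate
  hyperplane {z. z$j = 0}; x^(-j) corresponds to zeroing the j-th coordinate.\<close>
definition hyp :: "'n \<Rightarrow> (real^'n) set" where
  "hyp j = {z. z $ j = 0}"

definition dropc :: "'n \<Rightarrow> real^'n \<Rightarrow> real^'n" where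
  "dropc j x = (\<chi> i. if i = j then 0 else x $ i)"

definition Hclass :: "'n \<Rightarrow> (real^'n) set \<Rightarrow> (real^'n \<Rightarrow> real) set" where
  "Hclass j C = {h. \<exists>g1 g2 K.
      convex_on (hyp j) g1 \<and> convex_on (hyp j) g2 \<and>
      (\<forall>z\<in>hyp j. \<bar>g1 z\<bar> \<le> K * (1 + norm z)) \<and>
      (\<forall>z\<in>hyp j. \<bar>g2 z\<bar> \<le> K * (1 + norm z)) \<and>
      h = (\<lambda>x. x $ j + g1 (dropc j x) - g2 (dropc j x)) \<and>
      (\<forall>x. g1 differentiable (at (dropc j x) within hyp j) \<and>
           g2 differentiable (at (dropc j x) within hyp j) \<longrightarrow>
           (\<exists>D\<in>C. (h has_derivative (\<lambda>v. inner D v)) (at x)))}"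

definition L2vec :: "'w measure \<Rightarrow> ('w \<Rightarrow> real^'n) \<Rightarrow> bool" where
  "L2vec M X \<longleftrightarrow> X \<in> borel_measurable M \<and> integrable M (\<lambda>w. (norm (X w))\<^sup>2)"

definition msupp :: "(real^'n) measure \<Rightarrow> (real^'n) set" where
  "msupp \<nu> = \<Inter>{F. closed F \<and> emeasure \<nu> (UNIV - F) = 0}"

definition is_cond_exp :: "'w measure \<Rightarrow> 'w measure \<Rightarrow> ('w \<Rightarrow> real^'n) \<Rightarrow> ('w \<Rightarrow> real^'n) \<Rightarrow> bool" where
  "is_cond_exp M N Y X \<longleftrightarrow> X \<in> borel_measurable N \<and> integrable M X \<and>
     (\<forall>A\<in>sets N. set_lebesgue_integral M A X = set_lebesgue_integral M A Y)"

definition eexpect :: "'a measure \<Rightarrow> ('a \<Rightarrow> ereal) \<Rightarrow> ereal" where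
  "eexpect M f = enn2ereal (\<integral>\<^sup>+ w. e2ennreal (f w) \<partial>M) - enn2ereal (\<integral>\<^sup>+ w. e2ennreal (- f w) \<partial>M)"

definition Xset :: "'w measure \<Rightarrow> ('w \<Rightarrow> real^'n) \<Rightarrow> ('w \<Rightarrow> real^'n) set" where
  "Xset M Y = {X. L2vec M X \<and> X \<in> measurable (vimage_algebra (space M) Y borel) borel \<and>
                  is_cond_exp M (vimage_algebra (space M) X borel) Y X}"

definition optimal_map :: "'w measure \<Rightarrow> real^'n^'n \<Rightarrow> ('w \<Rightarrow> real^'n) \<Rightarrow> ('w \<Rightarrow> real^'n) \<Rightarrow> bool" where
  "optimal_map M S Y X \<longleftrightarrow> X \<in> Xset M Y \<and>
     (\<forall>X'\<in>Xset M Y. (1/2) * (\<integral>w. Sform S (X' w) (Y w) \<partial>M) \<le> (1/2) * (\<integral>w. Sform S (X w) (Y w) \<partial>M))"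

definition Gamma :: "(real^'n) measure \<Rightarrow> ((real^'n) \<times> (real^'n)) measure set" where
  "Gamma \<nu> = {\<gamma>. sets \<gamma> = sets borel \<and> prob_space \<gamma> \<and>
      integrable \<gamma> (\<lambda>p. (norm (fst p))\<^sup>2) \<and> integrable \<gamma> (\<lambda>p. (norm (snd p))\<^sup>2) \<and>
      distr \<gamma> borel snd = \<nu> \<and>
      (\<forall>A\<in>sets borel. set_lebesgue_integral \<gamma> (A \<times> UNIV) snd = set_lebesgue_integral \<gamma> (A \<times> UNIV) fst)}"

definition optimal_plan :: "(real^'n) measure \<Rightarrow> real^'n^'n \<Rightarrow> ((real^'n) \<times> (real^'n)) measure \<Rightarrow> bool" where
  "optimal_plan \<nu> S \<gamma> \<longleftrightarrow> \<gamma> \<in> Gamma \<nu> \<and>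
     (\<forall>\<gamma>'\<in>Gamma \<nu>. (1/2) * (\<integral>p. Sform S (fst p) (snd p) \<partial>\<gamma>') \<le> (1/2) * (\<integral>p. Sform S (fst p) (snd p) \<partial>\<gamma>))"

definition dual_optimal :: "(real^'n) measure \<Rightarrow> real^'n^'n \<Rightarrow> (real^'n) set \<Rightarrow> bool" where
  "dual_optimal \<nu> S G \<longleftrightarrow> G \<in> maxmon S \<and>
     (\<forall>G'\<in>maxmon S. eexpect \<nu> (psiG S G) \<le> eexpect \<nu> (psiG S G'))"

end

(*
  Write q(x) = S(x,x)/2 and let l_x be the affine function tangent to q at x, so that psi_G is the
  supremum of l_x over x in G.

  Singular set. If P_G(y) meets two compact sets A, B on which the j-th coordinates are separated,
  then the conjugates of q on A and on B coincide at Sy. The coincidence set is a graph in the j-th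
  direction whose height is a difference of two partial minima of convex functions, and whose
  normals are multiples of a - b with a in A, b in B. Countably many pairs of balls (A, B) with
  S(a-b,a-b) > 0 cover Sigma_1, and (A1) makes each graph negligible.

  Duality without a gap. An optimal plan exists by compactness of the set of martingale plans.
  Moving a small part of the mass of an optimal plan to a new atom shows that the convex hull of the
  function l_x(y) on the plan stays above q. A maximal convex set above the graph of q contains it, and
  the points whose tangents lie below that set form a maximal monotone set G with
  psi_G(y) <= l_x(y) almost surely. So the dual value equals the primal value, every optimal plan
  satisfies x in P_G(y) for every dual optimizer G, and the martingale property upgrades this to
  P_G(x) = P_G(y).

  The conditional expectation X given P_G(Y) keeps the points of P_G(Y) in P_G(X), hence
  q(X) <= l_x(X) for x in P_G(Y). Integrating this against an optimal plan gives E q(x) <= E q(X), so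
  that X is optimal.
*)
theory Submission
  imports Defs
begin

section \<open>Monotone sets of a symmetric form\<close>

text \<open>The form is indefinite, so q is neither convex nor concave and convexity has to come
  from elsewhere: psi_G is convex as a supremum of affine functions, and q <= psi_G because G is
  maximal. Jensen's inequality for psi_G then bounds every martingale plan by the dual value. In the
  converse direction a convex set above q easily yields a monotone set; its maximality is the hard
  point and comes from a Hahn-Banach separation inside the negative directions of S, where q is
  concave. The upgrade to P_G(x) = P_G(y) rests on the test E S(f(x) - x, x - y) = 0 for a selection
  f of P_G: the integrand is nonnegative and vanishes only if f(x) lies in P_G(y). In both arguments
  about P_G, selections are replaced by hits of small balls, since the generating events of
  sigma(P_G) are of this kind. (A1) speaks about SY because <x, SY> = S(x,Y) turns the maximization
  into a conjugate for the Euclidean pairing.\<close>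

lemma Sform_add_left: "Sform S (x + y) z = Sform S x z + Sform S y z"
  and Sform_add_right: "Sform S x (y + z) = Sform S x y + Sform S x z"
  and Sform_diff_left: "Sform S (x - y) z = Sform S x z - Sform S y z"
  and Sform_diff_right: "Sform S x (y - z) = Sform S x y - Sform S x z"
  and Sform_scaleR_left: "Sform S (c *\<^sub>R x) z = c * Sform S x z"
  and Sform_scaleR_right: "Sform S x (c *\<^sub>R z) = c * Sform S x z"
  and Sform_minus_left: "Sform S (- x) z = - Sform S x z"
  and Sform_minus_right: "Sform S x (- z) = - Sform S x z"
  and Sform_zero_left: "Sform S 0 z = 0"
  and Sform_zero_right: "Sform S x 0 = 0"
  by (simp_all add: Sform_def inner_simps matrix_vector_right_distrib matrix_vector_mult_diff_distrib
      matrix_vector_mult_scaleR vec.neg vec.zero)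

lemmas Sform_simps = Sform_add_left Sform_add_right Sform_diff_left Sform_diff_right
  Sform_scaleR_left Sform_scaleR_right Sform_minus_left Sform_minus_right Sform_zero_left Sform_zero_right

lemma Sform_sum_left: "Sform S (sum f A) z = (\<Sum>a\<in>A. Sform S (f a) z)"
  and Sform_sum_right: "Sform S z (sum f A) = (\<Sum>a\<in>A. Sform S z (f a))"
  by (induction A rule: infinite_finite_induct) (simp_all add: Sform_simps)

lemma Sform_commute:
  assumes "transpose S = S"
  shows "Sform S x y = Sform S y x"
  by (metis Sform_def assms dot_lmul_matrix inner_commute transpose_matrix_vector)

lemma Sform_diff_commute: "Sform S (x - y) (x - y) = Sform S (y - x) (y - x)"
  by (simp add: Sform_simps)

lemma Sform_bound: "\<exists>K>0. \<forall>x y. \<bar>Sform S x y\<bar> \<le> K * norm x * norm y"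
proof -
  obtain K where K: "K > 0" "\<And>y. norm (S *v y) \<le> norm y * K"
    using bounded_linear.pos_bounded[OF matrix_vector_mul_bounded_linear[of S]] by blast
  have "\<bar>Sform S x y\<bar> \<le> K * norm x * norm y" for x y
  proof -
    have "\<bar>Sform S x y\<bar> \<le> norm x * norm (S *v y)"
      unfolding Sform_def by (rule Cauchy_Schwarz_ineq2)
    also have "\<dots> \<le> norm x * (norm y * K)"
      by (rule mult_left_mono[OF K(2)]) simp
    finally show ?thesis by (simp add: ac_simps)
  qed
  then show ?thesis using K(1) by blast
qed

lemma continuous_on_Sform [continuous_intros]:
  assumes "continuous_on A f" "continuous_on A g"
  shows "continuous_on A (\<lambda>x. Sform S (f x) (g x))"
proof -
  have "continuous_on A (\<lambda>x. S *v g x)"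
    using continuous_on_compose2[OF linear_continuous_on[OF matrix_vector_mul_bounded_linear[of S], of UNIV] assms(2)]
    by auto
  then show ?thesis unfolding Sform_def by (intro continuous_intros assms)
qed

lemma tendsto_Sform [tendsto_intros]:
  assumes "(f \<longlongrightarrow> a) F" "(g \<longlongrightarrow> b) F"
  shows "((\<lambda>x. Sform S (f x) (g x)) \<longlongrightarrow> Sform S a b) F"
  unfolding Sform_def
  by (intro tendsto_inner assms bounded_linear.tendsto[OF matrix_vector_mul_bounded_linear])

lemma measurable_matrix_vector:
  fixes S :: "real^'n^'m"
  assumes "f \<in> borel_measurable M"
  shows "(\<lambda>w. S *v f w) \<in> borel_measurable M"
  by (rule measurable_compose[OF assms])
    (intro borel_measurable_continuous_onI linear_continuous_on matrix_vector_mul_bounded_linear)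

lemma measurable_Sform [measurable]:
  assumes "f \<in> borel_measurable M" "g \<in> borel_measurable M"
  shows "(\<lambda>x. Sform S (f x) (g x)) \<in> borel_measurable M"
  unfolding Sform_def by (intro borel_measurable_inner measurable_matrix_vector assms)

lemma borel_measurable_fst_snd:
  "(fst :: 'a::second_countable_topology \<times> 'b::second_countable_topology \<Rightarrow> 'a) \<in> borel_measurable borel"
  "(snd :: 'a::second_countable_topology \<times> 'b::second_countable_topology \<Rightarrow> 'b) \<in> borel_measurable borel"
  by (intro borel_measurable_continuous_onI continuous_intros)+

lemma borel_measurable_vecI:
  fixes f :: "'w \<Rightarrow> real^'n"
  assumes "\<And>i. (\<lambda>w. f w $ i) \<in> borel_measurable M"
  shows "f \<in> borel_measurable M"
proof (subst borel_measurable_euclidean_space, intro ballI)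
  fix b :: "real^'n" assume "b \<in> Basis"
  then obtain i where "b = axis i 1" by (auto simp: Basis_vec_def)
  then show "(\<lambda>w. f w \<bullet> b) \<in> borel_measurable M" using assms[of i] by (simp add: inner_axis)
qed

text \<open>The affine function of \<open>y\<close> that is tangent to \<open>S(y,y)/2\<close> at \<open>x\<close>.\<close>
abbreviation tang :: "real^'n^'n \<Rightarrow> real^'n \<Rightarrow> real^'n \<Rightarrow> real" where
  "tang S x y \<equiv> Sform S x y - Sform S x x / 2"

text \<open>Completing the square: two points are monotonically related exactly when the tangent at
  either one stays below the form at the other.\<close>

lemma tang_eq:
  assumes "transpose S = S"
  shows "tang S x y = Sform S y y / 2 - Sform S (x - y) (x - y) / 2"
  using Sform_commute[OF assms, of x y] by (simp add: Sform_simps field_simps)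

text \<open>Adjoining \<open>x\<close> keeps the set monotone, so maximality leaves no room for it
  outside \<open>G\<close>. Later uses of maximality all go through this membership test.\<close>

lemma maxmon_memI:
  assumes "G \<in> maxmon S" "\<And>g. g \<in> G \<Longrightarrow> Sform S (x - g) (x - g) \<ge> 0"
  shows "x \<in> G"
proof -
  have "S_monotone S (insert x G)"
    unfolding S_monotone_def
  proof (intro ballI)
    fix a b assume "a \<in> insert x G" "b \<in> insert x G"
    then consider "a = x" "b = x" | "a = x" "b \<in> G" | "a \<in> G" "b = x" | "a \<in> G" "b \<in> G" by blast
    then show "Sform S (a - b) (a - b) \<ge> 0"
    proof cases
      case 3
      then show ?thesis using assms(2)[of a] Sform_diff_commute[of S a b] by simp
    qed (use assms in \<open>auto simp: Sform_zero_left maxmon_def S_monotone_def\<close>)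
  qed
  then have "insert x G = G" using assms(1) unfolding maxmon_def by blast
  then show ?thesis by blast
qed

lemma maxmon_nonempty: "G \<in> maxmon S \<Longrightarrow> G \<noteq> {}"
  using maxmon_memI[of G S undefined] by auto

lemma maxmon_monotone: "G \<in> maxmon S \<Longrightarrow> x \<in> G \<Longrightarrow> y \<in> G \<Longrightarrow> Sform S (x - y) (x - y) \<ge> 0"
  unfolding maxmon_def S_monotone_def by blast

lemma closed_maxmon:
  assumes "G \<in> maxmon S"
  shows "closed G"
proof (unfold closed_sequential_limits, intro allI impI, elim conjE)
  fix x l assume x: "\<forall>n::nat. x n \<in> G" "x \<longlonglongrightarrow> l"
  show "l \<in> G"
  proof (rule maxmon_memI[OF assms])
    fix g assume "g \<in> G"
    have "(\<lambda>n. Sform S (x n - g) (x n - g)) \<longlonglongrightarrow> Sform S (l - g) (l - g)"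
      by (intro tendsto_intros x)
    then show "Sform S (l - g) (l - g) \<ge> 0"
      by (rule LIMSEQ_le_const) (use x \<open>g \<in> G\<close> maxmon_monotone[OF assms] in blast)
  qed
qed

text \<open>This is q <= psi_G with an explicit point: outside \<open>G\<close>, maximality supplies
  \<open>g\<close> with \<open>S(y-g,y-g)\<close> negative, and then the tangent at \<open>g\<close>
  exceeds the form at \<open>y\<close>.\<close>

lemma maxmon_tang_above:
  assumes "transpose S = S" "G \<in> maxmon S"
  shows "\<exists>g\<in>G. Sform S y y / 2 \<le> tang S g y"
proof (cases "y \<in> G")
  case True
  then show ?thesis by (intro bexI[of _ y]) auto
next
  case False
  then obtain g where "g \<in> G" "Sform S (y - g) (y - g) < 0"
    using maxmon_memI[OF assms(2)] by (meson not_le)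
  then show ?thesis
    using tang_eq[OF assms(1), of g y] by (intro bexI[of _ g]) (auto simp: Sform_simps)
qed

text \<open>\<open>G\<close> is the contact set of q and psi_G. Membership thereby becomes a family
  of inequalities that are continuous in \<open>g\<close> and can be checked on a countable dense
  subset.\<close>

lemma maxmon_mem_iff:
  assumes "transpose S = S" "G \<in> maxmon S"
  shows "y \<in> G \<longleftrightarrow> (\<forall>g\<in>G. tang S g y \<le> Sform S y y / 2)"
proof -
  have "tang S g y \<le> Sform S y y / 2 \<longleftrightarrow> Sform S (y - g) (y - g) \<ge> 0" for g
    using tang_eq[OF assms(1), of g y] by (auto simp: Sform_simps)
  then show ?thesis
    using maxmon_memI[OF assms(2)] maxmon_monotone[OF assms(2)] by blast
qed

section \<open>Maximal monotone sets below a convex set\<close>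

text \<open>Take an orthonormal family of negative vectors of largest cardinality, which
  independence bounds. An orthogonal vector with negative square could be normalized and added. The
  family stands in for a diagonalization of \<open>S\<close>: it splits off the directions in which
  the form is negative.\<close>

lemma maximal_neg_orthonormal:
  fixes S :: "real^'n^'n"
  assumes sym: "transpose S = S"
  shows "\<exists>B. finite B \<and> (\<forall>e\<in>B. Sform S e e = -1) \<and> (\<forall>e\<in>B. \<forall>f\<in>B. e \<noteq> f \<longrightarrow> Sform S e f = 0)
    \<and> (\<forall>a. (\<forall>e\<in>B. Sform S a e = 0) \<longrightarrow> Sform S a a \<ge> 0)"
proof -
  define P where "P B \<longleftrightarrow> finite B \<and> (\<forall>e\<in>B. Sform S e e = -1) \<and> (\<forall>e\<in>B. \<forall>f\<in>B. e \<noteq> f \<longrightarrow> Sform S e f = 0)" for B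
  have bound: "card B \<le> DIM(real^'n)" if PB: "P B" for B
  proof -
    have "independent B"
    proof (rule ccontr)
      assume "\<not> independent B"
      then have "dependent B" by simp
      then obtain u where u: "(\<Sum>v\<in>B. u v *\<^sub>R v) = 0" and nz: "\<exists>v\<in>B. u v \<noteq> 0"
        using PB dependent_finite[of B] unfolding P_def by blast
      obtain v where v: "v \<in> B" "u v \<noteq> 0" using nz by blast
      have "0 = Sform S (\<Sum>v\<in>B. u v *\<^sub>R v) v" by (simp add: u Sform_simps)
      also have "\<dots> = (\<Sum>w\<in>B. u w * Sform S w v)" by (simp add: Sform_sum_left Sform_simps)
      also have "\<dots> = (\<Sum>w\<in>B. if w = v then - u v else 0)"
        using that v unfolding P_def by (intro sum.cong) auto
      also have "\<dots> = - u v" using that v unfolding P_def by simp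
      finally show False using v by simp
    qed
    then show ?thesis using independent_bound by blast
  qed
  have "P {}" by (simp add: P_def)
  then obtain B where B: "P B" and max: "\<And>B'. P B' \<Longrightarrow> card B' \<le> card B"
    using ex_has_greatest_nat[of P "{}" card "Suc (DIM(real^'n))"] bound by (metis less_Suc_eq_le)
  have "Sform S a a \<ge> 0" if a: "\<forall>e\<in>B. Sform S a e = 0" for a
    proof (rule ccontr)
      assume neg: "\<not> ?thesis"
      define c where "c = 1 / sqrt (- Sform S a a)"
      have c: "c * c * Sform S a a = -1" "c \<noteq> 0"
        using neg by (auto simp: c_def field_simps)
      have "c *\<^sub>R a \<notin> B"
        using bspec[OF a, of "c *\<^sub>R a"] c neg by (auto simp: Sform_simps)
      moreover have "P (insert (c *\<^sub>R a) B)"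
      proof -
        have "Sform S e a = 0" if "e \<in> B" for e
          using a that Sform_commute[OF sym, of e a] by simp
        then show ?thesis using B a c unfolding P_def by (auto simp: Sform_simps)
      qed
      ultimately show False using max[of "insert (c *\<^sub>R a) B"] B unfolding P_def by auto
    qed
  then show ?thesis using B unfolding P_def by blast
qed

text \<open>A maximal convex \<open>E\<close> above the form contains the contact point of each
  tangent below it, which makes the set \<open>T\<close> of such tangents monotone. \<open>T\<close>
  is maximal because every translate of the negative span contains one of its points, found by
  separation.\<close>

theorem exists_maxmon_below:
  fixes S :: "real^'n^'n" and E0 :: "((real^'n) \<times> real) set"
  assumes sym: "transpose S = S" and "convex E0" "E0 \<noteq> {}"
    and above: "\<And>y r. (y, r) \<in> E0 \<Longrightarrow> Sform S y y / 2 \<le> r"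
  shows "\<exists>G\<in>maxmon S. \<forall>x\<in>G. \<forall>(y, r)\<in>E0. tang S x y \<le> r"
proof -
  define \<E> where "\<E> = {E. convex E \<and> E0 \<subseteq> E \<and> (\<forall>(y, r)\<in>E. Sform S y y / 2 \<le> r)}"
  have "\<exists>E\<in>\<E>. \<forall>X\<in>\<E>. E \<subseteq> X \<longrightarrow> X = E"
  proof (rule subset_Zorn_nonempty)
    show "\<E> \<noteq> {}" using assms unfolding \<E>_def by blast
    fix \<C> assume ne: "\<C> \<noteq> {}" and ch: "subset.chain \<E> \<C>"
    have "convex (\<Union>\<C>)"
    proof (rule convexI)
      fix p1 p2 u v assume p: "p1 \<in> \<Union>\<C>" "p2 \<in> \<Union>\<C>" and uv: "0 \<le> u" "0 \<le> v" "u + v = (1::real)"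
      obtain X1 X2 where X: "X1 \<in> \<C>" "p1 \<in> X1" "X2 \<in> \<C>" "p2 \<in> X2" using p by blast
      then have "X1 \<subseteq> X2 \<or> X2 \<subseteq> X1" using subset.chain_total[OF ch] by blast
      then obtain X where "X \<in> \<C>" "p1 \<in> X" "p2 \<in> X" using X by blast
      moreover have "convex X" using \<open>X \<in> \<C>\<close> ch unfolding subset.chain_def \<E>_def by blast
      ultimately show "u *\<^sub>R p1 + v *\<^sub>R p2 \<in> \<Union>\<C>" using convexD uv by blast
    qed
    then show "\<Union>\<C> \<in> \<E>" using ne ch unfolding \<E>_def subset.chain_def by blast
  qed
  then obtain E where E: "E \<in> \<E>" and maxE: "\<And>X. X \<in> \<E> \<Longrightarrow> E \<subseteq> X \<Longrightarrow> X = E" by blast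
  have cE: "convex E" and E0E: "E0 \<subseteq> E" and Eq: "\<And>y r. (y, r) \<in> E \<Longrightarrow> Sform S y y / 2 \<le> r"
    using E unfolding \<E>_def by auto
  define T where "T = {x. \<forall>(y, r)\<in>E. tang S x y \<le> r}"
  \<comment> \<open>Adjoining the contact point at \<open>x\<close> keeps the convex hull above the
    form: on the segment to \<open>(y', r')\<close> the loss of convexity is made up by the tangent
    inequality at \<open>y'\<close>. Maximality of \<open>E\<close> then puts the point into
    \<open>E\<close>.\<close>
  have TE: "(x, Sform S x x / 2) \<in> E" if "x \<in> T" for x
  proof -
    let ?p = "(x, Sform S x x / 2)"
    have "convex hull (insert ?p E) \<in> \<E>"
      unfolding \<E>_def
    proof (intro CollectI conjI ballI, goal_cases)
      case (3 p)
      obtain y r where p: "p = (y, r)" by fastforce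
      then have "(y, r) \<in> convex hull (insert ?p E)" using 3 by simp
      then obtain u v y' r' where uv: "u \<ge> 0" "v \<ge> 0" "u + v = 1" and y': "(y', r') \<in> E"
        and eq: "(y, r) = u *\<^sub>R ?p + v *\<^sub>R (y', r')"
        using E0E assms(3) cE by (subst (asm) convex_hull_insert) (auto simp: hull_same)
      have y: "y = u *\<^sub>R x + v *\<^sub>R y'" and r: "r = u * (Sform S x x / 2) + v * r'" using eq by auto
      have u: "u = 1 - v" using uv by simp
      have id: "Sform S y y / 2 = u * (Sform S x x / 2) + v * (Sform S y' y' / 2) - u * v * (Sform S (x - y') (x - y') / 2)"
        unfolding y u Sform_simps using Sform_commute[OF sym, of y' x] by (simp add: field_simps)
      have 1: "Sform S y' y' / 2 \<le> r'" using Eq y' by blast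
      have 2: "Sform S y' y' / 2 - Sform S (x - y') (x - y') / 2 \<le> r'"
        using that y' tang_eq[OF sym, of x y'] unfolding T_def by fastforce
      \<comment> \<open>The two lower bounds for \<open>r'\<close> are combined with the weights
        \<open>u\<close> and \<open>v\<close> of the segment itself; multiplied by \<open>v\<close>,
        the result contains exactly the defect term of \<open>id\<close>.\<close>
      have "u * (Sform S y' y' / 2 - Sform S (x - y') (x - y') / 2) + v * (Sform S y' y' / 2) \<le> u * r' + v * r'"
        using 1 2 uv by (intro add_mono mult_left_mono) auto
      then have 3: "Sform S y' y' / 2 - u * (Sform S (x - y') (x - y') / 2) \<le> r'"
        unfolding u by (simp add: field_simps)
      have "v * (Sform S y' y' / 2 - u * (Sform S (x - y') (x - y') / 2)) \<le> v * r'"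
        using 3 uv by (intro mult_left_mono) auto
      then show ?case unfolding p split id r by (simp add: algebra_simps)
    qed (use E0E hull_subset[of "insert ?p E" convex] in auto)
    then have "convex hull (insert ?p E) = E"
      by (rule maxE) (meson hull_subset insert_subset)
    then show ?thesis by (metis hull_inc insertI1)
  qed
  have monT: "Sform S (x - y) (x - y) \<ge> 0" if "x \<in> T" "y \<in> T" for x y
  proof -
    have "tang S y x \<le> Sform S x x / 2" using that(2) TE[OF that(1)] unfolding T_def by fast
    then show ?thesis using tang_eq[OF sym, of y x] by (simp add: Sform_simps)
  qed
  obtain B where B: "finite B" "\<forall>e\<in>B. Sform S e e = -1"
    "\<forall>e\<in>B. \<forall>f\<in>B. e \<noteq> f \<longrightarrow> Sform S e f = 0"
    and Bmax: "\<forall>a. (\<forall>e\<in>B. Sform S a e = 0) \<longrightarrow> Sform S a a \<ge> 0"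
    using maximal_neg_orthonormal[OF sym] by (elim exE conjE)
  define comb where "comb c = (\<Sum>e\<in>B. c e *\<^sub>R e)" for c :: "real^'n \<Rightarrow> real"
  have S_comb: "Sform S (comb c) e = - c e" if "e \<in> B" for c e
  proof -
    have "Sform S (comb c) e = (\<Sum>f\<in>B. if f = e then - c e else 0)"
      unfolding comb_def Sform_sum_left Sform_scaleR_left using B that by (intro sum.cong) auto
    then show ?thesis using B that by simp
  qed
  have S_comb2: "Sform S (comb c) (comb d) = - (\<Sum>e\<in>B. c e * d e)" for c d
  proof -
    have "Sform S (comb c) (comb d) = (\<Sum>e\<in>B. d e * Sform S (comb c) e)"
      by (subst (2) comb_def) (simp add: Sform_sum_right Sform_simps)
    also have "\<dots> = (\<Sum>e\<in>B. - (c e * d e))" by (intro sum.cong) (auto simp: S_comb)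
    finally show ?thesis by (simp add: sum_negf)
  qed
  \<comment> \<open>The \<open>S\<close>-orthogonal projection onto the span of \<open>B\<close>;
    the minus sign compensates \<open>S(e,e) = -1\<close>.\<close>
  define pr where "pr y = comb (\<lambda>e. - Sform S y e)" for y
  have pr_lin: "pr (u *\<^sub>R x + v *\<^sub>R y) = u *\<^sub>R pr x + v *\<^sub>R pr y" for u v x y
    unfolding pr_def comb_def
    by (simp add: scaleR_sum_right sum.distrib[symmetric] Sform_simps algebra_simps)
  have S_pr_comb: "Sform S (pr y) (comb c) = Sform S y (comb c)" for y c
  proof -
    have "Sform S (pr y) e = Sform S y e" if "e \<in> B" for e unfolding pr_def using S_comb[OF that] by simp
    then show ?thesis unfolding comb_def[of c] by (simp add: Sform_sum_right Sform_simps)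
  qed
  have q_pr: "Sform S (pr y) (pr y) \<le> Sform S y y" for y
  proof -
    have "Sform S (y - pr y) (y - pr y) \<ge> 0"
      by (rule Bmax[rule_format]) (simp add: Sform_diff_left pr_def S_comb)
    moreover have "Sform S y (pr y) = Sform S (pr y) (pr y)" using S_pr_comb unfolding pr_def by metis
    ultimately show ?thesis using Sform_commute[OF sym, of y "pr y"] by (simp add: Sform_simps)
  qed
  have pr_pr: "pr (pr y) = pr y" for y
    unfolding pr_def by (subst (1 2) comb_def) (rule sum.cong, auto simp: S_comb)
  \<comment> \<open>For \<open>v\<close> in the negative span, subtracting the tangent at
    \<open>z\<close> turns the claim that \<open>z + v\<close> lies in \<open>T\<close> into: the
    affine function \<open>S(v, b) - q(v)\<close> of \<open>b = pr (y - z)\<close> lies below the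
    shifted heights. Such a function is found between the concave form on the negative span and the
    image of \<open>E\<close>.\<close>
  have full: "\<exists>c. z + comb c \<in> T" for z
  proof -
    define aff where "aff = (\<lambda>(y, r). (pr (y - z), r - Sform S z z / 2 - Sform S z (y - z)))"
    define A where "A = aff ` E"
    \<comment> \<open>The strict hypograph is disjoint from \<open>A\<close> even where the heights
      touch. It is convex because the form is nonpositive on the range of \<open>pr\<close>.\<close>
    define C where "C = {(b, s). s < Sform S (pr b) (pr b) / 2}"
    have "convex A"
    proof (rule convexI)
      fix p1 p2 u v assume "p1 \<in> A" "p2 \<in> A" and uv: "0 \<le> u" "0 \<le> v" "u + v = (1::real)"
      then obtain y1 r1 y2 r2 where e: "(y1, r1) \<in> E" "(y2, r2) \<in> E" "p1 = aff (y1, r1)" "p2 = aff (y2, r2)"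
        unfolding A_def by auto
      have "(u *\<^sub>R y1 + v *\<^sub>R y2, u * r1 + v * r2) \<in> E"
        using convexD[OF cE e(1,2) uv] by simp
      moreover have "u *\<^sub>R p1 + v *\<^sub>R p2 = aff (u *\<^sub>R y1 + v *\<^sub>R y2, u * r1 + v * r2)"
      proof -
        have u: "u = 1 - v" using uv by simp
        have z: "u *\<^sub>R y1 + v *\<^sub>R y2 - z = u *\<^sub>R (y1 - z) + v *\<^sub>R (y2 - z)"
          unfolding u by (simp add: algebra_simps)
        have "r + Sform S z z / 2 = u * Sform S z z / 2 + v * Sform S z z / 2 + r" for r
          unfolding u by (simp add: algebra_simps diff_divide_distrib)
        then show ?thesis unfolding e aff_def split z pr_lin
          by (simp add: Sform_simps algebra_simps)
      qed
      ultimately show "u *\<^sub>R p1 + v *\<^sub>R p2 \<in> A" unfolding A_def by blast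
    qed
    moreover have "convex C"
    proof (rule convexI)
      fix p1 p2 u v assume p: "p1 \<in> C" "p2 \<in> C" and uv: "0 \<le> u" "0 \<le> v" "u + v = (1::real)"
      obtain b1 s1 b2 s2 where e: "p1 = (b1, s1)" "p2 = (b2, s2)" by fastforce
      have lt: "s1 < Sform S (pr b1) (pr b1) / 2" "s2 < Sform S (pr b2) (pr b2) / 2"
        using p unfolding e C_def by auto
      have u: "u = 1 - v" using uv by simp
      have "Sform S (pr b1 - pr b2) (pr b1 - pr b2) \<le> 0"
      proof -
        have "pr b1 - pr b2 = comb (\<lambda>e. Sform S b2 e - Sform S b1 e)"
          unfolding pr_def comb_def by (simp add: sum_subtractf[symmetric] algebra_simps)
        then show ?thesis by (simp add: S_comb2 sum_nonneg)
      qed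
      then have "u * v * (Sform S (pr b1 - pr b2) (pr b1 - pr b2) / 2) \<le> 0"
        using uv by (simp add: mult_nonneg_nonpos divide_le_0_iff)
      moreover have "u * s1 + v * s2 < u * (Sform S (pr b1) (pr b1) / 2) + v * (Sform S (pr b2) (pr b2) / 2)"
      proof (cases "v = 0")
        case False
        have "u * s1 \<le> u * (Sform S (pr b1) (pr b1) / 2)" using lt(1) uv by (intro mult_left_mono) auto
        moreover have "v * s2 < v * (Sform S (pr b2) (pr b2) / 2)"
          using lt(2) uv False by (intro mult_strict_left_mono) auto
        ultimately show ?thesis by linarith
      qed (use lt u in auto)
      moreover have "Sform S (pr (u *\<^sub>R b1 + v *\<^sub>R b2)) (pr (u *\<^sub>R b1 + v *\<^sub>R b2)) / 2
         = u * (Sform S (pr b1) (pr b1) / 2) + v * (Sform S (pr b2) (pr b2) / 2)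
           - u * v * (Sform S (pr b1 - pr b2) (pr b1 - pr b2) / 2)"
        unfolding pr_lin u Sform_simps using Sform_commute[OF sym, of "pr b2" "pr b1"]
        by (simp add: field_simps)
      ultimately show "u *\<^sub>R p1 + v *\<^sub>R p2 \<in> C" unfolding e C_def by simp
    qed
    moreover have "A \<noteq> {}" using E0E assms(3) unfolding A_def by blast
    moreover have "(0, - 1) \<in> C" unfolding C_def by (simp add: pr_def S_comb2 Sform_simps)
    moreover have "C \<inter> A = {}"
    proof (rule ccontr)
      assume "C \<inter> A \<noteq> {}"
      then obtain y r where "(y, r) \<in> E" and c: "aff (y, r) \<in> C" unfolding A_def by auto
      have "Sform S y y / 2 \<le> r" using Eq \<open>(y, r) \<in> E\<close> by blast
      moreover have "Sform S y y / 2 - Sform S z z / 2 - Sform S z (y - z) = Sform S (y - z) (y - z) / 2"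
        using Sform_commute[OF sym, of z y] by (simp add: Sform_simps field_simps)
      ultimately show False using c q_pr[of "y - z"] unfolding C_def aff_def by (simp add: pr_pr)
    qed
    ultimately obtain a \<beta> where a0: "a \<noteq> 0" and aC: "\<And>p. p \<in> C \<Longrightarrow> a \<bullet> p \<le> \<beta>" and aA: "\<And>p. p \<in> A \<Longrightarrow> \<beta> \<le> a \<bullet> p"
      using separating_hyperplane_sets[of C A] by blast
    obtain w c where a: "a = (w, c)" by fastforce
    have cw: "w \<bullet> b + c * s \<le> \<beta>" if "s < Sform S (pr b) (pr b) / 2" for b s
      using aC[of "(b, s)"] that unfolding C_def a by simp
    \<comment> \<open>\<open>C\<close> contains a downward ray over \<open>0\<close>, so
      \<open>c * s\<close> stays bounded above as \<open>s\<close> tends to minus infinity;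
      \<open>\<bar>\<beta>\<bar> + 1\<close> is just a value beyond \<open>\<beta>\<close>.\<close>
    have c0: "c \<ge> 0"
    proof (rule ccontr)
      assume "\<not> c \<ge> 0"
      then have *: "c * ((\<bar>\<beta>\<bar> + 1) / c) = \<bar>\<beta>\<bar> + 1" "(\<bar>\<beta>\<bar> + 1) / c < 0"
        by (auto simp: field_simps)
      have "c * ((\<bar>\<beta>\<bar> + 1) / c) \<le> \<beta>"
        using cw[of "(\<bar>\<beta>\<bar> + 1) / c" 0] * by (simp add: pr_def S_comb2 Sform_simps)
      then show False using * by simp
    qed
    \<comment> \<open>A vertical hyperplane cannot separate: \<open>C\<close> projects onto the
      whole space, on which \<open>w\<close> would be bounded above.\<close>
    have "c \<noteq> 0"
    proof
      assume c: "c = 0"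
      then have "w \<noteq> 0" using a0 a by (auto simp: zero_prod_def)
      have *: "w \<bullet> (((\<bar>\<beta>\<bar> + 1) / (w \<bullet> w)) *\<^sub>R w) = \<bar>\<beta>\<bar> + 1" using \<open>w \<noteq> 0\<close> by simp
      have "w \<bullet> b \<le> \<beta>" for b using cw[of "Sform S (pr b) (pr b) / 2 - 1" b] c by simp
      from this[of "((\<bar>\<beta>\<bar> + 1) / (w \<bullet> w)) *\<^sub>R w"] show False unfolding * by simp
    qed
    then have c: "c > 0" using c0 by simp
    \<comment> \<open>Represents the slope \<open>- w / c\<close> through \<open>S\<close> on the
      negative span; at this point the concave function \<open>w . b + c * q(pr b)\<close> is
      largest.\<close>
    define v where "v = comb (\<lambda>e. (w /\<^sub>R c) \<bullet> e)"
    have S_v: "Sform S (pr b) v = - ((w /\<^sub>R c) \<bullet> pr b)" for b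
    proof -
      have "Sform S (pr b) v = - (\<Sum>e\<in>B. - Sform S b e * ((w /\<^sub>R c) \<bullet> e))"
        unfolding v_def pr_def by (rule S_comb2)
      then show ?thesis by (simp add: pr_def comb_def inner_sum_right sum_negf)
    qed
    have pr_v: "pr v = v"
      unfolding v_def pr_def by (subst (1 3) comb_def) (rule sum.cong, auto simp: S_comb)
    \<comment> \<open>The graph lies outside the strict hypograph, so its point over
      \<open>v\<close> is approached from below at vertical distance
      \<open>\<epsilon> / c\<close>.\<close>
    have "w \<bullet> v + c * (Sform S v v / 2) \<le> \<beta>"
    proof (rule field_le_epsilon)
      fix \<epsilon> :: real assume "\<epsilon> > 0"
      then show "w \<bullet> v + c * (Sform S v v / 2) \<le> \<beta> + \<epsilon>"
        using cw[of "Sform S v v / 2 - \<epsilon> / c" v] c pr_v by (simp add: algebra_simps)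
    qed
    then have bv: "- (Sform S v v / 2) \<le> \<beta> / c"
      using S_v[of v] c unfolding pr_v by (simp add: field_simps)
    have "z + v \<in> T"
      unfolding T_def
    proof (safe)
      fix y r assume yr: "(y, r) \<in> E"
      let ?s = "r - Sform S z z / 2 - Sform S z (y - z)"
      have "\<beta> \<le> w \<bullet> pr (y - z) + c * ?s"
        using aA[of "aff (y, r)"] imageI[OF yr, of aff] unfolding A_def[symmetric] by (simp add: aff_def a)
      then have "\<beta> / c \<le> (w /\<^sub>R c) \<bullet> pr (y - z) + ?s"
        using c by (simp add: field_simps)
      then have "- (Sform S v v / 2) + Sform S (y - z) v \<le> ?s"
        using bv S_v[of "y - z"] S_pr_comb[of "y - z" "\<lambda>e. (w /\<^sub>R c) \<bullet> e"] unfolding v_def[symmetric] by simp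
      then show "tang S (z + v) y \<le> r"
        using Sform_commute[OF sym, of v y] Sform_commute[OF sym, of v z]
        by (simp add: Sform_simps field_simps)
    qed
    then show ?thesis unfolding v_def by blast
  qed
  \<comment> \<open>A point \<open>z\<close> of a monotone superset is compared with the point
    \<open>z + comb c\<close> of \<open>T\<close>: their difference has square
    \<open>- (\<Sum>e\<in>B. c e * c e)\<close>, which is nonnegative only if
    \<open>comb c = 0\<close>, so \<open>z\<close> itself lies in \<open>T\<close>.\<close>
  have "T \<in> maxmon S"
    unfolding maxmon_def S_monotone_def
  proof (safe)
    fix G' z assume mon: "\<forall>x\<in>G'. \<forall>y\<in>G'. 0 \<le> Sform S (x - y) (x - y)" and sub: "T \<subseteq> G'" and z: "z \<in> G'"
    obtain c where c: "z + comb c \<in> T" using full by blast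
    then have "Sform S (comb c) (comb c) \<ge> 0" using mon sub z by (metis add_diff_cancel_left' subsetD)
    then have "(\<Sum>e\<in>B. c e * c e) \<le> 0" by (simp add: S_comb2)
    then have "(\<Sum>e\<in>B. c e * c e) = 0" by (meson antisym sum_nonneg zero_le_square)
    then have "comb c = 0" unfolding comb_def using B(1) by (subst (asm) sum_nonneg_eq_0_iff) auto
    then show "z \<in> T" using c by simp
  qed (use monT in auto)
  moreover have "\<forall>x\<in>T. \<forall>(y, r)\<in>E0. tang S x y \<le> r"
  proof (intro ballI)
    fix x p assume x: "x \<in> T" and p: "p \<in> E0"
    have pE: "p \<in> E" using p E0E by blast
    from x[unfolded T_def mem_Collect_eq] pE show "case p of (y, r) \<Rightarrow> tang S x y \<le> r"
      by (rule bspec)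
  qed
  ultimately show ?thesis by (rule rev_bexI)
qed

section \<open>The singular set\<close>

text \<open>A choice of maximizers represents the conjugate: \<open>m z\<close> is at the same time
  a subgradient at \<open>z\<close>, and all slope estimates below come from this.\<close>

lemma compact_conjugate:
  fixes c :: "'a::euclidean_space \<Rightarrow> real"
  assumes "compact K" "K \<noteq> {}" "continuous_on UNIV c"
  obtains m :: "'a \<Rightarrow> 'a" where "\<And>z. m z \<in> K" "\<And>z x. x \<in> K \<Longrightarrow> x \<bullet> z - c x \<le> m z \<bullet> z - c (m z)"
proof -
  have "\<exists>a\<in>K. \<forall>x\<in>K. x \<bullet> z - c x \<le> a \<bullet> z - c a" for z
    by (intro continuous_attains_sup assms continuous_intros continuous_on_subset[OF assms(3)]) auto
  then have "\<forall>z. \<exists>a. a \<in> K \<and> (\<forall>x\<in>K. x \<bullet> z - c x \<le> a \<bullet> z - c a)" by blast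
  then obtain m where "\<forall>z. m z \<in> K \<and> (\<forall>x\<in>K. x \<bullet> z - c x \<le> m z \<bullet> z - c (m z))"
    by (rule choice[THEN exE])
  then show ?thesis using that[of m] by blast
qed

lemma convex_on_compact_conjugate:
  fixes c :: "'a::euclidean_space \<Rightarrow> real"
    and m :: "'a \<Rightarrow> 'a"
  assumes m: "\<And>z. m z \<in> K" "\<And>z x. x \<in> K \<Longrightarrow> x \<bullet> z - c x \<le> m z \<bullet> z - c (m z)"
  shows "convex_on UNIV (\<lambda>z. m z \<bullet> z - c (m z))"
proof (rule convex_onI)
  fix t :: real and x y :: 'a assume t: "0 < t" "t < 1"
  let ?z = "(1 - t) *\<^sub>R x + t *\<^sub>R y"
  have "m ?z \<bullet> ?z - c (m ?z) = (1 - t) * (m ?z \<bullet> x - c (m ?z)) + t * (m ?z \<bullet> y - c (m ?z))"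
    by (simp add: inner_simps algebra_simps)
  also have "\<dots> \<le> (1 - t) * (m x \<bullet> x - c (m x)) + t * (m y \<bullet> y - c (m y))"
    using t m by (intro add_mono mult_left_mono) auto
  finally show "m ?z \<bullet> ?z - c (m ?z) \<le> (1 - t) * (m x \<bullet> x - c (m x)) + t * (m y \<bullet> y - c (m y))" .
qed auto

lemma linear_dropc: "linear (dropc j)"
  by (rule linearI) (auto simp: dropc_def vec_eq_iff)

lemma dropc_mem_hyp [simp]: "dropc j x \<in> hyp j"
  by (simp add: dropc_def hyp_def)

lemma convex_hyp: "convex (hyp j)"
  by (auto simp: convex_def hyp_def)

lemma dropc_add_axis: "dropc j x + (x $ j) *\<^sub>R axis j 1 = x"
  by (simp add: dropc_def vec_eq_iff axis_def)

text \<open>Composing with the linear map \<open>dropc j\<close> gives finite convex functions on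
  the whole space, which are continuous. The zero sets to which (A1) is applied are therefore
  Borel.\<close>

lemma Hclass_continuous:
  fixes h :: "real^'n \<Rightarrow> real"
  assumes "h \<in> Hclass j C"
  shows "continuous_on UNIV h"
proof -
  obtain g1 g2 :: "real^'n \<Rightarrow> real" where g: "convex_on (hyp j) g1" "convex_on (hyp j) g2"
    and h: "h = (\<lambda>x. x $ j + g1 (dropc j x) - g2 (dropc j x))"
    using assms unfolding Hclass_def by blast
  have *: "continuous_on UNIV (\<lambda>x. g (dropc j x))" if "convex_on (hyp j) g" for g :: "real^'n \<Rightarrow> real"
  proof (rule convex_on_continuous[OF open_UNIV], rule convex_onI)
    fix t :: real and x y :: "real^'n" assume "0 < t" "t < 1"
    then show "g (dropc j ((1 - t) *\<^sub>R x + t *\<^sub>R y)) \<le> (1 - t) * g (dropc j x) + t * g (dropc j y)"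
      using convex_onD[OF that, of t "dropc j x" "dropc j y"]
      by (simp add: linear_add[OF linear_dropc] linear_cmul[OF linear_dropc])
  qed auto
  show ?thesis unfolding h by (intro continuous_intros * g)
qed

text \<open>Write \<open>f\<^sub>A\<close>, \<open>f\<^sub>B\<close> for the conjugates of \<open>c\<close> on \<open>A\<close> and \<open>B\<close>. Along the direction of the \<open>j\<close>-th
  axis the slopes of \<open>f\<^sub>A\<close> are at least \<open>\<beta>\<close> and those of \<open>f\<^sub>B\<close> at most \<open>\<alpha> < \<beta>\<close>. Hence for every
  \<open>\<gamma>\<close> in \<open>[\<alpha>, \<beta>]\<close> the minimum over \<open>t\<close> of \<open>max f\<^sub>A f\<^sub>B (z + t e) - \<gamma> t\<close> is attained at the
  unique \<open>t = \<phi>(z)\<close> with \<open>f\<^sub>A = f\<^sub>B\<close>. These minima \<open>g \<gamma> z\<close> are convex in \<open>z\<close> and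
  \<open>\<phi> = (g \<alpha> - g \<beta>) / (\<beta> - \<alpha>)\<close>.\<close>

lemma coincidence_set_Hclass:
  fixes A B :: "(real^'n) set" and c :: "real^'n \<Rightarrow> real"
  assumes A: "compact A" "A \<noteq> {}" and B: "compact B" "B \<noteq> {}" and c: "continuous_on UNIV c"
    and sep: "\<And>a b. a \<in> A \<Longrightarrow> b \<in> B \<Longrightarrow> b $ j < a $ j"
  shows "\<exists>h\<in>Hclass j ((\<lambda>(a, b). (a - b) /\<^sub>R (a $ j - b $ j)) ` (A \<times> B)). \<forall>z. \<forall>a\<in>A. \<forall>b\<in>B.
      (\<forall>x\<in>A \<union> B. x \<bullet> z - c x \<le> a \<bullet> z - c a) \<longrightarrow> (\<forall>x\<in>A \<union> B. x \<bullet> z - c x \<le> b \<bullet> z - c b) \<longrightarrow> h z = 0"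
proof -
  obtain mA where mA: "\<And>z. mA z \<in> A" "\<And>z x. x \<in> A \<Longrightarrow> x \<bullet> z - c x \<le> mA z \<bullet> z - c (mA z)"
    using compact_conjugate[OF A c] by blast
  obtain mB where mB: "\<And>z. mB z \<in> B" "\<And>z x. x \<in> B \<Longrightarrow> x \<bullet> z - c x \<le> mB z \<bullet> z - c (mB z)"
    using compact_conjugate[OF B c] by blast
  define fA where "fA z = mA z \<bullet> z - c (mA z)" for z
  define fB where "fB z = mB z \<bullet> z - c (mB z)" for z
  have cvA: "convex_on UNIV fA" unfolding fA_def by (rule convex_on_compact_conjugate[OF mA])
  have cvB: "convex_on UNIV fB" unfolding fB_def by (rule convex_on_compact_conjugate[OF mB])
  have ctA: "continuous_on UNIV fA" "continuous_on UNIV fB"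
    using cvA cvB convex_on_continuous[OF open_UNIV] by auto
  have A_le: "x \<bullet> z - c x \<le> fA z" if "x \<in> A" for x z using mA(2)[OF that] by (simp add: fA_def)
  have B_le: "x \<bullet> z - c x \<le> fB z" if "x \<in> B" for x z using mB(2)[OF that] by (simp add: fB_def)
  \<comment> \<open>The extreme coordinates: \<open>\<beta>\<close> is the least slope available in
    \<open>A\<close>, \<open>\<alpha>\<close> the greatest in \<open>B\<close>, and both are
    attained, so a gap remains between them.\<close>
  obtain a0 where a0: "a0 \<in> A" "\<And>a. a \<in> A \<Longrightarrow> a0 $ j \<le> a $ j"
    using continuous_attains_inf[OF A continuous_on_component[OF continuous_on_id], of j] by blast
  obtain b0 where b0: "b0 \<in> B" "\<And>b. b \<in> B \<Longrightarrow> b $ j \<le> b0 $ j"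
    using continuous_attains_sup[OF B continuous_on_component[OF continuous_on_id], of j] by blast
  define \<alpha> where "\<alpha> = b0 $ j"
  define \<beta> where "\<beta> = a0 $ j"
  have \<alpha>\<beta>: "\<alpha> < \<beta>" unfolding \<alpha>_def \<beta>_def using sep a0 b0 by blast
  define e :: "real^'n" where "e = axis j 1"
  have inner_e: "x \<bullet> e = x $ j" for x by (simp add: e_def inner_axis)
  have slopeA: "fA (z + s *\<^sub>R e) + \<beta> * (t - s) \<le> fA (z + t *\<^sub>R e)" if "s \<le> t" for z s t
  proof -
    let ?m = "mA (z + s *\<^sub>R e)"
    have "fA (z + s *\<^sub>R e) + \<beta> * (t - s) \<le> fA (z + s *\<^sub>R e) + ?m $ j * (t - s)"
      using that a0(2)[OF mA(1)] by (auto simp: \<beta>_def intro!: mult_right_mono)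
    also have "\<dots> = ?m \<bullet> (z + t *\<^sub>R e) - c ?m"
      by (simp add: fA_def inner_simps inner_e algebra_simps)
    also have "\<dots> \<le> fA (z + t *\<^sub>R e)" by (rule A_le[OF mA(1)])
    finally show ?thesis .
  qed
  have slopeB: "fB (z + t *\<^sub>R e) \<le> fB (z + s *\<^sub>R e) + \<alpha> * (t - s)" if "s \<le> t" for z s t
  proof -
    let ?m = "mB (z + t *\<^sub>R e)"
    have "fB (z + t *\<^sub>R e) = ?m \<bullet> (z + s *\<^sub>R e) - c ?m + ?m $ j * (t - s)"
      by (simp add: fB_def inner_simps inner_e algebra_simps)
    also have "\<dots> \<le> fB (z + s *\<^sub>R e) + \<alpha> * (t - s)"
      using that b0(2)[OF mB(1)] B_le[OF mB(1)] by (intro add_mono mult_right_mono) (auto simp: \<alpha>_def)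
    finally show ?thesis .
  qed
  define D where "D z t = fA (z + t *\<^sub>R e) - fB (z + t *\<^sub>R e)" for z t
  have slopeD: "D z s + (\<beta> - \<alpha>) * (t - s) \<le> D z t" if "s \<le> t" for z s t
    using slopeA[OF that, of z] slopeB[OF that, of z] by (simp add: D_def algebra_simps)
  have "\<exists>t. D z t = 0" for z
  proof -
    \<comment> \<open>\<open>D z\<close> grows at rate at least \<open>\<beta> - \<alpha>\<close>,
      so its zero lies within this distance of \<open>0\<close>.\<close>
    define T where "T = \<bar>D z 0\<bar> / (\<beta> - \<alpha>)"
    have T: "T \<ge> 0" "(\<beta> - \<alpha>) * T = \<bar>D z 0\<bar>" using \<alpha>\<beta> by (auto simp: T_def)
    have "D z (- T) \<le> 0" using slopeD[of "-T" 0 z] T by simp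
    moreover have "0 \<le> D z T" using slopeD[of 0 T z] T by simp
    moreover have "continuous_on {-T..T} (D z)"
      unfolding D_def by (intro continuous_intros continuous_on_compose2[OF ctA(1)] continuous_on_compose2[OF ctA(2)]) auto
    ultimately show ?thesis using IVT'[of "D z" "-T" 0 T] T by auto
  qed
  then obtain \<phi> where \<phi>: "\<And>z. D z (\<phi> z) = 0" by metis
  have \<phi>_unique: "t = \<phi> z" if "D z t = 0" for z t
  proof (rule ccontr)
    assume "t \<noteq> \<phi> z"
    then consider "t < \<phi> z" | "\<phi> z < t" by linarith
    then show False
    proof cases
      case 1
      then have "(\<beta> - \<alpha>) * (\<phi> z - t) > 0" using \<alpha>\<beta> by simp
      then show False using slopeD[of t "\<phi> z" z] 1 that \<phi>[of z] by simp
    next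
      case 2
      then have "(\<beta> - \<alpha>) * (t - \<phi> z) > 0" using \<alpha>\<beta> by simp
      then show False using slopeD[of "\<phi> z" t z] 2 that \<phi>[of z] by simp
    qed
  qed
  define p where "p z = z + \<phi> z *\<^sub>R e" for z
  have AB_p: "fA (p z) = fB (p z)" for z using \<phi>[of z] by (simp add: D_def p_def)
  define g where "g \<gamma> z = fA (p z) - \<gamma> * \<phi> z" for \<gamma> z
  define F where "F z = max (fA z) (fB z)" for z
  have cvF: "convex_on UNIV F"
    unfolding convex_on_def F_def
  proof (safe, simp, rule max.boundedI)
    fix x y and u v :: real assume uv: "0 \<le> u" "0 \<le> v" "u + v = 1"
    have le: "u * f x + v * f y \<le> u * max (fA x) (fB x) + v * max (fA y) (fB y)"
      if "f = fA \<or> f = fB" for f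
      using that uv by (intro add_mono mult_left_mono) auto
    have "fA (u *\<^sub>R x + v *\<^sub>R y) \<le> u * fA x + v * fA y"
      "fB (u *\<^sub>R x + v *\<^sub>R y) \<le> u * fB x + v * fB y"
      using cvA cvB uv unfolding convex_on_def by auto
    then show "fA (u *\<^sub>R x + v *\<^sub>R y) \<le> u * max (fA x) (fB x) + v * max (fA y) (fB y)"
      "fB (u *\<^sub>R x + v *\<^sub>R y) \<le> u * max (fA x) (fB x) + v * max (fA y) (fB y)"
      using le[of fA] le[of fB] by auto
  qed
  \<comment> \<open>Right of \<open>\<phi> z\<close> the slope of \<open>fA\<close> is at least
    \<open>\<beta> \<ge> \<gamma>\<close>, left of it the slope of \<open>fB\<close> is at most
    \<open>\<alpha> \<le> \<gamma>\<close>; the two branches meet at \<open>p z\<close>.\<close>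
  have g_min: "g \<gamma> z \<le> F (z + t *\<^sub>R e) - \<gamma> * t" if "\<alpha> \<le> \<gamma>" "\<gamma> \<le> \<beta>" for \<gamma> z t
  proof (cases "\<phi> z \<le> t")
    case True
    have "\<gamma> * (t - \<phi> z) \<le> \<beta> * (t - \<phi> z)" using True that by (intro mult_right_mono) auto
    moreover have "fA (p z) + \<beta> * (t - \<phi> z) \<le> F (z + t *\<^sub>R e)"
      using slopeA[OF True, of z] by (simp add: p_def F_def)
    ultimately show ?thesis unfolding g_def by (simp add: algebra_simps)
  next
    case False
    have "\<alpha> * (\<phi> z - t) \<le> \<gamma> * (\<phi> z - t)" using False that by (intro mult_right_mono) auto
    moreover have "fB (p z) \<le> F (z + t *\<^sub>R e) + \<alpha> * (\<phi> z - t)"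
      using slopeB[of t "\<phi> z" z] False by (simp add: p_def F_def)
    ultimately show ?thesis unfolding g_def AB_p by (simp add: algebra_simps)
  qed
  \<comment> \<open>The trial height \<open>?s\<close> interpolates the two minimizers, so joint
    convexity of \<open>F\<close> passes to the partial minimum.\<close>
  have cvg: "convex_on (hyp j) (\<lambda>z. g \<gamma> z / (\<beta> - \<alpha>))" if "\<alpha> \<le> \<gamma>" "\<gamma> \<le> \<beta>" for \<gamma>
  proof (rule convex_onI)
    fix t :: real and x y assume t: "0 < t" "t < 1"
    let ?z = "(1 - t) *\<^sub>R x + t *\<^sub>R y" and ?s = "(1 - t) * \<phi> x + t * \<phi> y"
    have "g \<gamma> ?z \<le> F (?z + ?s *\<^sub>R e) - \<gamma> * ?s" by (rule g_min[OF that])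
    also have "?z + ?s *\<^sub>R e = (1 - t) *\<^sub>R p x + t *\<^sub>R p y" by (simp add: p_def algebra_simps)
    also have "F \<dots> \<le> (1 - t) * F (p x) + t * F (p y)"
      using convex_onD[OF cvF, of t "p x" "p y"] t by simp
    finally have "g \<gamma> ?z \<le> (1 - t) * g \<gamma> x + t * g \<gamma> y"
      by (simp add: F_def g_def AB_p algebra_simps)
    then show "g \<gamma> ?z / (\<beta> - \<alpha>) \<le> (1 - t) * (g \<gamma> x / (\<beta> - \<alpha>)) + t * (g \<gamma> y / (\<beta> - \<alpha>))"
      using divide_right_mono[of _ _ "\<beta> - \<alpha>"] \<alpha>\<beta> by (fastforce simp: add_divide_distrib)
  qed (rule convex_hyp)
  obtain L where L: "\<And>x. x \<in> A \<union> B \<Longrightarrow> norm x \<le> L"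
    using compact_imp_bounded[OF compact_Un[OF A(1) B(1)]] unfolding bounded_iff by blast
  have L0: "L \<ge> 0" using order_trans[OF norm_ge_zero L[of a0]] a0(1) by blast
  have in_le: "\<bar>x \<bullet> z\<bar> \<le> L * norm z" if "x \<in> A \<union> B" for x z
    by (rule order_trans[OF Cauchy_Schwarz_ineq2]) (rule mult_right_mono[OF L[OF that] norm_ge_zero])
  define K where "K = \<bar>fA 0\<bar> + \<bar>fB 0\<bar> + L + \<bar>c a0\<bar> + \<bar>c b0\<bar>"
  have growth: "\<bar>g \<gamma> z / (\<beta> - \<alpha>)\<bar> \<le> K / (\<beta> - \<alpha>) * (1 + norm z)" if \<gamma>: "\<gamma> = \<alpha> \<or> \<gamma> = \<beta>" for \<gamma> z
  proof -
    have "fA z \<le> fA 0 + L * norm z" "fB z \<le> fB 0 + L * norm z"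
      using A_le[OF mA(1)[of z], of 0] B_le[OF mB(1)[of z], of 0] in_le[of "mA z" z] in_le[of "mB z" z] mA(1)[of z] mB(1)[of z]
      by (auto simp: fA_def[of z] fB_def[of z])
    \<comment> \<open>The upper bound evaluates the minimum at \<open>t = 0\<close>; the lower bound
      tests with the extreme point whose \<open>j\<close>-th coordinate equals
      \<open>\<gamma>\<close>, so that the unknown \<open>\<phi> z\<close> cancels.\<close>
    then have up: "g \<gamma> z \<le> \<bar>fA 0\<bar> + \<bar>fB 0\<bar> + L * norm z"
      using g_min[of \<gamma> z 0] \<gamma> \<alpha>\<beta> unfolding F_def by auto
    have lo: "g \<gamma> z \<ge> - (\<bar>c a0\<bar> + \<bar>c b0\<bar> + L * norm z)"
    proof (cases "\<gamma> = \<alpha>")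
      case True
      have "b0 \<bullet> z - c b0 \<le> g \<gamma> z"
      proof -
        have "b0 \<bullet> p z = b0 \<bullet> z + \<alpha> * \<phi> z" by (simp add: p_def inner_simps inner_e \<alpha>_def)
        then show ?thesis using B_le[OF b0(1), of "p z"] True unfolding g_def AB_p by simp
      qed
      then show ?thesis using in_le[of b0 z] b0(1) by auto
    next
      case False
      have "a0 \<bullet> z - c a0 \<le> g \<gamma> z"
      proof -
        have "a0 \<bullet> p z = a0 \<bullet> z + \<beta> * \<phi> z" by (simp add: p_def inner_simps inner_e \<beta>_def)
        then show ?thesis using A_le[OF a0(1), of "p z"] False \<gamma> unfolding g_def by simp
      qed
      then show ?thesis using in_le[of a0 z] a0(1) by auto
    qed
    have "\<bar>g \<gamma> z\<bar> \<le> \<bar>fA 0\<bar> + \<bar>fB 0\<bar> + \<bar>c a0\<bar> + \<bar>c b0\<bar> + L * norm z" using up lo by linarith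
    also have "\<dots> \<le> K * (1 + norm z)"
      using L0 by (simp add: K_def algebra_simps)
    finally show ?thesis using \<alpha>\<beta> by (simp add: divide_right_mono abs_divide)
  qed
  define h where "h x = x $ j + g \<beta> (dropc j x) / (\<beta> - \<alpha>) - g \<alpha> (dropc j x) / (\<beta> - \<alpha>)" for x
  have \<phi>_eq: "\<phi> z = g \<alpha> z / (\<beta> - \<alpha>) - g \<beta> z / (\<beta> - \<alpha>)" for z
  proof -
    have "g \<alpha> z - g \<beta> z = (\<beta> - \<alpha>) * \<phi> z" by (simp add: g_def algebra_simps)
    then show ?thesis using \<alpha>\<beta> by (simp add: diff_divide_distrib[symmetric])
  qed
  have h_eq: "h x = x $ j - \<phi> (dropc j x)" for x by (simp add: h_def \<phi>_eq)
  let ?C = "(\<lambda>(a, b). (a - b) /\<^sub>R (a $ j - b $ j)) ` (A \<times> B)"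
  have deriv: "\<exists>D\<in>?C. (h has_derivative (\<lambda>v. D \<bullet> v)) (at x)"
    if diff: "(\<lambda>z. g \<beta> z / (\<beta> - \<alpha>)) differentiable (at (dropc j x) within hyp j)"
      "(\<lambda>z. g \<alpha> z / (\<beta> - \<alpha>)) differentiable (at (dropc j x) within hyp j)" for x
  proof -
    define z where "z = dropc j x"
    have zh: "z \<in> hyp j" by (simp add: z_def)
    have "\<phi> differentiable (at z within hyp j)"
      unfolding \<phi>_eq[abs_def] z_def by (intro differentiable_diff diff)
    then obtain \<phi>' where \<phi>': "(\<phi> has_derivative \<phi>') (at z within hyp j)" unfolding differentiable_def by blast
    \<comment> \<open>The touching argument also needs the common height \<open>fA (p z)\<close>,
      which is recovered from \<open>g \<alpha>\<close> and \<open>\<phi>\<close>.\<close>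
    have "(\<lambda>z. fA (p z)) differentiable (at z within hyp j)"
    proof -
      have "fA (p z) = (\<beta> - \<alpha>) * (g \<alpha> z / (\<beta> - \<alpha>)) + \<alpha> * \<phi> z" for z
        using \<alpha>\<beta> by (simp add: g_def)
      then show ?thesis
        by (simp only:) (intro differentiable_add differentiable_mult differentiable_const
          diff(2)[folded z_def] \<open>\<phi> differentiable _\<close>)
    qed
    then obtain u' where u': "((\<lambda>z. fA (p z)) has_derivative u') (at z within hyp j)"
      by (rule differentiable_def[THEN iffD1, THEN exE])
    \<comment> \<open>The affine function of \<open>a\<close> touches \<open>F\<close> from below at
      \<open>p z\<close>. Along the surface in direction \<open>w\<close> the difference
      \<open>?k\<close> is therefore minimal at \<open>t = 0\<close>, and its derivative vanishes
      there.\<close>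
    have key: "u' w - a $ j * \<phi>' w - a \<bullet> w = 0"
      if w: "w \<in> hyp j" and a: "\<And>y. a \<bullet> y - c a \<le> F y" "a \<bullet> p z - c a = fA (p z)" for a w
    proof -
      have line: "z + t *\<^sub>R w \<in> hyp j" for t using zh w by (simp add: hyp_def)
      have lin: "((\<lambda>t. z + t *\<^sub>R w) has_derivative (\<lambda>t. t *\<^sub>R w)) (at 0)"
        by (auto intro!: derivative_eq_intros)
      have comp: "((\<lambda>t. f (z + t *\<^sub>R w)) has_derivative (\<lambda>t. f' (t *\<^sub>R w))) (at 0)"
        if "(f has_derivative f') (at z within hyp j)" for f :: "real^'n \<Rightarrow> real" and f'
        by (rule has_derivative_in_compose[OF lin])
          (use that line in \<open>auto intro: has_derivative_subset\<close>)
      let ?k = "\<lambda>t. fA (p (z + t *\<^sub>R w)) - a $ j * \<phi> (z + t *\<^sub>R w) - t * (a \<bullet> w)"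
      have "(?k has_derivative (\<lambda>t. u' (t *\<^sub>R w) - a $ j * \<phi>' (t *\<^sub>R w) - t * (a \<bullet> w))) (at 0)"
        by (intro has_derivative_diff has_derivative_mult_right has_derivative_mult_left comp[OF u'] comp[OF \<phi>'] has_derivative_ident)
      moreover have "(\<lambda>t. u' (t *\<^sub>R w) - a $ j * \<phi>' (t *\<^sub>R w) - t * (a \<bullet> w)) = (*) (u' w - a $ j * \<phi>' w - a \<bullet> w)"
        using linear_cmul[OF has_derivative_linear[OF u']] linear_cmul[OF has_derivative_linear[OF \<phi>']]
        by (auto simp: algebra_simps)
      ultimately have k': "(?k has_field_derivative (u' w - a $ j * \<phi>' w - a \<bullet> w)) (at 0)"
        by (simp add: has_field_derivative_def)
      have "?k 0 \<le> ?k t" for t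
      proof -
        have "a \<bullet> p (z + t *\<^sub>R w) - c a \<le> fA (p (z + t *\<^sub>R w))"
          using a(1)[of "p (z + t *\<^sub>R w)"] by (simp add: F_def AB_p)
        moreover have "a \<bullet> p (z + t *\<^sub>R w) = a \<bullet> p z + t * (a \<bullet> w) + a $ j * (\<phi> (z + t *\<^sub>R w) - \<phi> z)"
          by (simp add: p_def inner_simps inner_e algebra_simps)
        ultimately show ?thesis using a(2) by (simp add: algebra_simps)
      qed
      then show ?thesis using DERIV_local_min[OF k' zero_less_one] by blast
    qed
    define a where "a = mA (p z)"
    define b where "b = mB (p z)"
    have ab: "a \<in> A" "b \<in> B" by (simp_all add: a_def b_def mA mB)
    have jlt: "b $ j < a $ j" using sep ab by blast
    define d where "d = (a - b) /\<^sub>R (a $ j - b $ j)"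
    have \<phi>'_d: "- \<phi>' w = d \<bullet> w" if "w \<in> hyp j" for w
    proof -
      have 1: "u' w - a $ j * \<phi>' w - a \<bullet> w = 0"
        by (rule key[OF that]) (use A_le[OF ab(1)] in \<open>auto simp: F_def le_max_iff_disj a_def fA_def\<close>)
      have 2: "u' w - b $ j * \<phi>' w - b \<bullet> w = 0"
        by (rule key[OF that]) (use B_le[OF ab(2)] in \<open>auto simp: F_def le_max_iff_disj AB_p\<close>, simp add: b_def fB_def)
      \<comment> \<open>Subtracting the two touching conditions eliminates \<open>u'\<close> and
        leaves the slope of \<open>\<phi>\<close> in terms of \<open>a - b\<close>.\<close>
      have "(a $ j - b $ j) * (- \<phi>' w) = (a - b) \<bullet> w" using 1 2 by (simp add: algebra_simps)
      then have "- \<phi>' w = (a - b) \<bullet> w / (a $ j - b $ j)"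
        using jlt by (simp add: eq_divide_eq mult.commute)
      then show ?thesis by (simp add: d_def divide_inverse mult.commute)
    qed
    have "(h has_derivative (\<lambda>v. v $ j - \<phi>' (dropc j v))) (at x)"
      unfolding h_eq[abs_def]
    proof (intro has_derivative_diff)
      show "((\<lambda>x. \<phi> (dropc j x)) has_derivative (\<lambda>v. \<phi>' (dropc j v))) (at x)"
        by (rule has_derivative_in_compose[OF linear_imp_has_derivative[OF linear_dropc]])
          (use \<phi>' in \<open>auto simp: z_def intro: has_derivative_subset\<close>)
    qed (rule bounded_linear_imp_has_derivative[OF bounded_linear_vec_nth])
    moreover have "v $ j - \<phi>' (dropc j v) = d \<bullet> v" for v
    proof -
      have "d \<bullet> v = d \<bullet> (dropc j v + (v $ j) *\<^sub>R axis j 1)" by (simp add: dropc_add_axis)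
      also have "\<dots> = d \<bullet> dropc j v + v $ j * d $ j" by (simp add: inner_simps inner_axis)
      also have "d $ j = 1" using jlt by (simp add: d_def)
      finally show ?thesis using \<phi>'_d[of "dropc j v"] by simp
    qed
    ultimately have "(h has_derivative (\<lambda>v. d \<bullet> v)) (at x)" by simp
    moreover have "d \<in> ?C" using ab unfolding d_def by force
    ultimately show ?thesis by blast
  qed
  have "h \<in> Hclass j ?C"
    unfolding Hclass_def mem_Collect_eq
  proof (intro exI conjI)
    show "convex_on (hyp j) (\<lambda>z. g \<beta> z / (\<beta> - \<alpha>))" "convex_on (hyp j) (\<lambda>z. g \<alpha> z / (\<beta> - \<alpha>))"
      using cvg \<alpha>\<beta> by auto
    show "\<forall>z\<in>hyp j. \<bar>g \<beta> z / (\<beta> - \<alpha>)\<bar> \<le> K / (\<beta> - \<alpha>) * (1 + norm z)"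
      "\<forall>z\<in>hyp j. \<bar>g \<alpha> z / (\<beta> - \<alpha>)\<bar> \<le> K / (\<beta> - \<alpha>) * (1 + norm z)"
      using growth by blast+
    show "h = (\<lambda>x. x $ j + g \<beta> (dropc j x) / (\<beta> - \<alpha>) - g \<alpha> (dropc j x) / (\<beta> - \<alpha>))"
      by (rule ext) (rule h_def)
  qed (use deriv in blast)
  moreover have "h z = 0" if "a \<in> A" "b \<in> B" "\<forall>x\<in>A \<union> B. x \<bullet> z - c x \<le> a \<bullet> z - c a"
    "\<forall>x\<in>A \<union> B. x \<bullet> z - c x \<le> b \<bullet> z - c b" for z a b
  proof -
    have "fA z = a \<bullet> z - c a" using that(1,3) A_le[of a z] mA(1)[of z] unfolding fA_def by (intro antisym) auto
    moreover have "fB z = b \<bullet> z - c b" using that(2,4) B_le[of b z] mB(1)[of z] unfolding fB_def by (intro antisym) auto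
    moreover have "a \<bullet> z - c a = b \<bullet> z - c b" using that by (intro antisym) auto
    ultimately have "D (dropc j z) (z $ j) = 0" by (simp add: D_def e_def dropc_add_axis)
    then show ?thesis using \<phi>_unique by (simp add: h_eq)
  qed
  ultimately show ?thesis by blast
qed

text \<open>Both conditions, \<open>b $ j < a $ j\<close> and positivity of
  \<open>S(a-b,a-b)\<close>, are open in \<open>(a, b)\<close>. They persist on small compact
  neighbourhoods, where the quotients of \<open>a - b\<close> by \<open>a $ j - b $ j\<close> form a
  compact set admissible in (A1).\<close>

lemma Sigma1P_negligible:
  fixes S :: "real^'n^'n" and \<nu> :: "(real^'n) measure"
  assumes sym: "transpose S = S" and G: "G \<in> maxmon S" and \<nu>: "sets \<nu> = sets borel"
    and A1: "\<And>j C h. compact C \<Longrightarrow> C \<subseteq> {x. x $ j = 1 \<and> Sform S x x > 0} \<Longrightarrow> h \<in> Hclass j C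
               \<Longrightarrow> AE y in \<nu>. h (S *v y) \<noteq> 0"
  shows "\<exists>N\<in>null_sets \<nu>. Sigma1P S G \<subseteq> N"
proof -
  obtain D :: "(real^'n) set" where D: "countable D" "\<And>X. open X \<Longrightarrow> X \<noteq> {} \<Longrightarrow> \<exists>d\<in>D. d \<in> X"
    using countable_dense_exists by blast
  \<comment> \<open>A countable family of compact sets that contains arbitrarily small ones around
    every point.\<close>
  define \<K> where "\<K> = (\<lambda>(p, n). cball p (inverse (real (Suc n)))) ` (D \<times> (UNIV :: nat set))"
  have cK: "countable \<K>" unfolding \<K>_def using D(1) by auto
  have \<K>: "\<exists>K\<in>\<K>. x \<in> K \<and> K \<subseteq> U" if "open U" "x \<in> U" for x U
  proof -
    obtain r where r: "r > 0" "ball x r \<subseteq> U" using \<open>open U\<close> \<open>x \<in> U\<close> by (meson openE)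
    obtain n where n: "inverse (real (Suc n)) < r / 2" using r reals_Archimedean[of "r/2"] by auto
    obtain p where p: "p \<in> D" "dist x p < inverse (real (Suc n))"
      using D(2)[of "ball x (inverse (real (Suc n)))"] by auto
    have "cball p (inverse (real (Suc n))) \<subseteq> ball x r"
    proof
      fix y assume "y \<in> cball p (inverse (real (Suc n)))"
      then show "y \<in> ball x r" using p n dist_triangle[of x y p] by (simp add: dist_commute)
    qed
    moreover have "x \<in> cball p (inverse (real (Suc n)))" using p by (simp add: dist_commute less_imp_le)
    ultimately show ?thesis using r p unfolding \<K>_def by blast
  qed
  define good where "good = (\<lambda>(j, K1, K2). (\<forall>a\<in>G \<inter> K1. \<forall>b\<in>G \<inter> K2. b $ j < a $ j \<and> Sform S (a - b) (a - b) > 0)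
      \<and> G \<inter> K1 \<noteq> {} \<and> G \<inter> K2 \<noteq> {})"
  define I where "I = {i \<in> UNIV \<times> \<K> \<times> \<K>. good i}"
  have "countable I"
    unfolding I_def by (rule countable_subset[of _ "UNIV \<times> \<K> \<times> \<K>"]) (use cK in \<open>auto intro!: countable_SIGMA\<close>)
  define Z :: "'n \<times> (real^'n) set \<times> (real^'n) set \<Rightarrow> (real^'n) set" where "Z = (\<lambda>(j, K1, K2). {y. \<exists>a\<in>G \<inter> K1. \<exists>b\<in>G \<inter> K2. a \<in> PG S G y \<and> b \<in> PG S G y})"
  have "\<exists>N\<in>null_sets \<nu>. Z i \<subseteq> N" if "i \<in> I" for i
  proof -
    obtain j K1 K2 where i: "i = (j, K1, K2)" by (cases i)
    define A where "A = G \<inter> K1"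
    define B where "B = G \<inter> K2"
    have K: "compact K1" "compact K2" using that unfolding i I_def \<K>_def by auto
    have AB: "compact A" "A \<noteq> {}" "compact B" "B \<noteq> {}"
      using that K closed_maxmon[OF G] unfolding i I_def good_def A_def B_def
      by (auto intro: closed_Int_compact)
    have ab: "b $ j < a $ j" "Sform S (a - b) (a - b) > 0" if "a \<in> A" "b \<in> B" for a b
      using \<open>i \<in> I\<close> that unfolding i I_def good_def A_def B_def by auto
    define C where "C = (\<lambda>(a, b). (a - b) /\<^sub>R (a $ j - b $ j)) ` (A \<times> B)"
    have "\<exists>h\<in>Hclass j C. \<forall>z. \<forall>a\<in>A. \<forall>b\<in>B.
      (\<forall>x\<in>A \<union> B. x \<bullet> z - Sform S x x / 2 \<le> a \<bullet> z - Sform S a a / 2) \<longrightarrow>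
      (\<forall>x\<in>A \<union> B. x \<bullet> z - Sform S x x / 2 \<le> b \<bullet> z - Sform S b b / 2) \<longrightarrow> h z = 0"
      unfolding C_def
      by (rule coincidence_set_Hclass[OF AB]) (use ab(1) in \<open>auto intro!: continuous_intros\<close>)
    then obtain h where h: "h \<in> Hclass j C" and h0: "\<And>z a b. a \<in> A \<Longrightarrow> b \<in> B
        \<Longrightarrow> \<forall>x\<in>A \<union> B. x \<bullet> z - Sform S x x / 2 \<le> a \<bullet> z - Sform S a a / 2
        \<Longrightarrow> \<forall>x\<in>A \<union> B. x \<bullet> z - Sform S x x / 2 \<le> b \<bullet> z - Sform S b b / 2 \<Longrightarrow> h z = 0"
      by metis
    have "compact C"
      unfolding C_def split_beta using ab(1) AB
      by (intro compact_continuous_image continuous_intros compact_Times) fastforce+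
    moreover have "C \<subseteq> {x. x $ j = 1 \<and> Sform S x x > 0}"
      using ab by (fastforce simp: C_def Sform_simps(5,6))
    ultimately have AE: "AE y in \<nu>. h (S *v y) \<noteq> 0" using A1 h by blast
    have hb: "(\<lambda>y. h (S *v y)) \<in> borel_measurable borel"
      by (intro borel_measurable_continuous_onI continuous_on_compose2[OF Hclass_continuous[OF h]]
          linear_continuous_on matrix_vector_mul_bounded_linear) auto
    define N where "N = {y. h (S *v y) = 0}"
    have "N \<in> sets borel" unfolding N_def using hb by measurable
    then have "N \<in> null_sets \<nu>" using AE \<nu> AE_iff_null_sets[of N \<nu>] by (simp add: N_def)
    moreover have "Z i \<subseteq> N"
    proof
      fix y assume "y \<in> Z i"
      then obtain a b where "a \<in> A" "b \<in> B" "a \<in> PG S G y" "b \<in> PG S G y"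
        unfolding i Z_def A_def B_def by auto
      \<comment> \<open>At \<open>S *v y\<close> the Euclidean pairing with \<open>x\<close> is
        \<open>Sform S x y\<close>, so elements of \<open>PG S G y\<close> maximize over
        \<open>A \<union> B\<close> in particular.\<close>
      then show "y \<in> N" unfolding N_def mem_Collect_eq
        by (intro h0[of a b]) (auto simp: PG_def Sform_def A_def B_def)
    qed
    ultimately show ?thesis by blast
  qed
  then obtain N where N: "\<And>i. i \<in> I \<Longrightarrow> N i \<in> null_sets \<nu>" "\<And>i. i \<in> I \<Longrightarrow> Z i \<subseteq> N i" by metis
  have "(\<Union>i\<in>I. N i) \<in> null_sets \<nu>" using \<open>countable I\<close> N(1) by (rule null_sets_UN')
  moreover have "Sigma1P S G \<subseteq> (\<Union>i\<in>I. N i)"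
  proof
    fix y assume "y \<in> Sigma1P S G"
    then obtain y1 y2 where y12: "y1 \<in> PG S G y" "y2 \<in> PG S G y" "Sform S (y1 - y2) (y1 - y2) > 0"
      unfolding Sigma1P_def by blast
    then have "y1 \<noteq> y2" by (auto simp: Sform_simps)
    then obtain j where "y1 $ j \<noteq> y2 $ j" by (auto simp: vec_eq_iff)
    \<comment> \<open>The two points may be interchanged since the square of their difference is
      symmetric; \<open>a\<close> is the one with the larger coordinate.\<close>
    then obtain a b where ab: "a \<in> PG S G y" "b \<in> PG S G y" "Sform S (a - b) (a - b) > 0" "b $ j < a $ j"
      using y12 Sform_diff_commute[of S y1 y2] by (metis linorder_neqE_linordered_idom)
    define O' where "O' = {p. snd p $ j < fst p $ j \<and> Sform S (fst p - snd p) (fst p - snd p) > 0}"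
    have "open O'" unfolding O'_def by (intro open_Collect_conj open_Collect_less continuous_intros)
    moreover have "(a, b) \<in> O'" using ab by (simp add: O'_def)
    ultimately obtain U V where UV: "open U" "open V" "a \<in> U" "b \<in> V" "U \<times> V \<subseteq> O'"
      using open_prod_elim by (metis mem_Sigma_iff)
    obtain K1 K2 where K: "K1 \<in> \<K>" "a \<in> K1" "K1 \<subseteq> U" "K2 \<in> \<K>" "b \<in> K2" "K2 \<subseteq> V"
      using \<K> UV by meson
    have "(j, K1, K2) \<in> I"
    proof -
      have "b' $ j < a' $ j \<and> Sform S (a' - b') (a' - b') > 0" if "a' \<in> G \<inter> K1" "b' \<in> G \<inter> K2" for a' b'
      proof -
        have "(a', b') \<in> O'" using that K UV(5) by blast
        then show ?thesis by (simp add: O'_def)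
      qed
      moreover have "G \<inter> K1 \<noteq> {}" "G \<inter> K2 \<noteq> {}" using K ab unfolding PG_def by blast+
      ultimately have "good (j, K1, K2)" unfolding good_def by blast
      then show ?thesis using K unfolding I_def by blast
    qed
    moreover have "y \<in> Z (j, K1, K2)" using K ab unfolding Z_def PG_def by auto
    ultimately show "y \<in> (\<Union>i\<in>I. N i)" using N(2) by blast
  qed
  ultimately show ?thesis by blast
qed

section \<open>Weak compactness in Euclidean space\<close>

text \<open>The digit is \<open>floor (2 * y) - 2 * floor y\<close> with \<open>y = 2^k * x\<close>,
  so the partial sums telescope to \<open>floor (2^n * x) / 2^n\<close>.\<close>

lemma binary_expansion_sums:
  fixes x :: real
  assumes "0 \<le> x" "x < 1"
  shows "(\<lambda>k. (1/2)^(Suc k) * of_bool (\<lfloor>2^(Suc k) * x\<rfloor> mod 2 = 1)) sums x"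
proof -
  have step: "of_bool (\<lfloor>2 * y\<rfloor> mod 2 = 1) = real_of_int \<lfloor>2 * y\<rfloor> - 2 * real_of_int \<lfloor>y\<rfloor>" for y :: real
  proof -
    have "\<lfloor>2 * y / real_of_int 2\<rfloor> = \<lfloor>2 * y\<rfloor> div 2" by (rule floor_divide_real_eq_div) simp
    then have "\<lfloor>2 * y\<rfloor> mod 2 = \<lfloor>2 * y\<rfloor> - 2 * \<lfloor>y\<rfloor>" by (simp add: minus_mult_div_eq_mod[symmetric])
    moreover have "\<lfloor>2 * y\<rfloor> mod 2 = 0 \<or> \<lfloor>2 * y\<rfloor> mod 2 = 1" by presburger
    ultimately have "(of_bool (\<lfloor>2 * y\<rfloor> mod 2 = 1) :: int) = \<lfloor>2 * y\<rfloor> - 2 * \<lfloor>y\<rfloor>" by auto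
    then have "real_of_int (of_bool (\<lfloor>2 * y\<rfloor> mod 2 = 1)) = real_of_int (\<lfloor>2 * y\<rfloor> - 2 * \<lfloor>y\<rfloor>)" by simp
    then show ?thesis by simp
  qed
  have part: "(\<Sum>k<n. (1/2)^(Suc k) * of_bool (\<lfloor>2^(Suc k) * x\<rfloor> mod 2 = 1)) = real_of_int \<lfloor>2^n * x\<rfloor> / 2^n" for n
  proof (induction n)
    case 0
    then show ?case using assms by (simp add: floor_eq_iff)
  next
    case (Suc n)
    have e: "of_bool (\<lfloor>2 ^ Suc n * x\<rfloor> mod 2 = 1) = real_of_int \<lfloor>2 ^ Suc n * x\<rfloor> - 2 * real_of_int \<lfloor>2 ^ n * x\<rfloor>"
      using step[of "2^n * x"] by (simp add: mult.assoc)
    show ?case unfolding sum.lessThan_Suc Suc.IH e by (simp add: power_divide field_simps)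
  qed
  have "(\<lambda>n. real_of_int \<lfloor>2^n * x\<rfloor> / 2^n - x) \<longlonglongrightarrow> 0"
  proof (rule Lim_null_comparison)
    have "norm (real_of_int \<lfloor>2^n * x\<rfloor> / 2^n - x) \<le> (1/2)^n" for n
    proof -
      have "\<bar>real_of_int \<lfloor>2^n * x\<rfloor> - 2^n * x\<bar> \<le> 1" by linarith
      then have "\<bar>real_of_int \<lfloor>2^n * x\<rfloor> - 2^n * x\<bar> / 2^n \<le> 1 / 2^n" by (intro divide_right_mono) auto
      moreover have "real_of_int \<lfloor>2^n * x\<rfloor> / 2^n - x = (real_of_int \<lfloor>2^n * x\<rfloor> - 2^n * x) / 2^n"
        by (simp add: field_simps)
      ultimately show ?thesis by (simp add: abs_divide power_divide)
    qed
    then show "\<forall>\<^sub>F n in sequentially. norm (real_of_int \<lfloor>2^n * x\<rfloor> / 2^n - x) \<le> (1/2)^n" by simp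
    show "(\<lambda>n. (1/2)^n :: real) \<longlonglongrightarrow> 0" by (rule LIMSEQ_power_zero) simp
  qed
  then show ?thesis unfolding sums_def part by (simp add: LIM_zero_iff)
qed

text \<open>The point of the Cantor set with the given digits. Doubling the digits leaves a gap
  between 1/3 and 2/3, where a continuous function has room to pass from one digit value to the
  other.\<close>

definition ternary :: "(nat \<Rightarrow> bool) \<Rightarrow> real" where
  "ternary b = (\<Sum>i. 2 * of_bool (b i) * (1/3)^(Suc i))"

lemma summable_ternary: "summable (\<lambda>i. 2 * of_bool (b i) * (1/3)^(Suc i) :: real)"
proof (rule summable_comparison_test')
  show "summable (\<lambda>i. 2 * (1/3)^(Suc i) :: real)"
    by (intro summable_mult) (simp add: summable_geometric)
  show "norm (2 * of_bool (b n) * (1/3)^(Suc n) :: real) \<le> 2 * (1/3)^(Suc n)" for n by simp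
qed

lemma ternary_bounds: "0 \<le> ternary b" "ternary b \<le> 1"
proof -
  show "0 \<le> ternary b" unfolding ternary_def by (intro suminf_nonneg summable_ternary) simp
  have "(\<lambda>i. (1/3)^i :: real) sums (1 / (1 - 1/3))" by (rule geometric_sums) simp
  then have s: "(\<lambda>i. 2/3 * (1/3)^i :: real) sums (2/3 * (1 / (1 - 1/3)))" by (rule sums_mult)
  have "ternary b \<le> (\<Sum>i. 2/3 * (1/3)^i)"
    unfolding ternary_def by (intro suminf_le summable_ternary sums_summable[OF s]) simp
  then show "ternary b \<le> 1" using sums_unique[OF s] by simp
qed

lemma ternary_shift: "3 * ternary b = 2 * of_bool (b 0) + ternary (\<lambda>i. b (Suc i))"
proof -
  have "ternary b = 2 * of_bool (b 0) * (1/3) + (\<Sum>i. 2 * of_bool (b (Suc i)) * (1/3)^(Suc (Suc i)))"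
    using suminf_split_head[OF summable_ternary[of b]] unfolding ternary_def by simp
  also have "(\<Sum>i. 2 * of_bool (b (Suc i)) * (1/3)^(Suc (Suc i)) :: real) = (\<Sum>i. 1/3 * (2 * of_bool (b (Suc i)) * (1/3)^(Suc i)))"
    by (simp add: algebra_simps)
  also have "\<dots> = 1/3 * ternary (\<lambda>i. b (Suc i))"
    unfolding ternary_def by (rule suminf_mult[OF summable_ternary])
  finally show ?thesis by simp
qed

text \<open>A 2-periodic continuous function that is \<open>0\<close> on \<open>[0, 1/3]\<close> and \<open>1\<close> on \<open>[2/3, 1]\<close>: it reads off
  the first ternary digit of a number with digits \<open>0\<close> and \<open>2\<close>, as in Schoenberg's space-filling curve.\<close>
definition digit_fun :: "real \<Rightarrow> real" where
  "digit_fun s = min 1 (max 0 (1/2 - cos (pi * s)))"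

lemma digit_fun_periodic: "digit_fun (s + 2 * real N) = digit_fun s"
proof (induction N)
  case (Suc N)
  have "cos (pi * (s + 2 * real (Suc N))) = cos (pi * (s + 2 * real N) + 2 * pi)"
    by (simp add: algebra_simps)
  then show ?case using Suc by (simp add: digit_fun_def)
qed simp

lemma digit_fun_ternary_0: "digit_fun (ternary b) = of_bool (b 0)"
proof (cases "b 0")
  case True
  then have "2/3 \<le> ternary b" "ternary b \<le> 1"
    using ternary_shift[of b] ternary_bounds[of b] ternary_bounds[of "\<lambda>i. b (Suc i)"] by auto
  then have "cos (pi * ternary b) \<le> cos (pi * (2/3))"
    by (intro cos_monotone_0_pi_le) (auto simp: mult_left_le)
  also have "\<dots> = - 1/2" using cos_120 by (simp add: mult.commute)
  finally show ?thesis using True by (simp add: digit_fun_def)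
next
  case False
  then have "0 \<le> ternary b" "ternary b \<le> 1/3"
    using ternary_shift[of b] ternary_bounds[of b] ternary_bounds[of "\<lambda>i. b (Suc i)"] by auto
  then have "cos (pi * (1/3)) \<le> cos (pi * ternary b)"
    by (intro cos_monotone_0_pi_le mult_left_mono) auto
  moreover have "cos (pi * (1/3)) = 1/2" using cos_60 by simp
  ultimately show ?thesis using False by (simp add: digit_fun_def)
qed

lemma digit_fun_ternary: "digit_fun (3^m * ternary b) = of_bool (b m)"
proof -
  \<comment> \<open>Multiplying by 3 shifts the digits and releases an even integer; the summand
    \<open>2 * real N\<close> absorbs it and makes the induction go through.\<close>
  have "digit_fun (3^m * ternary b + 2 * real N) = of_bool (b m)" for N
  proof (induction m arbitrary: b N)
    case 0
    then show ?case by (simp add: digit_fun_periodic digit_fun_ternary_0)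
  next
    case (Suc m)
    have "3 ^ Suc m * ternary b = 3^m * (3 * ternary b)" by simp
    also have "\<dots> = 3^m * ternary (\<lambda>i. b (Suc i)) + 2 * real (3^m * of_bool (b 0))"
      unfolding ternary_shift by (simp add: algebra_simps)
    finally have eq: "3 ^ Suc m * ternary b + 2 * real N =
        3^m * ternary (\<lambda>i. b (Suc i)) + 2 * real (3^m * of_bool (b 0) + N)" by simp
    show ?case unfolding eq by (rule Suc.IH)
  qed
  from this[of 0] show ?thesis by simp
qed

text \<open>\<open>prod_encode\<close> deals the digits of one ternary number out to all
  coordinates: the \<open>k\<close>-th binary digit of coordinate \<open>i\<close> is read at
  position \<open>prod_encode (k, i)\<close>.\<close>

definition curve_coord :: "nat \<Rightarrow> real \<Rightarrow> real" where
  "curve_coord i t = (\<Sum>k. (1/2)^(Suc k) * digit_fun (3^(prod_encode (k, i)) * t))"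

lemma continuous_curve_coord: "continuous_on UNIV (curve_coord i)"
proof -
  have b: "norm ((1/2)^(Suc k) * digit_fun (3^(prod_encode (k, i)) * t)) \<le> (1/2)^(Suc k)" for k t
  proof -
    have "\<bar>digit_fun s\<bar> \<le> 1" for s by (auto simp: digit_fun_def)
    then show ?thesis by (simp add: abs_mult mult_le_cancel_left1 del: power_Suc)
  qed
  have "summable (\<lambda>k. (1/2)^(Suc k) :: real)" by (simp add: summable_geometric)
  from Weierstrass_m_test[of UNIV "\<lambda>k t. (1/2)^(Suc k) * digit_fun (3^(prod_encode (k, i)) * t)", OF b this]
  have "uniform_limit UNIV (\<lambda>n t. \<Sum>k<n. (1/2)^(Suc k) * digit_fun (3^(prod_encode (k, i)) * t)) (curve_coord i) sequentially"
    unfolding curve_coord_def[abs_def] .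
  then show ?thesis
    by (rule uniform_limit_theorem[rotated])
      (auto intro!: always_eventually continuous_intros simp: digit_fun_def)
qed

text \<open>The decoder is continuous so that it can carry limits from the line back to the space;
  for the encoder, Borel measurability is enough to transport laws.\<close>

theorem space_filling_curve:
  shows "\<exists>(dec :: real \<Rightarrow> 'a::euclidean_space) (enc :: 'a \<Rightarrow> real). continuous_on UNIV dec \<and>
    enc \<in> borel_measurable borel \<and> (\<forall>x. 0 \<le> enc x \<and> enc x \<le> 1) \<and> (\<forall>x. norm x < 1 \<longrightarrow> dec (enc x) = x)"
proof -
  \<comment> \<open>Coordinates of a point of the open unit ball lie strictly between -1 and 1;
    halving after adding 1 brings them into the range of the binary expansion.\<close>
  define bits where "bits x m = (\<lfloor>2^(Suc (fst (prod_decode m))) * ((x \<bullet> from_nat_into Basis (snd (prod_decode m)) + 1) / 2)\<rfloor> mod 2 = 1)"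
    for x :: 'a and m
  define enc where "enc x = ternary (bits x)" for x
  define dec :: "real \<Rightarrow> 'a" where "dec t = (\<Sum>b\<in>Basis. (2 * curve_coord (to_nat_on Basis b) t - 1) *\<^sub>R b)" for t
  have "continuous_on UNIV dec"
    unfolding dec_def by (intro continuous_intros continuous_curve_coord)
  moreover have "enc \<in> borel_measurable borel"
    unfolding enc_def ternary_def bits_def by measurable
  moreover have "\<forall>x. 0 \<le> enc x \<and> enc x \<le> 1" by (simp add: enc_def ternary_bounds)
  moreover have "dec (enc x) = x" if nx: "norm x < 1" for x
  proof -
    have cc: "curve_coord (to_nat_on Basis b) (enc x) = (x \<bullet> b + 1) / 2" if b: "b \<in> Basis" for b
    proof -
      have "\<bar>x \<bullet> b\<bar> < 1" using nx Basis_le_norm[OF b, of x] by simp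
      then have r: "0 \<le> (x \<bullet> b + 1) / 2" "(x \<bullet> b + 1) / 2 < 1" by (auto simp: abs_less_iff)
      have "from_nat_into Basis (to_nat_on Basis b) = b"
        using b by (simp add: countable_finite from_nat_into_to_nat_on)
      then have "bits x (prod_encode (k, to_nat_on Basis b)) = (\<lfloor>2^(Suc k) * ((x \<bullet> b + 1) / 2)\<rfloor> mod 2 = 1)" for k
        by (simp add: bits_def)
      then show ?thesis
        using sums_unique[OF binary_expansion_sums[OF r]]
        unfolding curve_coord_def enc_def digit_fun_ternary by simp
    qed
    have "2 * curve_coord (to_nat_on Basis b) (enc x) - 1 = x \<bullet> b" if b: "b \<in> Basis" for b
      unfolding cc[OF b] by (simp add: field_simps)
    then have "dec (enc x) = (\<Sum>b\<in>Basis. (x \<bullet> b) *\<^sub>R b)"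
      unfolding dec_def by (intro sum.cong refl) (simp only:)
    then show ?thesis by (simp add: euclidean_representation)
  qed
  ultimately show ?thesis by blast
qed

section \<open>Almost surely convergent representations\<close>

lemma ball_homeomorphism:
  fixes x :: "'a::real_normed_vector"
  shows "norm (x /\<^sub>R (1 + norm x)) < 1"
    and "(x /\<^sub>R (1 + norm x)) /\<^sub>R (1 - norm (x /\<^sub>R (1 + norm x))) = x"
proof -
  have p: "1 + norm x > 0" by (rule add_pos_nonneg) auto
  have n: "norm (x /\<^sub>R (1 + norm x)) = norm x / (1 + norm x)" using p by (simp add: divide_inverse)
  then show "norm (x /\<^sub>R (1 + norm x)) < 1" using p by simp
  have "1 - norm (x /\<^sub>R (1 + norm x)) = 1 / (1 + norm x)" unfolding n using p by (simp add: field_simps)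
  then show "(x /\<^sub>R (1 + norm x)) /\<^sub>R (1 - norm (x /\<^sub>R (1 + norm x))) = x"
    using p by simp
qed

text \<open>Bounded first moments give tightness. The laws are transported to the line along the space-filling
  curve, where Helly's and Skorohod's theorems apply.\<close>
theorem prokhorov_skorohod:
  fixes \<mu> :: "nat \<Rightarrow> 'a::euclidean_space measure"
  assumes prob: "\<And>n. prob_space (\<mu> n)" and sets_\<mu>: "\<And>n. sets (\<mu> n) = sets borel"
    and bound: "\<And>n. (\<integral>\<^sup>+ x. ennreal (norm x) \<partial>\<mu> n) \<le> ennreal C"
  shows "\<exists>s (\<Omega> :: real measure) W V. strict_mono s \<and> prob_space \<Omega> \<and> (\<forall>n. W n \<in> borel_measurable \<Omega>) \<and>
    V \<in> borel_measurable \<Omega> \<and> (\<forall>n. distr \<Omega> borel (W n) = \<mu> (s n)) \<and> (AE \<omega> in \<Omega>. (\<lambda>n. W n \<omega>) \<longlonglongrightarrow> V \<omega>)"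
proof -
  obtain dec :: "real \<Rightarrow> 'a" and enc where dec: "continuous_on UNIV dec" and enc: "enc \<in> borel_measurable borel"
    and enc01: "\<And>x. 0 \<le> enc x" "\<And>x. enc x \<le> 1" and inv: "\<And>x. norm x < 1 \<Longrightarrow> dec (enc x) = x"
    using space_filling_curve by metis
  have dec_m [measurable]: "dec \<in> borel_measurable borel" by (rule borel_measurable_continuous_onI[OF dec])
  note enc [measurable]
  define \<tau> where "\<tau> w = w /\<^sub>R (1 - norm w)" for w :: 'a
  define code where "code x = enc (x /\<^sub>R (1 + norm x))" for x
  have [measurable]: "\<tau> \<in> borel_measurable borel" unfolding \<tau>_def by measurable
  have [measurable]: "code \<in> borel_measurable borel" unfolding code_def by measurable
  have code01: "- 1 < code x" "code x \<le> 1" for x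
    using enc01[of "x /\<^sub>R (1 + norm x)"] unfolding code_def by linarith+
  have dec_code: "dec (code x) = x /\<^sub>R (1 + norm x)" for x
    unfolding code_def by (rule inv) (rule ball_homeomorphism)
  have \<tau>_code: "\<tau> (dec (code x)) = x" for x
    unfolding dec_code \<tau>_def by (rule ball_homeomorphism)
  have m\<mu> [measurable_cong]: "\<And>n. sets (\<mu> n) = sets borel" by (rule sets_\<mu>)
  define m where "m n = distr (\<mu> n) borel code" for n
  have rd: "real_distribution (m n)" for n
  proof -
    interpret prob_space "\<mu> n" by (rule prob)
    show ?thesis unfolding m_def by (rule real_distribution_distr) simp
  qed
  \<comment> \<open>On the line tightness is automatic since all codes lie between 0 and 1; the
    half-open interval starts at \<open>-1\<close> so that the code \<open>0\<close> is
    included.\<close>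
  have "tight m"
    unfolding tight_def
  proof (intro conjI allI impI)
    fix \<epsilon> :: real assume "\<epsilon> > 0"
    have "measure (m n) {-1<..1} = 1" for n
    proof -
      interpret prob_space "\<mu> n" by (rule prob)
      have "measure (m n) {-1<..1} = measure (\<mu> n) (code -` {-1<..1} \<inter> space (\<mu> n))"
        unfolding m_def by (rule measure_distr) auto
      also have "code -` {-1<..1} \<inter> space (\<mu> n) = space (\<mu> n)"
        using code01 by auto
      finally show ?thesis by (simp add: prob_space)
    qed
    then show "\<exists>a b. a < b \<and> (\<forall>n. 1 - \<epsilon> < measure (m n) {a<..b})"
      using \<open>\<epsilon> > 0\<close> by (intro exI[of _ "-1"] exI[of _ 1]) auto
  qed (rule rd)
  then obtain r M where r: "strict_mono (r :: nat \<Rightarrow> nat)" and M: "real_distribution M" and "weak_conv_m (m \<circ> id \<circ> r) M"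
    using tight_imp_convergent_subsubsequence[of m id] strict_mono_id by blast
  then have wc: "weak_conv_m (\<lambda>n. m (r n)) M" by (simp add: comp_def)
  obtain \<Omega> :: "real measure" and T T' where \<Omega>: "prob_space \<Omega>" and T [measurable]: "\<And>n. T n \<in> borel_measurable \<Omega>"
    and dT: "\<And>n. distr \<Omega> borel (T n) = m (r n)" and T' [measurable]: "T' \<in> borel_measurable \<Omega>"
    and lim: "\<And>x. x \<in> space \<Omega> \<Longrightarrow> (\<lambda>n. T n x) \<longlonglongrightarrow> T' x"
    using Skorohod[of "\<lambda>n. m (r n)" M, OF rd M wc] unfolding measurable_lborel1 by metis
  define W where "W n \<omega> = \<tau> (dec (T n \<omega>))" for n \<omega>
  define V where "V \<omega> = \<tau> (dec (T' \<omega>))" for \<omega>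
  have [measurable]: "W n \<in> borel_measurable \<Omega>" for n unfolding W_def by measurable
  have [measurable]: "V \<in> borel_measurable \<Omega>" unfolding V_def by measurable
  have dW: "distr \<Omega> borel (W n) = \<mu> (r n)" for n
  proof -
    have "distr \<Omega> borel (W n) = distr (distr \<Omega> borel (T n)) borel (\<lambda>t. \<tau> (dec t))"
      unfolding W_def by (subst distr_distr) (auto simp: comp_def)
    also have "\<dots> = distr (\<mu> (r n)) borel (\<lambda>x. \<tau> (dec (code x)))"
      unfolding dT m_def by (subst distr_distr) (auto simp: comp_def)
    also have "\<dots> = \<mu> (r n)" unfolding \<tau>_code by (rule distr_id2) (simp add: sets_\<mu>)
    finally show ?thesis .
  qed
  have AE1: "AE \<omega> in \<Omega>. norm (dec (T n \<omega>)) < 1" for n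
  proof -
    have "AE t in distr (\<mu> (r n)) borel code. norm (dec t) < 1"
      by (subst AE_distr_iff) (auto simp: dec_code ball_homeomorphism(1) simp del: norm_scaleR)
    then have "AE t in distr \<Omega> borel (T n). norm (dec t) < 1" unfolding dT m_def .
    then show ?thesis by (rule AE_distrD[OF T])
  qed
  \<comment> \<open>The moment bound is spent here. The decoded points converge in the closed ball
    in any case; by Fatou the \<open>liminf\<close> of the norms of \<open>W n\<close> is finite
    almost surely, which keeps the limit off the unit sphere, the image of infinity.\<close>
  have "(\<integral>\<^sup>+ \<omega>. liminf (\<lambda>n. ennreal (norm (W n \<omega>))) \<partial>\<Omega>) \<le> liminf (\<lambda>n. \<integral>\<^sup>+ \<omega>. ennreal (norm (W n \<omega>)) \<partial>\<Omega>)"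
    by (rule nn_integral_liminf) simp
  also have "\<dots> \<le> ennreal C"
  proof -
    have "(\<integral>\<^sup>+ \<omega>. ennreal (norm (W n \<omega>)) \<partial>\<Omega>) \<le> ennreal C" for n
      using bound[of "r n"] unfolding dW[symmetric] by (subst (asm) nn_integral_distr) auto
    then have "liminf (\<lambda>n. \<integral>\<^sup>+ \<omega>. ennreal (norm (W n \<omega>)) \<partial>\<Omega>) \<le> liminf (\<lambda>n::nat. ennreal C)"
      by (intro Liminf_mono) auto
    then show ?thesis by (simp add: Liminf_const)
  qed
  finally have "(\<integral>\<^sup>+ \<omega>. liminf (\<lambda>n. ennreal (norm (W n \<omega>))) \<partial>\<Omega>) \<noteq> \<infinity>"
    by (auto simp: top_unique)
  then have AE2: "AE \<omega> in \<Omega>. liminf (\<lambda>n. ennreal (norm (W n \<omega>))) \<noteq> \<infinity>"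
    by (intro nn_integral_PInf_AE) auto
  have "AE \<omega> in \<Omega>. \<forall>n. norm (dec (T n \<omega>)) < 1" using AE1 by (simp add: AE_all_countable)
  then have "AE \<omega> in \<Omega>. (\<lambda>n. W n \<omega>) \<longlonglongrightarrow> V \<omega>"
    using AE2 AE_space
  proof eventually_elim
    case (elim \<omega>)
    have d: "(\<lambda>n. dec (T n \<omega>)) \<longlonglongrightarrow> dec (T' \<omega>)"
      using continuous_on_tendsto_compose[OF dec lim[OF elim(3)]] by simp
    then have dn: "(\<lambda>n. norm (dec (T n \<omega>))) \<longlonglongrightarrow> norm (dec (T' \<omega>))" by (rule tendsto_norm)
    have "norm (dec (T' \<omega>)) \<le> 1"
      by (rule LIMSEQ_le_const2[OF dn]) (use elim(1) less_imp_le in blast)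
    moreover have "norm (dec (T' \<omega>)) \<noteq> 1"
    proof
      assume "norm (dec (T' \<omega>)) = 1"
      then have l1: "(\<lambda>n. norm (dec (T n \<omega>))) \<longlonglongrightarrow> 1" using dn by simp
      have "(\<lambda>n. 1 - norm (dec (T n \<omega>))) \<longlonglongrightarrow> 1 - 1" by (intro tendsto_diff l1 tendsto_const)
      then have "filterlim (\<lambda>n. 1 - norm (dec (T n \<omega>))) (at_right 0) sequentially"
        unfolding filterlim_at
      proof (intro conjI always_eventually allI)
        show "1 - norm (dec (T n \<omega>)) \<in> {0<..}" "1 - norm (dec (T n \<omega>)) \<noteq> 0" for n
          using spec[OF elim(1), of n] by auto
      qed simp
      then have "LIM n sequentially. inverse (1 - norm (dec (T n \<omega>))) :> at_top"
        by (rule filterlim_compose[OF filterlim_inverse_at_top_right])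
      then have "LIM n sequentially. norm (dec (T n \<omega>)) * inverse (1 - norm (dec (T n \<omega>))) :> at_top"
        by (rule filterlim_tendsto_pos_mult_at_top[OF l1 zero_less_one])
      moreover have "norm (W n \<omega>) = norm (dec (T n \<omega>)) * inverse (1 - norm (dec (T n \<omega>)))" for n
      proof -
        have "norm (dec (T n \<omega>)) < 1" using elim(1) by blast
        then show ?thesis by (simp add: W_def \<tau>_def)
      qed
      ultimately have "LIM n sequentially. norm (W n \<omega>) :> at_top" by simp
      then have "(\<lambda>n. ennreal (norm (W n \<omega>))) \<longlonglongrightarrow> top"
        by (simp add: ennreal_tendsto_top_eq_at_top)
      then have "liminf (\<lambda>n. ennreal (norm (W n \<omega>))) = top"
        by (intro lim_imp_Liminf) auto
      then show False using elim(2) by simp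
    qed
    ultimately have "1 - norm (dec (T' \<omega>)) \<noteq> 0" by simp
    then show ?case unfolding W_def V_def \<tau>_def by (intro tendsto_intros d) auto
  qed
  then show ?thesis using r \<Omega> dW
    by (intro exI[of _ r] exI[of _ \<Omega>] exI[of _ W] exI[of _ V]) auto
qed

section \<open>Martingale plans\<close>

lemma L2vec_measurable: "L2vec M X \<Longrightarrow> X \<in> borel_measurable M"
  by (simp add: L2vec_def)

lemma measurable_vec_component:
  fixes X :: "'w \<Rightarrow> real^'n"
  assumes "X \<in> borel_measurable M"
  shows "(\<lambda>w. X w $ i) \<in> borel_measurable M"
  by (rule measurable_compose[OF assms])
    (intro borel_measurable_continuous_onI continuous_on_component continuous_on_id)

lemma L2vec_le:
  fixes X :: "'w \<Rightarrow> real^'n" and Y :: "'w \<Rightarrow> real^'m"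
  assumes "L2vec M Y" "X \<in> borel_measurable M" "AE w in M. norm (X w) \<le> norm (Y w)"
  shows "L2vec M X"
  unfolding L2vec_def
proof (intro conjI)
  show "integrable M (\<lambda>w. (norm (X w))\<^sup>2)"
    by (rule Bochner_Integration.integrable_bound[of M "\<lambda>w. (norm (Y w))\<^sup>2"])
      (use assms in \<open>auto simp: L2vec_def power_mono intro!: eventually_mono[OF assms(3)]\<close>)
qed (rule assms)

lemma L2vec_scaleR: "L2vec M X \<Longrightarrow> L2vec M (\<lambda>w. c *\<^sub>R X w)"
  unfolding L2vec_def by (auto simp: power_mult_distrib)

lemma L2vec_add:
  fixes X Y :: "'w \<Rightarrow> real^'n"
  assumes "L2vec M X" "L2vec M Y"
  shows "L2vec M (\<lambda>w. X w + Y w)"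
  unfolding L2vec_def
proof (intro conjI)
  show "integrable M (\<lambda>w. (norm (X w + Y w))\<^sup>2)"
  proof (rule Bochner_Integration.integrable_bound[of M "\<lambda>w. 2 * (norm (X w))\<^sup>2 + 2 * (norm (Y w))\<^sup>2"])
    have "(norm (x + y))\<^sup>2 \<le> 2 * (norm x)\<^sup>2 + 2 * (norm y)\<^sup>2" for x y :: "real^'n"
    proof -
      have "(norm (x + y))\<^sup>2 \<le> (norm x + norm y)\<^sup>2" by (intro power_mono norm_triangle_ineq) simp
      also have "\<dots> \<le> 2 * (norm x)\<^sup>2 + 2 * (norm y)\<^sup>2"
        using sum_squares_bound[of "norm x" "norm y"] by (simp add: power2_sum)
      finally show ?thesis .
    qed
    then show "AE w in M. norm ((norm (X w + Y w))\<^sup>2) \<le> norm (2 * (norm (X w))\<^sup>2 + 2 * (norm (Y w))\<^sup>2)"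
      by (intro always_eventually allI) simp
  qed (use assms in \<open>auto simp: L2vec_def\<close>)
qed (use assms in \<open>auto simp: L2vec_def\<close>)

lemma L2vec_diff: "L2vec M X \<Longrightarrow> L2vec M Y \<Longrightarrow> L2vec M (\<lambda>w. X w - Y w)"
  using L2vec_add[of M X "\<lambda>w. - 1 *\<^sub>R Y w"] L2vec_scaleR[of M Y "-1"] by simp

lemma L2vec_bounded:
  fixes X :: "'w \<Rightarrow> real^'n"
  assumes "finite_measure M" "X \<in> borel_measurable M" "\<And>w. norm (X w) \<le> c"
  shows "L2vec M X"
  unfolding L2vec_def
proof (intro conjI)
  interpret finite_measure M by fact
  show "integrable M (\<lambda>w. (norm (X w))\<^sup>2)"
    by (rule integrable_const_bound[of _ "c\<^sup>2"]) (use assms in \<open>auto simp: power_mono\<close>)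
qed (rule assms)

lemma L2vec_integrable:
  fixes X :: "'w \<Rightarrow> real^'n"
  assumes "finite_measure M" "L2vec M X"
  shows "integrable M X"
proof -
  interpret finite_measure M by fact
  show ?thesis
  proof (rule Bochner_Integration.integrable_bound[of M "\<lambda>w. 1 + (norm (X w))\<^sup>2"])
    have "r \<le> 1 + r\<^sup>2" for r :: real
    proof -
      have "2 * r \<le> 1 + r\<^sup>2" "0 \<le> r\<^sup>2" using sum_squares_bound[of r 1] by simp_all
      then show ?thesis by linarith
    qed
    then show "AE w in M. norm (X w) \<le> norm (1 + (norm (X w))\<^sup>2)" by (auto intro!: always_eventually)
  qed (use assms in \<open>auto simp: L2vec_def\<close>)
qed

lemma L2vec_inner:
  fixes X Y :: "'w \<Rightarrow> real^'n"
  assumes "L2vec M X" "L2vec M Y"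
  shows "integrable M (\<lambda>w. X w \<bullet> Y w)"
proof (rule Bochner_Integration.integrable_bound[of M "\<lambda>w. (norm (X w))\<^sup>2 + (norm (Y w))\<^sup>2"])
  have "\<bar>x \<bullet> y\<bar> \<le> (norm x)\<^sup>2 + (norm y)\<^sup>2" for x y :: "real^'n"
  proof -
    have "0 \<le> norm x * norm y" by simp
    then show ?thesis using Cauchy_Schwarz_ineq2[of x y] sum_squares_bound[of "norm x" "norm y"] by linarith
  qed
  then show "AE w in M. norm (X w \<bullet> Y w) \<le> norm ((norm (X w))\<^sup>2 + (norm (Y w))\<^sup>2)"
    by (intro always_eventually allI) simp
qed (use assms in \<open>auto simp: L2vec_def\<close>)

lemma L2vec_matrix:
  fixes X :: "'w \<Rightarrow> real^'n" and S :: "real^'n^'n"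
  assumes "L2vec M X"
  shows "L2vec M (\<lambda>w. S *v X w)"
proof -
  obtain K where K: "K > 0" "\<And>y. norm (S *v y) \<le> norm y * K"
    using bounded_linear.pos_bounded[OF matrix_vector_mul_bounded_linear[of S]] by blast
  have "(\<lambda>w. S *v X w) \<in> borel_measurable M"
    by (rule measurable_matrix_vector[OF L2vec_measurable[OF assms]])
  then show ?thesis
    by (rule L2vec_le[OF L2vec_scaleR[OF assms, of K]]) (use K in \<open>auto simp: mult.commute\<close>)
qed

lemma L2vec_Sform:
  assumes "L2vec M X" "L2vec M Y"
  shows "integrable M (\<lambda>w. Sform S (X w) (Y w))"
  unfolding Sform_def by (intro L2vec_inner L2vec_matrix assms)

lemma L2vec_distr:
  assumes "f \<in> measurable M N" "X \<in> borel_measurable N"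
  shows "L2vec (distr M N f) X \<longleftrightarrow> L2vec M (\<lambda>w. X (f w))"
  using assms unfolding L2vec_def by (auto simp: integrable_distr_eq)

lemma set_integral_eqI:
  fixes X Y :: "'w \<Rightarrow> real^'n"
  assumes "integrable M X" "integrable M Y" "A \<in> sets M"
    and eq: "\<And>u. (\<integral>w. (indicator A w *\<^sub>R u) \<bullet> X w \<partial>M) = (\<integral>w. (indicator A w *\<^sub>R u) \<bullet> Y w \<partial>M)"
  shows "set_lebesgue_integral M A X = set_lebesgue_integral M A Y"
proof -
  have "u \<bullet> set_lebesgue_integral M A Z = (\<integral>w. (indicator A w *\<^sub>R u) \<bullet> Z w \<partial>M)"
    if "integrable M Z" for u and Z :: "'w \<Rightarrow> real^'n"
    unfolding set_lebesgue_integral_def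
    using integrable_mult_indicator[OF assms(3) that] by (subst integral_inner_right[symmetric]) auto
  then have "u \<bullet> set_lebesgue_integral M A X = u \<bullet> set_lebesgue_integral M A Y" for u
    using assms by simp
  then show ?thesis using vector_eq_ldot by blast
qed

lemma set_integral_inner:
  fixes X :: "'w \<Rightarrow> real^'n"
  assumes "integrable M X" "A \<in> sets M"
  shows "set_lebesgue_integral M A (\<lambda>w. u \<bullet> X w) = u \<bullet> set_lebesgue_integral M A X"
  unfolding set_lebesgue_integral_def
  using integrable_mult_indicator[OF assms(2,1)] by (subst integral_inner_right[symmetric]) auto

lemma prob_space_subalgebra:
  assumes "prob_space M" "subalgebra M F"
  shows "finite_measure_subalgebra M F"
  using assms by (simp add: finite_measure_subalgebra_def finite_measure_subalgebra_axioms_def prob_space.finite_measure)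

text \<open>Agreement on the sets of \<open>F\<close> says that each component of
  \<open>X - Y\<close> has conditional expectation zero; pulling out the \<open>F\<close>-measurable
  factor gives the identity for test fields.\<close>

lemma cond_exp_test:
  fixes X Y \<theta> :: "'w \<Rightarrow> real^'n"
  assumes "prob_space M" "subalgebra M F" and X: "L2vec M X" and Y: "L2vec M Y"
    and eq: "\<And>A. A \<in> sets F \<Longrightarrow> set_lebesgue_integral M A X = set_lebesgue_integral M A Y"
    and \<theta>: "L2vec M \<theta>" "\<theta> \<in> borel_measurable F"
  shows "(\<integral>w. \<theta> w \<bullet> X w \<partial>M) = (\<integral>w. \<theta> w \<bullet> Y w \<partial>M)"
proof -
  interpret prob_space M by fact
  interpret finite_measure_subalgebra M F by (rule prob_space_subalgebra) fact+
  have int: "integrable M X" "integrable M Y" using L2vec_integrable[OF finite_measure_axioms] X Y by blast+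
  have D: "L2vec M (\<lambda>w. X w - Y w)" by (rule L2vec_diff[OF X Y])
  \<comment> \<open>A component is regarded as a vector along its axis, so that integrability of a
    single product of components follows from that of an inner product.\<close>
  have comp: "L2vec M (\<lambda>w. (Z w $ i) *\<^sub>R axis i 1)" if Z: "L2vec M Z" for Z :: "'w \<Rightarrow> real^'n" and i
  proof (rule L2vec_le[OF Z])
    show "(\<lambda>w. (Z w $ i) *\<^sub>R (axis i 1 :: real^'n)) \<in> borel_measurable M"
      by (intro borel_measurable_scaleR measurable_vec_component L2vec_measurable[OF Z] borel_measurable_const)
  qed (simp add: component_le_norm_cart)
  have "(\<integral>w. \<theta> w $ i * (X w - Y w) $ i \<partial>M) = 0" for i
  proof -
    have "AE w in M. real_cond_exp M F (\<lambda>w. (X w - Y w) $ i) w = 0"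
    proof (rule real_cond_exp_charact)
      fix A assume A: "A \<in> sets F"
      then have AM: "A \<in> sets M" using subalg by (auto simp: subalgebra_def)
      have "set_lebesgue_integral M A (\<lambda>w. axis i 1 \<bullet> (X w - Y w)) = 0"
        using eq[OF A] set_integral_inner[OF int(1) AM] set_integral_inner[OF int(2) AM]
          set_integral_inner[OF L2vec_integrable[OF finite_measure_axioms D] AM]
          set_integral_diff(2)[of M A X Y] integrable_mult_indicator[OF AM int(1)] integrable_mult_indicator[OF AM int(2)]
        by (simp add: set_integrable_def)
      then show "set_lebesgue_integral M A (\<lambda>w. (X w - Y w) $ i) = set_lebesgue_integral M A (\<lambda>w. 0)"
        by (simp add: inner_axis' set_lebesgue_integral_def)
    next
      show "integrable M (\<lambda>w. (X w - Y w) $ i)"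
        using integrable_bounded_linear[OF bounded_linear_vec_nth L2vec_integrable[OF finite_measure_axioms D]] .
    qed auto
    moreover have i1: "integrable M (\<lambda>w. \<theta> w $ i * (X w - Y w) $ i)"
      using L2vec_inner[OF comp[OF \<theta>(1), of i] D] by (simp add: inner_axis' mult.commute)
    moreover have "(\<lambda>w. \<theta> w $ i) \<in> borel_measurable F" by (rule measurable_vec_component[OF \<theta>(2)])
    moreover have "(\<lambda>w. (X w - Y w) $ i) \<in> borel_measurable M"
      by (rule measurable_vec_component[OF L2vec_measurable[OF D]])
    ultimately have "(\<integral>w. \<theta> w $ i * (X w - Y w) $ i \<partial>M) = (\<integral>w. \<theta> w $ i * real_cond_exp M F (\<lambda>w. (X w - Y w) $ i) w \<partial>M)"
      using real_cond_exp_intg(2)[OF i1] by simp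
    also have "\<dots> = (\<integral>w. 0 \<partial>M)"
      using \<open>AE w in M. real_cond_exp M F _ w = 0\<close> measurable_vec_component[OF L2vec_measurable[OF \<theta>(1)], of i]
      by (intro integral_cong_AE) auto
    finally show ?thesis by simp
  qed
  moreover have "(\<integral>w. \<theta> w \<bullet> (X w - Y w) \<partial>M) = (\<Sum>i\<in>UNIV. \<integral>w. \<theta> w $ i * (X w - Y w) $ i \<partial>M)"
  proof -
    have "integrable M (\<lambda>w. \<theta> w $ i * (X w - Y w) $ i)" for i
      using L2vec_inner[OF comp[OF \<theta>(1), of i] D] by (simp add: inner_axis' mult.commute)
    then show ?thesis by (simp add: inner_vec_def Bochner_Integration.integral_sum)
  qed
  ultimately have "(\<integral>w. \<theta> w \<bullet> (X w - Y w) \<partial>M) = 0" by simp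
  then show ?thesis
    using L2vec_inner[OF \<theta>(1) X] L2vec_inner[OF \<theta>(1) Y] by (simp add: inner_diff_right)
qed

lemma vimage_algebra_subalgebra:
  assumes "f \<in> measurable M N"
  shows "subalgebra M (vimage_algebra (space M) f N)"
  unfolding subalgebra_def using measurable_sets[OF assms] measurable_space[OF assms]
  by (auto simp: sets_vimage_algebra2)

section \<open>Plans and their test fields\<close>

lemma GammaD:
  assumes "\<gamma> \<in> Gamma \<nu>"
  shows "sets \<gamma> = sets borel" "prob_space \<gamma>" "L2vec \<gamma> fst" "L2vec \<gamma> snd" "distr \<gamma> borel snd = \<nu>" "space \<gamma> = UNIV"
proof -
  show s: "sets \<gamma> = sets borel" using assms by (simp add: Gamma_def)
  have "fst \<in> borel_measurable \<gamma>" "snd \<in> borel_measurable \<gamma>"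
    unfolding measurable_cong_sets[OF s refl] by (intro borel_measurable_continuous_onI continuous_intros)+
  then show "L2vec \<gamma> fst" "L2vec \<gamma> snd" using assms by (auto simp: Gamma_def L2vec_def)
  show "space \<gamma> = UNIV" using sets_eq_imp_space_eq[OF s] by simp
qed (use assms in \<open>simp_all add: Gamma_def\<close>)

text \<open>Stated for fields measurable with respect to the first coordinate, because the
  conditional expectations in the variation of an optimal plan arise in this form and not as
  explicit functions of \<open>x\<close>.\<close>

lemma Gamma_test_fst:
  fixes \<theta> :: "(real^'n) \<times> (real^'n) \<Rightarrow> real^'n"
  assumes \<gamma>: "\<gamma> \<in> Gamma \<nu>" and \<theta>: "L2vec \<gamma> \<theta>" "\<theta> \<in> borel_measurable (vimage_algebra UNIV fst borel)"
  shows "(\<integral>p. \<theta> p \<bullet> fst p \<partial>\<gamma>) = (\<integral>p. \<theta> p \<bullet> snd p \<partial>\<gamma>)"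
proof (rule cond_exp_test[OF GammaD(2)[OF \<gamma>] _ GammaD(3,4)[OF \<gamma>] _ \<theta>])
  show "subalgebra \<gamma> (vimage_algebra UNIV fst borel)"
    using vimage_algebra_subalgebra[of fst \<gamma> borel] GammaD(3,6)[OF \<gamma>] by (simp add: L2vec_def)
  fix A :: "((real^'n) \<times> (real^'n)) set" assume "A \<in> sets (vimage_algebra UNIV fst borel)"
  then obtain B where B: "B \<in> sets borel" "A = fst -` B" by (auto simp: sets_vimage_algebra2)
  then have "A = B \<times> UNIV" by auto
  with B show "set_lebesgue_integral \<gamma> A fst = set_lebesgue_integral \<gamma> A snd"
    using \<gamma> by (auto simp: Gamma_def)
qed

lemma Gamma_test:
  fixes \<theta> :: "real^'n \<Rightarrow> real^'n"
  assumes \<gamma>: "\<gamma> \<in> Gamma \<nu>" and \<theta>: "\<theta> \<in> borel_measurable borel" "L2vec \<gamma> (\<lambda>p. \<theta> (fst p))"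
  shows "(\<integral>p. \<theta> (fst p) \<bullet> fst p \<partial>\<gamma>) = (\<integral>p. \<theta> (fst p) \<bullet> snd p \<partial>\<gamma>)"
  using \<theta>(2) by (rule Gamma_test_fst[OF \<gamma>])
    (rule measurable_compose[OF measurable_vimage_algebra1 \<theta>(1)], simp)

lemma Sform_eq_inner: "transpose S = S \<Longrightarrow> Sform S x y = (S *v x) \<bullet> y"
  using Sform_commute[of S x y] by (simp add: Sform_def inner_commute)

text \<open>The test field is \<open>S *v x\<close>. The reward of a plan thus depends on its first
  marginal alone.\<close>

lemma Gamma_Sform_eq:
  assumes \<gamma>: "\<gamma> \<in> Gamma \<nu>" and sym: "transpose S = S"
  shows "(\<integral>p. Sform S (fst p) (snd p) \<partial>\<gamma>) = (\<integral>p. Sform S (fst p) (fst p) \<partial>\<gamma>)"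
proof -
  have "(\<lambda>x. S *v x) \<in> borel_measurable borel"
    by (rule measurable_matrix_vector) simp
  from Gamma_test[OF \<gamma> this L2vec_matrix[OF GammaD(3)[OF \<gamma>]]] show ?thesis
    unfolding Sform_eq_inner[OF sym] by simp
qed

lemma GammaI:
  fixes X Y :: "'w \<Rightarrow> real^'n"
  assumes "prob_space N" and X: "L2vec N X" and Y: "L2vec N Y" and law: "distr N borel Y = \<nu>"
    and mart: "\<And>A u. A \<in> sets borel \<Longrightarrow>
       (\<integral>w. (indicator A (X w) *\<^sub>R u) \<bullet> X w \<partial>N) = (\<integral>w. (indicator A (X w) *\<^sub>R u) \<bullet> Y w \<partial>N)"
  shows "distr N borel (\<lambda>w. (X w, Y w)) \<in> Gamma \<nu>"
proof -
  interpret prob_space N by fact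
  have [measurable]: "X \<in> borel_measurable N" "Y \<in> borel_measurable N" using X Y by (auto simp: L2vec_def)
  have m: "(\<lambda>w. (X w, Y w)) \<in> borel_measurable N" unfolding borel_prod[symmetric] by measurable
  note fs = borel_measurable_fst_snd[where 'a = "real^'n" and 'b = "real^'n"]
  let ?\<gamma> = "distr N borel (\<lambda>w. (X w, Y w))"
  interpret g: prob_space ?\<gamma> by (rule prob_space_distr[OF m])
  have L: "L2vec ?\<gamma> fst" "L2vec ?\<gamma> snd" using X Y by (simp_all add: L2vec_distr[OF m] fs)
  have "set_lebesgue_integral ?\<gamma> (A \<times> UNIV) snd = set_lebesgue_integral ?\<gamma> (A \<times> UNIV) fst"
    if A: "A \<in> sets borel" for A
  proof (rule set_integral_eqI)
    show AU: "A \<times> UNIV \<in> sets ?\<gamma>" using A by (simp add: borel_prod[symmetric])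
    fix u :: "real^'n"
    have *: "(\<integral>p. (indicator (A \<times> UNIV) p *\<^sub>R u) \<bullet> f p \<partial>?\<gamma>) = (\<integral>w. (indicator A (X w) *\<^sub>R u) \<bullet> f (X w, Y w) \<partial>N)"
      if "f \<in> borel_measurable borel" for f
      using AU that by (subst integral_distr[OF m]) (auto simp: indicator_def intro!: Bochner_Integration.integral_cong)
    show "(\<integral>p. (indicator (A \<times> UNIV) p *\<^sub>R u) \<bullet> snd p \<partial>?\<gamma>) = (\<integral>p. (indicator (A \<times> UNIV) p *\<^sub>R u) \<bullet> fst p \<partial>?\<gamma>)"
      unfolding *[OF fs(1)] *[OF fs(2)] fst_conv snd_conv by (rule mart[OF A, symmetric])
  qed (use L2vec_integrable[OF g.finite_measure_axioms] L in blast)+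
  moreover have "distr ?\<gamma> borel snd = \<nu>"
    using law by (subst distr_distr[OF fs(2) m]) (simp add: comp_def)
  ultimately show ?thesis
    unfolding Gamma_def using L g.prob_space_axioms by (auto simp: L2vec_def)
qed

text \<open>Testing with \<open>x\<close> itself gives \<open>E |x|^2 = E (x . y)\<close>, and half
  of the resulting bound moves back to the left. The bound depends on \<open>\<nu>\<close> only,
  hence is uniform over all plans.\<close>

lemma Gamma_second_moment:
  fixes \<nu> :: "(real^'n) measure"
  assumes \<gamma>: "\<gamma> \<in> Gamma \<nu>"
  shows "(\<integral>p. (norm (fst p))\<^sup>2 \<partial>\<gamma>) \<le> (\<integral>p. (norm (snd p))\<^sup>2 \<partial>\<gamma>)"
    and "(\<integral>p. (norm (snd p))\<^sup>2 \<partial>\<gamma>) = (\<integral>y. (norm y)\<^sup>2 \<partial>\<nu>)"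
proof -
  have i: "integrable \<gamma> (\<lambda>p. (norm (fst p))\<^sup>2)" "integrable \<gamma> (\<lambda>p. (norm (snd p))\<^sup>2)"
    using GammaD(3,4)[OF \<gamma>] by (auto simp: L2vec_def)
  have "(\<integral>p. fst p \<bullet> fst p \<partial>\<gamma>) = (\<integral>p. fst p \<bullet> snd p \<partial>\<gamma>)"
    by (rule Gamma_test[OF \<gamma>, of "\<lambda>x. x"]) (use GammaD(3)[OF \<gamma>] in auto)
  also have "\<dots> \<le> (\<integral>p. (norm (fst p))\<^sup>2 / 2 + (norm (snd p))\<^sup>2 / 2 \<partial>\<gamma>)"
  proof (rule integral_mono)
    fix p :: "(real^'n) \<times> (real^'n)"
    show "fst p \<bullet> snd p \<le> (norm (fst p))\<^sup>2 / 2 + (norm (snd p))\<^sup>2 / 2"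
      using norm_cauchy_schwarz[of "fst p" "snd p"] sum_squares_bound[of "norm (fst p)" "norm (snd p)"] by simp
  qed (use i L2vec_inner[OF GammaD(3,4)[OF \<gamma>]] in auto)
  also have "\<dots> = (\<integral>p. (norm (fst p))\<^sup>2 \<partial>\<gamma>) / 2 + (\<integral>p. (norm (snd p))\<^sup>2 \<partial>\<gamma>) / 2" using i by simp
  finally show "(\<integral>p. (norm (fst p))\<^sup>2 \<partial>\<gamma>) \<le> (\<integral>p. (norm (snd p))\<^sup>2 \<partial>\<gamma>)"
    by (simp add: power2_norm_eq_inner)
  have "snd \<in> borel_measurable \<gamma>" using GammaD(4)[OF \<gamma>] by (simp add: L2vec_def)
  then show "(\<integral>p. (norm (snd p))\<^sup>2 \<partial>\<gamma>) = (\<integral>y. (norm y)\<^sup>2 \<partial>\<nu>)"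
    unfolding GammaD(5)[OF \<gamma>, symmetric] by (subst integral_distr) auto
qed

section \<open>Weak duality\<close>

lemma countable_dense_subset:
  fixes G :: "('a::euclidean_space) set"
  assumes "G \<noteq> {}"
  shows "\<exists>g :: nat \<Rightarrow> 'a. range g \<subseteq> G \<and> G \<subseteq> closure (range g)"
proof -
  obtain T where T: "countable T" "T \<subseteq> G" "G \<subseteq> closure T" using separable by metis
  then have "T \<noteq> {}" using assms by auto
  then have "range (from_nat_into T) = T" using T(1) by (rule range_from_nat_into)
  then show ?thesis using T by (intro exI[of _ "from_nat_into T"]) auto
qed

lemma closure_le:
  fixes f :: "'a::topological_space \<Rightarrow> real"
  assumes "x \<in> closure T" "continuous_on UNIV f" "\<And>t. t \<in> T \<Longrightarrow> f t \<le> c"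
  shows "f x \<le> c"
proof -
  have "closed {x. f x \<le> c}" by (intro closed_Collect_le assms continuous_intros)
  moreover have "T \<subseteq> {x. f x \<le> c}" using assms(3) by auto
  ultimately have "closure T \<subseteq> {x. f x \<le> c}" by (rule closure_minimal[rotated])
  then show ?thesis using assms(1) by auto
qed

lemma PG_iff: "x \<in> PG S G y \<longleftrightarrow> x \<in> G \<and> (\<forall>g\<in>G. tang S g y \<le> tang S x y)"
  by (simp add: PG_def)

text \<open>Jensen's inequality for psi_G combined with q <= psi_G. Jensen is run on finite maxima
  of tangents, and an integrable majorant \<open>\<Psi>\<close> stands for the extended-real psi_G.
  In the case of equality the tangents stay below q at almost every \<open>x\<close>, so
  \<open>x\<close> lies in \<open>G\<close>, and its own tangent must reach \<open>\<Psi>\<close> at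
  \<open>y\<close>.\<close>

theorem weak_duality:
  fixes \<gamma> :: "((real^'n) \<times> (real^'n)) measure" and \<Psi> :: "real^'n \<Rightarrow> real"
  assumes sym: "transpose S = S" and G: "G \<in> maxmon S" and \<gamma>: "\<gamma> \<in> Gamma \<nu>"
    and \<Psi>: "integrable \<nu> \<Psi>" "AE y in \<nu>. \<forall>x\<in>G. tang S x y \<le> \<Psi> y"
  shows "(\<integral>p. Sform S (fst p) (fst p) / 2 \<partial>\<gamma>) \<le> (\<integral>y. \<Psi> y \<partial>\<nu>)"
    and "(\<integral>y. \<Psi> y \<partial>\<nu>) \<le> (\<integral>p. Sform S (fst p) (fst p) / 2 \<partial>\<gamma>) \<Longrightarrow> AE p in \<gamma>. fst p \<in> PG S G (snd p)"
proof -
  interpret prob_space \<gamma> by (rule GammaD(2)[OF \<gamma>])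
  note L = GammaD(3,4)[OF \<gamma>]
  have fst_m: "fst \<in> borel_measurable \<gamma>" and snd_m: "snd \<in> borel_measurable \<gamma>" using L by (auto simp: L2vec_def)
  obtain g :: "nat \<Rightarrow> real^'n" where g: "range g \<subseteq> G" "G \<subseteq> closure (range g)"
    using countable_dense_subset[OF maxmon_nonempty[OF G]] by blast
  have int_\<Psi>: "integrable \<gamma> (\<lambda>p. \<Psi> (snd p))" and \<Psi>_eq: "(\<integral>p. \<Psi> (snd p) \<partial>\<gamma>) = (\<integral>y. \<Psi> y \<partial>\<nu>)"
  proof -
    have *: "integrable (distr \<gamma> borel snd) \<Psi>" unfolding GammaD(5)[OF \<gamma>] by (rule \<Psi>)
    have m: "\<Psi> \<in> borel_measurable borel" using borel_measurable_integrable[OF *] by simp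
    show "integrable \<gamma> (\<lambda>p. \<Psi> (snd p))" using * integrable_distr[OF snd_m] by blast
    show "(\<integral>p. \<Psi> (snd p) \<partial>\<gamma>) = (\<integral>y. \<Psi> y \<partial>\<nu>)"
      unfolding GammaD(5)[OF \<gamma>, symmetric] by (rule integral_distr[OF snd_m m, symmetric])
  qed
  have AE\<Psi>: "AE p in \<gamma>. \<forall>x\<in>G. tang S x (snd p) \<le> \<Psi> (snd p)"
    using \<Psi>(2) unfolding GammaD(5)[OF \<gamma>, symmetric] by (rule AE_distrD[OF snd_m])
  have int_const: "L2vec \<gamma> (\<lambda>_. c)" for c :: "real^'n" by (rule L2vec_bounded[OF finite_measure_axioms, of _ "norm c"]) auto
  have int_tang: "integrable \<gamma> (\<lambda>p. tang S (g k) (fst p))" for k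
    using L2vec_Sform[OF int_const L(1)] by (intro Bochner_Integration.integrable_diff) auto
  define q where "q p = Sform S (fst p) (fst p) / 2" for p :: "(real^'n) \<times> (real^'n)"
  have int_q: "integrable \<gamma> q" unfolding q_def using L2vec_Sform[OF L(1) L(1)] by auto
  define m where "m n x = (MAX k\<in>{..n}. tang S (g k) x)" for n x
  have m_ge: "tang S (g k) x \<le> m n x" if "k \<le> n" for k n x
    unfolding m_def using that by (intro Max_ge) auto
  have m_mono: "m n x \<le> m n' x" if "n \<le> n'" for n n' x
    unfolding m_def using that by (intro Max_mono) auto
  have m_ex: "\<exists>k\<le>n. m n x = tang S (g k) x" for n x
  proof -
    have "m n x \<in> (\<lambda>k. tang S (g k) x) ` {..n}" unfolding m_def by (intro Max_in) auto
    then show ?thesis by auto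
  qed
  have int_m: "integrable \<gamma> (\<lambda>p. m n (fst p))" for n
    unfolding m_def by (intro Bochner_Integration.integrable_MAX int_tang) auto
  have m_le: "(\<integral>p. m n (fst p) \<partial>\<gamma>) \<le> (\<integral>y. \<Psi> y \<partial>\<nu>)" for n
  proof -
    \<comment> \<open>A Borel index of the active tangent: \<open>S *v g (\<kappa> x)\<close> is a
      subgradient of \<open>m n\<close> at \<open>x\<close>, and the martingale property annihilates
      the integral of its product with \<open>y - x\<close>.\<close>
    define \<kappa> where "\<kappa> x = (LEAST k. k \<le> n \<and> m n x = tang S (g k) x)" for x
    have \<kappa>: "\<kappa> x \<le> n" "m n x = tang S (g (\<kappa> x)) x" for x
      using LeastI_ex[OF m_ex[of n x, unfolded conj_commute[of "_ \<le> _"]]] m_ex[of n x]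
      unfolding \<kappa>_def by (metis (mono_tags, lifting) LeastI_ex)+
    have mb: "m n \<in> borel_measurable borel" unfolding m_def by measurable
    have "\<kappa> \<in> measurable borel (count_space UNIV)"
      unfolding \<kappa>_def using mb by measurable
    then have \<theta>m: "(\<lambda>x. S *v g (\<kappa> x)) \<in> borel_measurable borel"
      by (rule measurable_compose) auto
    obtain c where c: "\<And>k. k \<le> n \<Longrightarrow> norm (S *v g k) \<le> c"
    proof
      show "norm (S *v g k) \<le> (MAX k\<in>{..n}. norm (S *v g k))" if "k \<le> n" for k
        using that by (intro Max_ge) auto
    qed
    have L\<theta>: "L2vec \<gamma> (\<lambda>p. S *v g (\<kappa> (fst p)))"
      by (rule L2vec_bounded[OF finite_measure_axioms measurable_compose[OF fst_m \<theta>m]]) (rule c[OF \<kappa>(1)])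
    have "(\<integral>p. m n (fst p) \<partial>\<gamma>) = (\<integral>p. m n (fst p) + (S *v g (\<kappa> (fst p))) \<bullet> snd p - (S *v g (\<kappa> (fst p))) \<bullet> fst p \<partial>\<gamma>)"
      using Gamma_test[OF \<gamma> \<theta>m L\<theta>] L2vec_inner[OF L\<theta> L(1)] L2vec_inner[OF L\<theta> L(2)] int_m[of n] by simp
    also have "\<dots> \<le> (\<integral>p. \<Psi> (snd p) \<partial>\<gamma>)"
    proof (rule integral_mono_AE)
      show "AE p in \<gamma>. m n (fst p) + (S *v g (\<kappa> (fst p))) \<bullet> snd p - (S *v g (\<kappa> (fst p))) \<bullet> fst p \<le> \<Psi> (snd p)"
        using AE\<Psi>
      proof eventually_elim
        case (elim p)
        have "m n (fst p) + (S *v g (\<kappa> (fst p))) \<bullet> snd p - (S *v g (\<kappa> (fst p))) \<bullet> fst p = tang S (g (\<kappa> (fst p))) (snd p)"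
          unfolding \<kappa>(2) Sform_eq_inner[OF sym] by simp
        also have "\<dots> \<le> \<Psi> (snd p)" using elim g(1) by blast
        finally show ?case .
      qed
    qed (use L2vec_inner[OF L\<theta> L(1)] L2vec_inner[OF L\<theta> L(2)] int_m[of n] int_\<Psi> in auto)
    finally show ?thesis by (simp only: \<Psi>_eq)
  qed
  have sup: "\<exists>k. Sform S x x / 2 - \<epsilon> \<le> tang S (g k) x" if "\<epsilon> > 0" for x \<epsilon>
  proof (rule ccontr)
    assume "\<not> ?thesis"
    then have kk: "tang S (g k) x \<le> Sform S x x / 2 - \<epsilon>" for k using linear by blast
    have "tang S a x \<le> Sform S x x / 2 - \<epsilon>" if "a \<in> G" for a
    proof (rule closure_le[of a "range g" "\<lambda>a. tang S a x"])
      show "a \<in> closure (range g)" using \<open>a \<in> G\<close> g(2) by blast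
      show "continuous_on UNIV (\<lambda>a. tang S a x)" by (intro continuous_intros) auto
    qed (use kk in blast)
    moreover obtain a where "a \<in> G" "Sform S x x / 2 \<le> tang S a x" using maxmon_tang_above[OF sym G] by blast
    ultimately show False using \<open>\<epsilon> > 0\<close> by fastforce
  qed
  \<comment> \<open>Truncation from above by the form and the fixed tangent at \<open>g 0\<close>
    from below give one integrable bound for the whole increasing sequence.\<close>
  have lim: "(\<lambda>n. min (m n x) (Sform S x x / 2)) \<longlonglongrightarrow> Sform S x x / 2" for x
  proof (rule LIMSEQ_I)
    fix \<epsilon> :: real assume "\<epsilon> > 0"
    then obtain k where k: "Sform S x x / 2 - \<epsilon> / 2 \<le> tang S (g k) x" using sup[of "\<epsilon>/2" x] by auto
    have "norm (min (m n x) (Sform S x x / 2) - Sform S x x / 2) < \<epsilon>" if "n \<ge> k" for n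
      using k m_ge[OF that, of x] \<open>\<epsilon> > 0\<close> by (auto simp: min_def)
    then show "\<exists>k. \<forall>n\<ge>k. norm (min (m n x) (Sform S x x / 2) - Sform S x x / 2) < \<epsilon>" by blast
  qed
  have int_min: "integrable \<gamma> (\<lambda>p. min (m n (fst p)) (q p))" for n using int_m[of n] int_q by (rule integrable_min)
  have lim_int: "(\<lambda>n. \<integral>p. min (m n (fst p)) (q p) \<partial>\<gamma>) \<longlonglongrightarrow> (\<integral>p. q p \<partial>\<gamma>)"
  proof (rule integral_dominated_convergence[where w = "\<lambda>p. \<bar>tang S (g 0) (fst p)\<bar> + \<bar>q p\<bar>"])
    show "AE p in \<gamma>. (\<lambda>n. min (m n (fst p)) (q p)) \<longlonglongrightarrow> q p"
      unfolding q_def by (intro always_eventually allI lim)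
    show "AE p in \<gamma>. norm (min (m n (fst p)) (q p)) \<le> \<bar>tang S (g 0) (fst p)\<bar> + \<bar>q p\<bar>" for n
    proof (intro always_eventually allI)
      fix p show "norm (min (m n (fst p)) (q p)) \<le> \<bar>tang S (g 0) (fst p)\<bar> + \<bar>q p\<bar>"
        using m_ge[of 0 n "fst p"] by (simp add: min_def abs_if)
    qed
    show "integrable \<gamma> (\<lambda>p. \<bar>tang S (g 0) (fst p)\<bar> + \<bar>q p\<bar>)"
      using int_tang[of 0] int_q by auto
  qed (use int_min int_q in auto)
  have min_le: "(\<integral>p. min (m n (fst p)) (q p) \<partial>\<gamma>) \<le> (\<integral>y. \<Psi> y \<partial>\<nu>)" for n
    by (rule order_trans[OF integral_mono m_le[of n]]) (use int_min int_m in auto)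
  show "(\<integral>p. Sform S (fst p) (fst p) / 2 \<partial>\<gamma>) \<le> (\<integral>y. \<Psi> y \<partial>\<nu>)"
    using LIMSEQ_le_const2[OF lim_int] min_le unfolding q_def by blast
  assume ge: "(\<integral>y. \<Psi> y \<partial>\<nu>) \<le> (\<integral>p. Sform S (fst p) (fst p) / 2 \<partial>\<gamma>)"
  have "AE p in \<gamma>. m n (fst p) \<le> q p" for n
  proof -
    \<comment> \<open>The excess over the form increases with \<open>n\<close>, while its integral
      is at most that of \<open>q\<close> minus the truncated one, and this difference tends to
      \<open>0\<close>.\<close>
    let ?e = "\<lambda>n p. m n (fst p) - min (m n (fst p)) (q p)"
    have ie: "integrable \<gamma> (?e n)" for n using int_m int_min by auto
    have "(\<integral>p. ?e n p \<partial>\<gamma>) \<le> 0"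
    proof (rule LIMSEQ_le_const)
      show "(\<lambda>n'. (\<integral>p. q p \<partial>\<gamma>) - (\<integral>p. min (m n' (fst p)) (q p) \<partial>\<gamma>)) \<longlonglongrightarrow> 0"
        using tendsto_diff[OF tendsto_const lim_int, of "\<integral>p. q p \<partial>\<gamma>"] by simp
      have "(\<integral>p. ?e n p \<partial>\<gamma>) \<le> (\<integral>p. q p \<partial>\<gamma>) - (\<integral>p. min (m n' (fst p)) (q p) \<partial>\<gamma>)" if "n' \<ge> n" for n'
      proof -
        have "(\<integral>p. ?e n p \<partial>\<gamma>) \<le> (\<integral>p. ?e n' p \<partial>\<gamma>)"
          by (intro integral_mono ie) (use m_mono[OF that] in \<open>auto simp: min_def intro: order_trans\<close>)
        also have "\<dots> = (\<integral>p. m n' (fst p) \<partial>\<gamma>) - (\<integral>p. min (m n' (fst p)) (q p) \<partial>\<gamma>)"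
          using int_m int_min by auto
        finally show ?thesis using m_le[of n'] ge unfolding q_def by linarith
      qed
      then show "\<exists>N. \<forall>n'\<ge>N. (\<integral>p. ?e n p \<partial>\<gamma>) \<le> (\<integral>p. q p \<partial>\<gamma>) - (\<integral>p. min (m n' (fst p)) (q p) \<partial>\<gamma>)" by blast
    qed
    moreover have "0 \<le> (\<integral>p. ?e n p \<partial>\<gamma>)" by (intro integral_nonneg_AE) auto
    ultimately have "AE p in \<gamma>. ?e n p = 0"
      using integral_nonneg_eq_0_iff_AE[OF ie[of n]] by auto
    then show ?thesis by eventually_elim (auto simp: min_def split: if_splits)
  qed
  then have "AE p in \<gamma>. \<forall>n. m n (fst p) \<le> q p" by (simp add: AE_all_countable)
  then have in_G: "AE p in \<gamma>. fst p \<in> G"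
  proof eventually_elim
    case (elim p)
    have kk: "tang S (g k) (fst p) \<le> Sform S (fst p) (fst p) / 2" for k
      using order_trans[OF m_ge[of k k "fst p"] spec[OF elim, of k]] by (simp add: q_def)
    have "tang S a (fst p) \<le> Sform S (fst p) (fst p) / 2" if "a \<in> G" for a
    proof (rule closure_le[of a "range g" "\<lambda>a. tang S a (fst p)"])
      show "a \<in> closure (range g)" using \<open>a \<in> G\<close> g(2) by blast
      show "continuous_on UNIV (\<lambda>a. tang S a (fst p))" by (intro continuous_intros) auto
    qed (use kk in blast)
    then show ?case using maxmon_mem_iff[OF sym G] by blast
  qed
  have int_d: "integrable \<gamma> (\<lambda>p. \<Psi> (snd p) - tang S (fst p) (snd p))"
    using int_\<Psi> L2vec_Sform[OF L(1,1)] L2vec_Sform[OF L(1,2)] by auto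
  \<comment> \<open>The gap is nonnegative because \<open>x\<close> lies in \<open>G\<close>, and
    its mean is nonpositive because \<open>S(x,y)\<close> and \<open>S(x,x)\<close> have the same
    integral.\<close>
  have "(\<integral>p. \<Psi> (snd p) - tang S (fst p) (snd p) \<partial>\<gamma>)
      = (\<integral>y. \<Psi> y \<partial>\<nu>) - ((\<integral>p. Sform S (fst p) (snd p) \<partial>\<gamma>) - (\<integral>p. Sform S (fst p) (fst p) / 2 \<partial>\<gamma>))"
    using int_\<Psi> L2vec_Sform[OF L(1,1)] L2vec_Sform[OF L(1,2)] \<Psi>_eq by simp
  also have "\<dots> \<le> 0" using ge unfolding Gamma_Sform_eq[OF \<gamma> sym] by simp
  finally have le0: "(\<integral>p. \<Psi> (snd p) - tang S (fst p) (snd p) \<partial>\<gamma>) \<le> 0" .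
  have nonneg: "AE p in \<gamma>. 0 \<le> \<Psi> (snd p) - tang S (fst p) (snd p)"
    using in_G AE\<Psi> by eventually_elim auto
  then have "(\<integral>p. \<Psi> (snd p) - tang S (fst p) (snd p) \<partial>\<gamma>) = 0"
    using le0 integral_nonneg_AE[OF nonneg] by linarith
  then have "AE p in \<gamma>. \<Psi> (snd p) - tang S (fst p) (snd p) = 0"
    using integral_nonneg_eq_0_iff_AE[OF int_d nonneg] by simp
  then show "AE p in \<gamma>. fst p \<in> PG S G (snd p)"
    using in_G AE\<Psi> by eventually_elim (auto simp: PG_iff)
qed

section \<open>Existence of optimal plans\<close>

lemma closed_indicator_approx:
  fixes F :: "'a::metric_space set"
  assumes "closed F" "F \<noteq> {}"
  shows "(\<lambda>k. max 0 (1 - real k * infdist x F)) \<longlonglongrightarrow> indicator F x"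
proof (cases "x \<in> F")
  case True
  then show ?thesis by simp
next
  case False
  then have pos: "infdist x F > 0"
    using assms in_closed_iff_infdist_zero[of F x] infdist_nonneg[of x F] by (simp add: less_le)
  obtain N where N: "1 < real N * infdist x F" using pos reals_Archimedean3 by blast
  have "max 0 (1 - real k * infdist x F) = 0" if "k \<ge> N" for k
  proof -
    have "real N * infdist x F \<le> real k * infdist x F" using that pos by (intro mult_right_mono) auto
    then show ?thesis using N by simp
  qed
  then have "\<forall>\<^sub>F k in sequentially. max 0 (1 - real k * infdist x F) = indicator F x"
    using False by (auto simp: eventually_sequentially)
  then show ?thesis by (rule tendsto_eventually)
qed

lemma borel_measure_eqI_closed:
  fixes M N :: "'a::topological_space measure"
  assumes "finite_measure M" "sets M = sets borel" "sets N = sets borel"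
    and eq: "\<And>F. closed F \<Longrightarrow> emeasure M F = emeasure N F"
  shows "M = N"
proof (rule measure_eqI_generator_eq[where E = "Collect closed" and \<Omega> = UNIV and A = "\<lambda>_. UNIV"])
  interpret finite_measure M by fact
  show "Int_stable (Collect closed)" by (auto simp: Int_stable_def)
  show "sets M = sigma_sets UNIV (Collect closed)" "sets N = sigma_sets UNIV (Collect closed)"
    using assms by (simp_all add: borel_eq_closed)
  show "emeasure M UNIV \<noteq> \<infinity>" by simp
qed (use eq in auto)

text \<open>The positive and negative parts of \<open>k\<close>, used as densities, have images
  under \<open>X\<close> that agree on closed sets. These generate the Borel sets and are stable
  under intersection.\<close>

lemma integral_indicator_closed_extend:
  fixes X :: "'w \<Rightarrow> 'a::topological_space" and k :: "'w \<Rightarrow> real"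
  assumes X [measurable]: "X \<in> borel_measurable M" and k: "integrable M k"
    and closed0: "\<And>F. closed F \<Longrightarrow> (\<integral>w. indicator F (X w) * k w \<partial>M) = 0"
    and A: "A \<in> sets borel"
  shows "(\<integral>w. indicator A (X w) * k w \<partial>M) = 0"
proof -
  have [measurable]: "k \<in> borel_measurable M" using k by simp
  define N where "N h = distr (density M (\<lambda>w. ennreal (h w))) borel X" for h :: "'w \<Rightarrow> real"
  have kp: "integrable M (\<lambda>w. max 0 (k w))" "integrable M (\<lambda>w. max 0 (- k w))" using k by auto
  have int: "integrable M (\<lambda>w. indicator B (X w) * h w)" if h: "integrable M h" and [measurable]: "B \<in> sets borel" for h :: "'w \<Rightarrow> real" and B
    by (rule Bochner_Integration.integrable_bound[OF h])
      (use h in \<open>auto simp: indicator_def intro!: always_eventually\<close>)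
  have em: "emeasure (N h) B = ennreal (\<integral>w. indicator B (X w) * h w \<partial>M)"
    if h: "integrable M h" "\<And>w. 0 \<le> h w" and [measurable]: "B \<in> sets borel" for h :: "'w \<Rightarrow> real" and B
  proof -
    have [measurable]: "h \<in> borel_measurable M" using h by simp
    have "emeasure (N h) B = (\<integral>\<^sup>+w. ennreal (h w) * indicator (X -` B \<inter> space M) w \<partial>M)"
      unfolding N_def by (simp add: emeasure_distr emeasure_density)
    also have "\<dots> = (\<integral>\<^sup>+w. ennreal (indicator B (X w) * h w) \<partial>M)"
      by (intro nn_integral_cong) (auto simp: indicator_def)
    also have "\<dots> = ennreal (\<integral>w. indicator B (X w) * h w \<partial>M)"
      using h int[OF h(1)] by (intro nn_integral_eq_integral) auto
    finally show ?thesis .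
  qed
  have split: "(\<integral>w. indicator B (X w) * k w \<partial>M) = (\<integral>w. indicator B (X w) * max 0 (k w) \<partial>M) - (\<integral>w. indicator B (X w) * max 0 (- k w) \<partial>M)"
    if "B \<in> sets borel" for B
    unfolding Bochner_Integration.integral_diff[OF int[OF kp(1) that] int[OF kp(2) that], symmetric]
    by (intro Bochner_Integration.integral_cong) (auto simp: max_def indicator_def)
  have "N (\<lambda>w. max 0 (k w)) = N (\<lambda>w. max 0 (- k w))"
  proof (rule borel_measure_eqI_closed)
    show "finite_measure (N (\<lambda>w. max 0 (k w)))"
    proof (rule finite_measureI)
      have "space (N (\<lambda>w. max 0 (k w))) = UNIV" by (simp add: N_def)
      then show "emeasure (N (\<lambda>w. max 0 (k w))) (space (N (\<lambda>w. max 0 (k w)))) \<noteq> \<infinity>"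
        using em[OF kp(1), of UNIV] by simp
    qed
    fix F :: "'a set" assume "closed F"
    then show "emeasure (N (\<lambda>w. max 0 (k w))) F = emeasure (N (\<lambda>w. max 0 (- k w))) F"
      using em[OF kp(1), of F] em[OF kp(2), of F] split[of F] closed0[of F] by simp
  qed (simp_all add: N_def)
  then have "ennreal (\<integral>w. indicator A (X w) * max 0 (k w) \<partial>M) = ennreal (\<integral>w. indicator A (X w) * max 0 (- k w) \<partial>M)"
    using em[OF kp(1) _ A] em[OF kp(2) _ A] by simp
  then have "(\<integral>w. indicator A (X w) * max 0 (k w) \<partial>M) = (\<integral>w. indicator A (X w) * max 0 (- k w) \<partial>M)"
    by (subst (asm) ennreal_inj) (auto intro!: integral_nonneg_AE)
  then show ?thesis using split[OF A] by simp
qed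

text \<open>Fatou's lemma applied to \<open>\<delta>|x|\<^sup>2 + C(1 + |y|\<^sup>2) - f\<close>; the integrals of \<open>|y|\<^sup>2\<close> do not depend on \<open>n\<close>.\<close>
lemma limit_usc:
  fixes X Y :: "nat \<Rightarrow> 'w \<Rightarrow> real^'n" and f :: "real^'n \<Rightarrow> real^'n \<Rightarrow> real"
  assumes "prob_space M"
    and L: "\<And>n. L2vec M (X n)" "\<And>n. L2vec M (Y n)" "L2vec M X'" "L2vec M Y'"
    and cx: "\<And>n. (\<integral>w. (norm (X n w))\<^sup>2 \<partial>M) \<le> c" and cy: "\<And>n. (\<integral>w. (norm (Y n w))\<^sup>2 \<partial>M) = c" "(\<integral>w. (norm (Y' w))\<^sup>2 \<partial>M) = c"
    and lim: "AE w in M. (\<lambda>n. X n w) \<longlonglongrightarrow> X' w \<and> (\<lambda>n. Y n w) \<longlonglongrightarrow> Y' w"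
    and f: "\<And>n. integrable M (\<lambda>w. f (X n w) (Y n w))" "integrable M (\<lambda>w. f (X' w) (Y' w))"
    and cont: "continuous_on UNIV (\<lambda>p. f (fst p) (snd p))"
    and growth: "\<And>\<delta>. \<delta> > 0 \<Longrightarrow> \<exists>C. \<forall>x y. f x y \<le> \<delta> * (norm x)\<^sup>2 + C * (1 + (norm y)\<^sup>2)"
    and P: "\<And>n. P \<le> (\<integral>w. f (X n w) (Y n w) \<partial>M)"
  shows "P \<le> (\<integral>w. f (X' w) (Y' w) \<partial>M)"
proof -
  interpret prob_space M by fact
  have c0: "c \<ge> 0" unfolding cy(2)[symmetric] by simp
  have isq: "integrable M (\<lambda>w. (norm (Z w))\<^sup>2)" if "L2vec M Z" for Z :: "'w \<Rightarrow> real^'n" using that by (simp add: L2vec_def)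
  have step: "P \<le> (\<integral>w. f (X' w) (Y' w) \<partial>M) + \<delta> * c" if \<delta>: "\<delta> > 0" for \<delta>
  proof -
    obtain C where C: "\<And>x y. f x y \<le> \<delta> * (norm x)\<^sup>2 + C * (1 + (norm y)\<^sup>2)" using growth[OF \<delta>] by blast
    define g where "g x y = \<delta> * (norm x)\<^sup>2 + C * (1 + (norm y)\<^sup>2) - f x y" for x y
    have g0: "g x y \<ge> 0" for x y using C[of x y] by (simp add: g_def)
    have ig: "integrable M (\<lambda>w. g (X n w) (Y n w))" for n
      unfolding g_def by (intro Bochner_Integration.integrable_diff Bochner_Integration.integrable_add integrable_mult_right isq L f integrable_const)
    have ig': "integrable M (\<lambda>w. g (X' w) (Y' w))"
      unfolding g_def by (intro Bochner_Integration.integrable_diff Bochner_Integration.integrable_add integrable_mult_right isq L f integrable_const)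
    have eg: "(\<integral>w. g (X n w) (Y n w) \<partial>M) = \<delta> * (\<integral>w. (norm (X n w))\<^sup>2 \<partial>M) + C * (1 + c) - (\<integral>w. f (X n w) (Y n w) \<partial>M)" for n
      unfolding g_def using isq[OF L(1)[of n]] isq[OF L(2)[of n]] f(1)[of n] cy(1)[of n] by (simp add: prob_space)
    have eg': "(\<integral>w. g (X' w) (Y' w) \<partial>M) = \<delta> * (\<integral>w. (norm (X' w))\<^sup>2 \<partial>M) + C * (1 + c) - (\<integral>w. f (X' w) (Y' w) \<partial>M)"
      unfolding g_def using isq[OF L(3)] isq[OF L(4)] f(2) cy(2) by (simp add: prob_space)
    define R where "R = \<delta> * c + C * (1 + c) - P"
    have gR: "(\<integral>w. g (X n w) (Y n w) \<partial>M) \<le> R" for n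
    proof -
      have "\<delta> * (\<integral>w. (norm (X n w))\<^sup>2 \<partial>M) \<le> \<delta> * c" using cx[of n] \<delta> by (intro mult_left_mono) auto
      then show ?thesis unfolding eg R_def using P[of n] by linarith
    qed
    have R0: "R \<ge> 0" 
      by (rule order_trans[OF integral_nonneg_AE gR[of 0]]) (use g0 in auto)
    have "ennreal (\<integral>w. g (X' w) (Y' w) \<partial>M) = (\<integral>\<^sup>+w. ennreal (g (X' w) (Y' w)) \<partial>M)"
      using ig' g0 by (intro nn_integral_eq_integral[symmetric]) auto
    also have "\<dots> = (\<integral>\<^sup>+w. liminf (\<lambda>n. ennreal (g (X n w) (Y n w))) \<partial>M)"
    proof (rule nn_integral_cong_AE)
      show "AE w in M. ennreal (g (X' w) (Y' w)) = liminf (\<lambda>n. ennreal (g (X n w) (Y n w)))"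
        using lim
      proof eventually_elim
        case (elim w)
        then have "(\<lambda>n. (X n w, Y n w)) \<longlonglongrightarrow> (X' w, Y' w)" by (intro tendsto_Pair) auto
        from continuous_on_tendsto_compose[OF cont this]
        have fl: "(\<lambda>n. f (X n w) (Y n w)) \<longlonglongrightarrow> f (X' w) (Y' w)" by simp
        have "(\<lambda>n. g (X n w) (Y n w)) \<longlonglongrightarrow> g (X' w) (Y' w)"
          unfolding g_def using elim by (intro tendsto_intros fl) auto
        then have "(\<lambda>n. ennreal (g (X n w) (Y n w))) \<longlonglongrightarrow> ennreal (g (X' w) (Y' w))" by (rule tendsto_ennrealI)
        then show ?case by (intro lim_imp_Liminf[symmetric]) auto
      qed
    qed
    also have "\<dots> \<le> liminf (\<lambda>n. \<integral>\<^sup>+w. ennreal (g (X n w) (Y n w)) \<partial>M)"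
      by (rule nn_integral_liminf) (use ig in auto)
    also have "\<dots> \<le> liminf (\<lambda>n::nat. ennreal R)"
    proof (rule Liminf_mono, rule always_eventually, rule allI)
      fix n show "(\<integral>\<^sup>+w. ennreal (g (X n w) (Y n w)) \<partial>M) \<le> ennreal R"
        using nn_integral_eq_integral[OF ig[of n]] g0 gR[of n] by (simp add: ennreal_leI)
    qed
    also have "\<dots> = ennreal R" by (simp add: Liminf_const)
    finally have "(\<integral>w. g (X' w) (Y' w) \<partial>M) \<le> R" using R0 by (simp add: ennreal_le_iff)
    moreover have "0 \<le> \<delta> * (\<integral>w. (norm (X' w))\<^sup>2 \<partial>M)" using \<delta> by simp
    ultimately show ?thesis unfolding eg' R_def by linarith
  qed
  show ?thesis
  proof (rule field_le_epsilon)
    fix e :: real assume "e > 0"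
    \<comment> \<open>The loss at parameter \<open>\<delta>\<close> is \<open>\<delta> * c\<close>;
      the choice \<open>\<delta> = e / (c + 1)\<close> also covers \<open>c = 0\<close>.\<close>
    have "e / (c + 1) * c \<le> e"
    proof -
      have "c / (c + 1) \<le> 1" using c0 by simp
      then have "e * (c / (c + 1)) \<le> e * 1" using \<open>e > 0\<close> by (intro mult_left_mono) auto
      then show ?thesis by simp
    qed
    then show "P \<le> (\<integral>w. f (X' w) (Y' w) \<partial>M) + e"
      using step[of "e / (c + 1)"] \<open>e > 0\<close> c0 by auto
  qed
qed

lemma young_ineq:
  fixes K a b \<delta> :: real
  assumes "\<delta> > 0"
  shows "K * a * b \<le> \<delta> * a\<^sup>2 + K\<^sup>2 / (4 * \<delta>) * b\<^sup>2"
proof -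
  have "0 \<le> (2 * \<delta> * a - K * b)\<^sup>2" by simp
  then have "4 * \<delta> * (K * a * b) \<le> 4 * \<delta> * (\<delta> * a\<^sup>2) + K\<^sup>2 * b\<^sup>2"
    by (simp add: power2_eq_square algebra_simps)
  also have "\<dots> = 4 * \<delta> * (\<delta> * a\<^sup>2 + K\<^sup>2 / (4 * \<delta>) * b\<^sup>2)" using assms by (simp add: field_simps)
  finally show ?thesis using assms by (subst (asm) mult_le_cancel_left_pos) auto
qed

text \<open>Along a maximizing sequence the second moments of \<open>x\<close> are bounded but may
  drop in the limit, so only the semicontinuity of \<open>limit_usc\<close> is available. It
  suffices for the reward, and applied to both signs of a test function it preserves the martingale
  identity.\<close>

theorem optimal_plan_exists:
  fixes \<nu> :: "(real^'n) measure" and S :: "real^'n^'n"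
  assumes prob: "prob_space \<nu>" and sets_\<nu>: "sets \<nu> = sets borel" and L2: "L2vec \<nu> (\<lambda>y. y)"
  shows "\<exists>\<gamma>. optimal_plan \<nu> S \<gamma>"
proof -
  interpret \<nu>: prob_space \<nu> by (rule prob)
  define c where "c = (\<integral>y. (norm y)\<^sup>2 \<partial>\<nu>)"
  obtain K where K: "K > 0" "\<And>x y. \<bar>Sform S x y\<bar> \<le> K * norm x * norm y" using Sform_bound[of S] by blast
  define val where "val \<gamma> = (\<integral>p. Sform S (fst p) (snd p) \<partial>\<gamma>)" for \<gamma> :: "((real^'n) \<times> (real^'n)) measure"
  have c0: "c \<ge> 0" unfolding c_def by simp
  \<comment> \<open>The plan with \<open>x = y\<close> shows that there are plans at all.\<close>
  have ne: "distr \<nu> borel (\<lambda>y. (y, y)) \<in> Gamma \<nu>"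
    by (rule GammaI[OF prob L2 L2]) (auto simp: sets_\<nu> intro: distr_id2)
  have val_le: "val \<gamma> \<le> K * 2 * c" if \<gamma>: "\<gamma> \<in> Gamma \<nu>" for \<gamma>
  proof -
    note LL = GammaD(3,4)[OF \<gamma>]
    have "val \<gamma> \<le> (\<integral>p. K * ((norm (fst p))\<^sup>2 + (norm (snd p))\<^sup>2) \<partial>\<gamma>)"
      unfolding val_def
    proof (rule integral_mono)
      fix p :: "(real^'n) \<times> (real^'n)"
      have "norm (fst p) * norm (snd p) \<le> (norm (fst p))\<^sup>2 + (norm (snd p))\<^sup>2"
      proof -
        have "0 \<le> norm (fst p) * norm (snd p)" by simp
        then show ?thesis using sum_squares_bound[of "norm (fst p)" "norm (snd p)"] by linarith
      qed
      then have "K * (norm (fst p) * norm (snd p)) \<le> K * ((norm (fst p))\<^sup>2 + (norm (snd p))\<^sup>2)"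
        using K(1) by (intro mult_left_mono) auto
      then show "Sform S (fst p) (snd p) \<le> K * ((norm (fst p))\<^sup>2 + (norm (snd p))\<^sup>2)"
        using K(2)[of "fst p" "snd p"] by (simp add: mult.assoc)
    qed (use LL L2vec_Sform[OF LL] in \<open>auto simp: L2vec_def\<close>)
    also have "\<dots> = K * ((\<integral>p. (norm (fst p))\<^sup>2 \<partial>\<gamma>) + (\<integral>p. (norm (snd p))\<^sup>2 \<partial>\<gamma>))"
      using LL by (simp add: L2vec_def)
    also have "\<dots> \<le> K * (c + c)"
      using Gamma_second_moment[OF \<gamma>] K(1) unfolding c_def by (intro mult_left_mono) auto
    finally show ?thesis by simp
  qed
  define P where "P = Sup (val ` Gamma \<nu>)"
  have bdd: "bdd_above (val ` Gamma \<nu>)" using val_le by (intro bdd_aboveI2[of _ _ "K * 2 * c"]) auto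
  have "\<exists>\<gamma>\<in>Gamma \<nu>. P - inverse (real (Suc n)) < val \<gamma>" for n
  proof -
    have "P - inverse (real (Suc n)) < Sup (val ` Gamma \<nu>)" unfolding P_def by simp
    then have "\<exists>r\<in>val ` Gamma \<nu>. P - inverse (real (Suc n)) < r"
      by (subst (asm) less_cSup_iff) (use bdd ne in auto)
    then show ?thesis by blast
  qed
  then obtain \<gamma>s where \<gamma>s: "\<And>n. \<gamma>s n \<in> Gamma \<nu>" "\<And>n. P - inverse (real (Suc n)) < val (\<gamma>s n)" by metis
  have bound: "(\<integral>\<^sup>+ p. ennreal (norm p) \<partial>\<gamma>s n) \<le> ennreal (1 + (c + c))" for n
  proof -
    interpret g: prob_space "\<gamma>s n" by (rule GammaD(2)[OF \<gamma>s(1)])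
    note LL = GammaD(3,4)[OF \<gamma>s(1)[of n]]
    have i: "integrable (\<gamma>s n) (\<lambda>p. 1 + ((norm (fst p))\<^sup>2 + (norm (snd p))\<^sup>2))" using LL by (auto simp: L2vec_def)
    have le: "norm p \<le> 1 + ((norm (fst p))\<^sup>2 + (norm (snd p))\<^sup>2)" for p :: "(real^'n) \<times> (real^'n)"
    proof -
      have "2 * norm p \<le> 1 + (norm p)\<^sup>2" "0 \<le> (norm p)\<^sup>2" using sum_squares_bound[of "norm p" 1] by simp_all
      then have "norm p \<le> 1 + (norm p)\<^sup>2" by linarith
      then show ?thesis by (simp add: norm_prod_def)
    qed
    have "(\<integral>\<^sup>+ p. ennreal (norm p) \<partial>\<gamma>s n) \<le> (\<integral>\<^sup>+ p. ennreal (1 + ((norm (fst p))\<^sup>2 + (norm (snd p))\<^sup>2)) \<partial>\<gamma>s n)"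
      by (intro nn_integral_mono ennreal_leI le)
    also have "\<dots> = ennreal (\<integral>p. 1 + ((norm (fst p))\<^sup>2 + (norm (snd p))\<^sup>2) \<partial>\<gamma>s n)"
      using i by (intro nn_integral_eq_integral) (auto intro!: always_eventually)
    also have "(\<integral>p. 1 + ((norm (fst p))\<^sup>2 + (norm (snd p))\<^sup>2) \<partial>\<gamma>s n) = 1 + ((\<integral>p. (norm (fst p))\<^sup>2 \<partial>\<gamma>s n) + (\<integral>p. (norm (snd p))\<^sup>2 \<partial>\<gamma>s n))"
      using LL by (simp add: L2vec_def g.prob_space)
    also have "\<dots> \<le> 1 + (c + c)" using Gamma_second_moment[OF \<gamma>s(1)[of n]] unfolding c_def by simp
    finally show ?thesis by (simp add: ennreal_leI)
  qed
  obtain s and \<Omega> :: "real measure" and W V where s: "strict_mono s" and \<Omega>: "prob_space \<Omega>"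
    and W: "\<And>n. W n \<in> borel_measurable \<Omega>" and V: "V \<in> borel_measurable \<Omega>"
    and dW: "\<And>n. distr \<Omega> borel (W n) = \<gamma>s (s n)" and WV: "AE \<omega> in \<Omega>. (\<lambda>n. W n \<omega>) \<longlonglongrightarrow> V \<omega>"
    using prokhorov_skorohod[of \<gamma>s, OF GammaD(2)[OF \<gamma>s(1)] GammaD(1)[OF \<gamma>s(1)] bound] by blast
  interpret \<Omega>: prob_space \<Omega> by (rule \<Omega>)
  note fs = borel_measurable_fst_snd[where 'a = "real^'n" and 'b = "real^'n"]
  define X where "X n \<omega> = fst (W n \<omega>)" for n \<omega>
  define Y where "Y n \<omega> = snd (W n \<omega>)" for n \<omega>
  define X' where "X' \<omega> = fst (V \<omega>)" for \<omega>
  define Y' where "Y' \<omega> = snd (V \<omega>)" for \<omega>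
  have Xm [measurable]: "X n \<in> borel_measurable \<Omega>" and Ym [measurable]: "Y n \<in> borel_measurable \<Omega>" for n
    unfolding X_def Y_def by (rule measurable_compose[OF W fs(1)], rule measurable_compose[OF W fs(2)])
  have Xm' [measurable]: "X' \<in> borel_measurable \<Omega>" and Ym' [measurable]: "Y' \<in> borel_measurable \<Omega>"
    unfolding X'_def Y'_def by (rule measurable_compose[OF V fs(1)], rule measurable_compose[OF V fs(2)])
  have lim: "AE \<omega> in \<Omega>. (\<lambda>n. X n \<omega>) \<longlonglongrightarrow> X' \<omega> \<and> (\<lambda>n. Y n \<omega>) \<longlonglongrightarrow> Y' \<omega>"
    using WV unfolding X_def Y_def X'_def Y'_def by eventually_elim (auto intro: tendsto_fst tendsto_snd)
  have integral_W: "(\<integral>\<omega>. h (W n \<omega>) \<partial>\<Omega>) = (\<integral>p. h p \<partial>\<gamma>s (s n))" if "h \<in> borel_measurable borel" for h :: "_ \<Rightarrow> real" and n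
    unfolding dW[symmetric] using that by (intro integral_distr[symmetric] W)
  have LX: "L2vec \<Omega> (X n)" and LY: "L2vec \<Omega> (Y n)" for n
    using L2vec_distr[OF W fs(1), of n] L2vec_distr[OF W fs(2), of n] GammaD(3,4)[OF \<gamma>s(1)[of "s n"]]
    unfolding dW X_def Y_def by auto
  have cX: "(\<integral>\<omega>. (norm (X n \<omega>))\<^sup>2 \<partial>\<Omega>) \<le> c" and cY: "(\<integral>\<omega>. (norm (Y n \<omega>))\<^sup>2 \<partial>\<Omega>) = c" for n
    using Gamma_second_moment[OF \<gamma>s(1)[of "s n"]] integral_W[of "\<lambda>p. (norm (fst p))\<^sup>2" n] integral_W[of "\<lambda>p. (norm (snd p))\<^sup>2" n] fs
    unfolding c_def X_def Y_def by auto
  have law_Y: "distr \<Omega> borel (Y n) = \<nu>" for n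
    using distr_distr[OF fs(2) W, of n] GammaD(5)[OF \<gamma>s(1)[of "s n"]] unfolding dW Y_def by (simp add: comp_def)
  have law_Y': "distr \<Omega> borel Y' = \<nu>"
  proof (rule borel_measure_eqI_closed)
    interpret d: prob_space "distr \<Omega> borel Y'" by (rule \<Omega>.prob_space_distr[OF Ym'])
    show "finite_measure (distr \<Omega> borel Y')" by unfold_locales
    fix F :: "(real^'n) set" assume F: "closed F"
    show "emeasure (distr \<Omega> borel Y') F = emeasure \<nu> F"
    proof (cases "F = {}")
      case False
      define \<phi> where "\<phi> k y = max 0 (1 - real k * infdist y F)" for k y
      have \<phi>c: "continuous_on UNIV (\<phi> k)" for k unfolding \<phi>_def by (intro continuous_intros)
      then have [measurable]: "\<phi> k \<in> borel_measurable borel" for k by (rule borel_measurable_continuous_onI)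
      have \<phi>b: "norm (\<phi> k y) \<le> 1" for k y unfolding \<phi>_def using infdist_nonneg[of y F] by (simp add: mult_nonneg_nonneg)
      have \<phi>l: "(\<lambda>k. \<phi> k y) \<longlonglongrightarrow> indicator F y" for y unfolding \<phi>_def by (rule closed_indicator_approx[OF F False])
      have [measurable]: "F \<in> sets borel" using F by simp
      have "(\<integral>\<omega>. \<phi> k (Y' \<omega>) \<partial>\<Omega>) = (\<integral>y. \<phi> k y \<partial>\<nu>)" for k
      proof (rule LIMSEQ_unique)
        show "(\<lambda>n. \<integral>\<omega>. \<phi> k (Y n \<omega>) \<partial>\<Omega>) \<longlonglongrightarrow> (\<integral>\<omega>. \<phi> k (Y' \<omega>) \<partial>\<Omega>)"
        proof (rule integral_dominated_convergence[where w = "\<lambda>_. 1"])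
          show "AE \<omega> in \<Omega>. (\<lambda>n. \<phi> k (Y n \<omega>)) \<longlonglongrightarrow> \<phi> k (Y' \<omega>)"
            using lim by eventually_elim (auto intro: continuous_on_tendsto_compose[OF \<phi>c])
        qed (use \<phi>b in auto)
        have "(\<integral>\<omega>. \<phi> k (Y n \<omega>) \<partial>\<Omega>) = (\<integral>y. \<phi> k y \<partial>\<nu>)" for n
          unfolding law_Y[of n, symmetric] by (rule integral_distr[symmetric]) auto
        then show "(\<lambda>n. \<integral>\<omega>. \<phi> k (Y n \<omega>) \<partial>\<Omega>) \<longlonglongrightarrow> (\<integral>y. \<phi> k y \<partial>\<nu>)" by simp
      qed
      moreover have "(\<lambda>k. \<integral>\<omega>. \<phi> k (Y' \<omega>) \<partial>\<Omega>) \<longlonglongrightarrow> (\<integral>\<omega>. indicator F (Y' \<omega>) \<partial>\<Omega>)"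
        by (rule integral_dominated_convergence[where w = "\<lambda>_. 1"]) (use \<phi>b \<phi>l in auto)
      moreover have "(\<lambda>k. \<integral>y. \<phi> k y \<partial>\<nu>) \<longlonglongrightarrow> (\<integral>y. indicator F y \<partial>\<nu>)"
        by (rule integral_dominated_convergence[where w = "\<lambda>_. 1"]) (use \<phi>b \<phi>l sets_\<nu> in \<open>auto simp: measurable_cong_sets[OF sets_\<nu> refl]\<close>)
      ultimately have "(\<integral>\<omega>. indicator F (Y' \<omega>) \<partial>\<Omega>) = (\<integral>y. indicat_real F y \<partial>\<nu>)"
        by (simp add: LIMSEQ_unique)
      also have "(\<integral>\<omega>. indicator F (Y' \<omega>) \<partial>\<Omega>) = (\<integral>y. indicat_real F y \<partial>distr \<Omega> borel Y')"
        by (rule integral_distr[symmetric]) auto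
      finally have "measure (distr \<Omega> borel Y') F = measure \<nu> F" using sets_\<nu> by simp
      then show ?thesis by (simp add: d.emeasure_eq_measure \<nu>.emeasure_eq_measure)
    qed simp
  qed (simp_all add: sets_\<nu>)
  have LY': "L2vec \<Omega> Y'" using L2vec_distr[OF Ym', of "\<lambda>y. y"] L2 unfolding law_Y' by simp
  have cY': "(\<integral>\<omega>. (norm (Y' \<omega>))\<^sup>2 \<partial>\<Omega>) = c"
    unfolding c_def law_Y'[symmetric] by (rule integral_distr[symmetric]) auto
  have LX': "L2vec \<Omega> X'"
    unfolding L2vec_def
  proof (intro conjI Xm' integrableI_bounded)
    have "(\<integral>\<^sup>+ \<omega>. ennreal ((norm (X' \<omega>))\<^sup>2) \<partial>\<Omega>) = (\<integral>\<^sup>+ \<omega>. liminf (\<lambda>n. ennreal ((norm (X n \<omega>))\<^sup>2)) \<partial>\<Omega>)"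
    proof (rule nn_integral_cong_AE)
      show "AE \<omega> in \<Omega>. ennreal ((norm (X' \<omega>))\<^sup>2) = liminf (\<lambda>n. ennreal ((norm (X n \<omega>))\<^sup>2))"
        using lim
      proof eventually_elim
        case (elim \<omega>)
        then have "(\<lambda>n. ennreal ((norm (X n \<omega>))\<^sup>2)) \<longlonglongrightarrow> ennreal ((norm (X' \<omega>))\<^sup>2)"
          by (intro tendsto_ennrealI tendsto_power tendsto_norm) auto
        then show ?case by (intro lim_imp_Liminf[symmetric]) auto
      qed
    qed
    also have "\<dots> \<le> liminf (\<lambda>n. \<integral>\<^sup>+ \<omega>. ennreal ((norm (X n \<omega>))\<^sup>2) \<partial>\<Omega>)"
      by (rule nn_integral_liminf) auto
    also have "\<dots> \<le> liminf (\<lambda>n::nat. ennreal c)"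
    proof (rule Liminf_mono, rule always_eventually, rule allI)
      fix n
      have "(\<integral>\<^sup>+ \<omega>. ennreal ((norm (X n \<omega>))\<^sup>2) \<partial>\<Omega>) = ennreal (\<integral>\<omega>. (norm (X n \<omega>))\<^sup>2 \<partial>\<Omega>)"
        using LX[of n] by (intro nn_integral_eq_integral) (auto simp: L2vec_def)
      then show "(\<integral>\<^sup>+ \<omega>. ennreal ((norm (X n \<omega>))\<^sup>2) \<partial>\<Omega>) \<le> ennreal c" using cX[of n] by (simp add: ennreal_leI)
    qed
    also have "\<dots> < \<infinity>" by (simp add: Liminf_const)
    finally show "(\<integral>\<^sup>+ \<omega>. ennreal (norm ((norm (X' \<omega>))\<^sup>2)) \<partial>\<Omega>) < \<infinity>" by simp
  qed auto
  note usc = limit_usc[OF \<Omega> LX LY LX' LY' cX cY cY' lim]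
  have mart_closed: "(\<integral>\<omega>. indicator F (X' \<omega>) * (u \<bullet> (Y' \<omega> - X' \<omega>)) \<partial>\<Omega>) = 0" if F: "closed F" for F u
  proof (cases "F = {}")
    case False
    define \<phi> where "\<phi> k x = max 0 (1 - real k * infdist x F)" for k x
    have \<phi>c: "continuous_on UNIV (\<phi> k)" for k unfolding \<phi>_def by (intro continuous_intros)
    then have \<phi>m [measurable]: "\<phi> k \<in> borel_measurable borel" for k by (rule borel_measurable_continuous_onI)
    have \<phi>b: "\<bar>\<phi> k x\<bar> \<le> 1" for k x unfolding \<phi>_def using infdist_nonneg[of x F] by (simp add: mult_nonneg_nonneg)
    have L\<phi>: "L2vec \<Omega> (\<lambda>\<omega>. (\<phi> k (Z \<omega>)) *\<^sub>R u)" if [measurable]: "Z \<in> borel_measurable \<Omega>" for Z k and u :: "real^'n"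
      by (rule L2vec_bounded[OF \<Omega>.finite_measure_axioms, of _ "norm u"]) (use \<phi>b in \<open>auto intro: mult_left_le_one_le\<close>)
    \<comment> \<open>\<open>\<phi> k\<close> is a continuous approximation of the indicator of
      \<open>F\<close>; \<open>u\<close> and \<open>- u\<close> together will give equality.\<close>
    have ge: "0 \<le> (\<integral>\<omega>. \<phi> k (X' \<omega>) * (u \<bullet> (Y' \<omega> - X' \<omega>)) \<partial>\<Omega>)" for k u
    proof (rule usc[of "\<lambda>x y. \<phi> k x * (u \<bullet> (y - x))"])
      show "integrable \<Omega> (\<lambda>w. \<phi> k (X n w) * (u \<bullet> (Y n w - X n w)))" for n
        using L2vec_inner[OF L\<phi>[OF Xm] L2vec_diff[OF LY LX], of k n u n n] by simp
      show "integrable \<Omega> (\<lambda>w. \<phi> k (X' w) * (u \<bullet> (Y' w - X' w)))"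
        using L2vec_inner[OF L\<phi>[OF Xm'] L2vec_diff[OF LY' LX'], of k u] by simp
      show "continuous_on UNIV (\<lambda>p. \<phi> k (fst p) * (u \<bullet> (snd p - fst p)))"
        by (intro continuous_intros continuous_on_compose2[OF \<phi>c]) auto
      show "\<exists>C. \<forall>x y. \<phi> k x * (u \<bullet> (y - x)) \<le> \<delta> * (norm x)\<^sup>2 + C * (1 + (norm y)\<^sup>2)" if \<delta>: "\<delta> > 0" for \<delta>
      proof (intro exI allI)
        fix x y :: "real^'n"
        have "\<phi> k x * (u \<bullet> (y - x)) \<le> \<bar>\<phi> k x\<bar> * \<bar>u \<bullet> (y - x)\<bar>" by (metis abs_ge_self abs_mult)
        also have "\<dots> \<le> 1 * (norm u * norm (y - x))"
          using \<phi>b by (intro mult_mono Cauchy_Schwarz_ineq2) auto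
        also have "\<dots> \<le> norm u * norm x * 1 + norm u * norm y"
          using mult_left_mono[OF norm_triangle_ineq4[of y x], of "norm u"] by (simp add: algebra_simps)
        also have "\<dots> \<le> \<delta> * (norm x)\<^sup>2 + (norm u)\<^sup>2 / (4 * \<delta>) + norm u * (1 + (norm y)\<^sup>2)"
        proof (intro add_mono)
          show "norm u * norm x * 1 \<le> \<delta> * (norm x)\<^sup>2 + (norm u)\<^sup>2 / (4 * \<delta>)"
            using young_ineq[OF \<delta>, of "norm u" "norm x" 1] by simp
          have "2 * norm y \<le> 1 + (norm y)\<^sup>2" "0 \<le> (norm y)\<^sup>2" using sum_squares_bound[of "norm y" 1] by simp_all
          then have "norm y \<le> 1 + (norm y)\<^sup>2" by linarith
          then show "norm u * norm y \<le> norm u * (1 + (norm y)\<^sup>2)" by (rule mult_left_mono) simp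
        qed
        also have "\<dots> \<le> \<delta> * (norm x)\<^sup>2 + ((norm u)\<^sup>2 / (4 * \<delta>) + norm u) * (1 + (norm y)\<^sup>2)"
        proof -
          have "(norm u)\<^sup>2 / (4 * \<delta>) * 1 \<le> (norm u)\<^sup>2 / (4 * \<delta>) * (1 + (norm y)\<^sup>2)" using \<delta> by (intro mult_left_mono) auto
          then show ?thesis by (simp add: distrib_right)
        qed
        finally show "\<phi> k x * (u \<bullet> (y - x)) \<le> \<delta> * (norm x)\<^sup>2 + ((norm u)\<^sup>2 / (4 * \<delta>) + norm u) * (1 + (norm y)\<^sup>2)" .
      qed
      show "0 \<le> (\<integral>w. \<phi> k (X n w) * (u \<bullet> (Y n w - X n w)) \<partial>\<Omega>)" for n
      proof -
        have \<theta>: "(\<lambda>x. \<phi> k x *\<^sub>R u) \<in> borel_measurable borel" by measurable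
        have "L2vec (\<gamma>s (s n)) (\<lambda>p. \<phi> k (fst p) *\<^sub>R u)"
          unfolding dW[symmetric] using L\<phi>[OF Xm, of k n u] measurable_compose[OF fs(1) \<theta>]
          by (subst L2vec_distr[OF W]) (auto simp: X_def)
        from Gamma_test[OF \<gamma>s(1) \<theta> this]
        have "(\<integral>p. (\<phi> k (fst p) *\<^sub>R u) \<bullet> fst p \<partial>\<gamma>s (s n)) = (\<integral>p. (\<phi> k (fst p) *\<^sub>R u) \<bullet> snd p \<partial>\<gamma>s (s n))" .
        then have "(\<integral>w. (\<phi> k (X n w) *\<^sub>R u) \<bullet> X n w \<partial>\<Omega>) = (\<integral>w. (\<phi> k (X n w) *\<^sub>R u) \<bullet> Y n w \<partial>\<Omega>)"
          using integral_W[of "\<lambda>p. (\<phi> k (fst p) *\<^sub>R u) \<bullet> fst p" n] integral_W[of "\<lambda>p. (\<phi> k (fst p) *\<^sub>R u) \<bullet> snd p" n]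
            measurable_compose[OF fs(1) \<theta>] fs
          unfolding X_def Y_def by (auto intro: borel_measurable_inner)
        then have "(\<integral>w. \<phi> k (X n w) * (u \<bullet> (Y n w - X n w)) \<partial>\<Omega>) = 0"
          using L2vec_inner[OF L\<phi>[OF Xm] LX, of k n u n] L2vec_inner[OF L\<phi>[OF Xm] LY, of k n u n]
          by (simp add: inner_diff_right right_diff_distrib)
        then show ?thesis by simp
      qed
    qed
    have zero: "(\<integral>\<omega>. \<phi> k (X' \<omega>) * (u \<bullet> (Y' \<omega> - X' \<omega>)) \<partial>\<Omega>) = 0" for k
      using ge[of k u] ge[of k "- u"] by simp
    have iD: "integrable \<Omega> (\<lambda>\<omega>. u \<bullet> (Y' \<omega> - X' \<omega>))"
      using L2vec_integrable[OF \<Omega>.finite_measure_axioms L2vec_diff[OF LY' LX']] by (rule integrable_inner_right)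
    have "(\<lambda>k. \<integral>\<omega>. \<phi> k (X' \<omega>) * (u \<bullet> (Y' \<omega> - X' \<omega>)) \<partial>\<Omega>) \<longlonglongrightarrow> (\<integral>\<omega>. indicator F (X' \<omega>) * (u \<bullet> (Y' \<omega> - X' \<omega>)) \<partial>\<Omega>)"
    proof (rule integral_dominated_convergence[where w = "\<lambda>\<omega>. \<bar>u \<bullet> (Y' \<omega> - X' \<omega>)\<bar>"])
      show "(\<lambda>\<omega>. indicator F (X' \<omega>) * (u \<bullet> (Y' \<omega> - X' \<omega>))) \<in> borel_measurable \<Omega>"
        by (intro borel_measurable_times measurable_compose[OF Xm' borel_measurable_indicator] borel_measurable_integrable[OF iD])
          (use F in auto)
      show "AE \<omega> in \<Omega>. (\<lambda>k. \<phi> k (X' \<omega>) * (u \<bullet> (Y' \<omega> - X' \<omega>))) \<longlonglongrightarrow> indicator F (X' \<omega>) * (u \<bullet> (Y' \<omega> - X' \<omega>))"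
        unfolding \<phi>_def by (intro always_eventually allI tendsto_mult_right closed_indicator_approx[OF F False])
      show "AE \<omega> in \<Omega>. norm (\<phi> k (X' \<omega>) * (u \<bullet> (Y' \<omega> - X' \<omega>))) \<le> \<bar>u \<bullet> (Y' \<omega> - X' \<omega>)\<bar>" for k
        using \<phi>b by (intro always_eventually allI) (auto simp: abs_mult intro: mult_left_le_one_le)
    qed (use iD in \<open>auto intro: integrable_abs\<close>)
    then show ?thesis unfolding zero by (simp add: LIMSEQ_const_iff)
  qed simp
  have G: "distr \<Omega> borel (\<lambda>\<omega>. (X' \<omega>, Y' \<omega>)) \<in> Gamma \<nu>"
  proof (rule GammaI[OF \<Omega> LX' LY' law_Y'])
    fix A :: "(real^'n) set" and u :: "real^'n" assume A: "A \<in> sets borel"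
    have iD: "integrable \<Omega> (\<lambda>\<omega>. u \<bullet> (Y' \<omega> - X' \<omega>))"
      using L2vec_integrable[OF \<Omega>.finite_measure_axioms L2vec_diff[OF LY' LX']] by (rule integrable_inner_right)
    have z: "(\<integral>\<omega>. indicator A (X' \<omega>) * (u \<bullet> (Y' \<omega> - X' \<omega>)) \<partial>\<Omega>) = 0"
      by (rule integral_indicator_closed_extend[OF Xm' iD mart_closed A])
    have L: "L2vec \<Omega> (\<lambda>\<omega>. indicator A (X' \<omega>) *\<^sub>R u)"
      by (rule L2vec_bounded[OF \<Omega>.finite_measure_axioms, of _ "norm u"]) (use A in \<open>auto simp: indicator_def\<close>)
    show "(\<integral>w. (indicator A (X' w) *\<^sub>R u) \<bullet> X' w \<partial>\<Omega>) = (\<integral>w. (indicator A (X' w) *\<^sub>R u) \<bullet> Y' w \<partial>\<Omega>)"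
      using z L2vec_inner[OF L LX'] L2vec_inner[OF L LY'] by (simp add: inner_diff_right right_diff_distrib)
  qed
  have pair_m: "(\<lambda>\<omega>. (X' \<omega>, Y' \<omega>)) \<in> borel_measurable \<Omega>" unfolding borel_prod[symmetric] by measurable
  have Sm: "(\<lambda>p. Sform S (fst p) (snd p)) \<in> borel_measurable borel" by (rule measurable_Sform[OF fs])
  have P_le: "P - \<epsilon> \<le> (\<integral>\<omega>. Sform S (X' \<omega>) (Y' \<omega>) \<partial>\<Omega>)" if \<epsilon>: "\<epsilon> > 0" for \<epsilon>
  proof -
    obtain N where N: "inverse (real (Suc N)) < \<epsilon>" using reals_Archimedean[OF \<epsilon>] by blast
    \<comment> \<open>\<open>limit_usc\<close> wants one lower bound for all indices; dropping the
      first \<open>N\<close> terms brings every remaining value within \<open>\<epsilon>\<close> of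
      the supremum.\<close>
    have lim': "AE \<omega> in \<Omega>. (\<lambda>n. X (n + N) \<omega>) \<longlonglongrightarrow> X' \<omega> \<and> (\<lambda>n. Y (n + N) \<omega>) \<longlonglongrightarrow> Y' \<omega>"
      using lim by eventually_elim (auto intro: LIMSEQ_ignore_initial_segment)
    show ?thesis
    proof (rule limit_usc[OF \<Omega> LX LY LX' LY' cX cY cY' lim', of "Sform S"])
      show "integrable \<Omega> (\<lambda>w. Sform S (X (n + N) w) (Y (n + N) w))" for n by (rule L2vec_Sform[OF LX LY])
      show "integrable \<Omega> (\<lambda>w. Sform S (X' w) (Y' w))" by (rule L2vec_Sform[OF LX' LY'])
      show "continuous_on UNIV (\<lambda>p. Sform S (fst p) (snd p))" by (intro continuous_intros)
      show "\<exists>C. \<forall>x y. Sform S x y \<le> \<delta> * (norm x)\<^sup>2 + C * (1 + (norm y)\<^sup>2)" if \<delta>: "\<delta> > 0" for \<delta>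
      proof (intro exI allI)
        fix x y :: "real^'n"
        have "Sform S x y \<le> K * norm x * norm y" using K(2)[of x y] by simp
        also have "\<dots> \<le> \<delta> * (norm x)\<^sup>2 + K\<^sup>2 / (4 * \<delta>) * (norm y)\<^sup>2" by (rule young_ineq[OF \<delta>])
        also have "\<dots> \<le> \<delta> * (norm x)\<^sup>2 + K\<^sup>2 / (4 * \<delta>) * (1 + (norm y)\<^sup>2)"
          using \<delta> by (intro add_left_mono mult_left_mono) auto
        finally show "Sform S x y \<le> \<delta> * (norm x)\<^sup>2 + K\<^sup>2 / (4 * \<delta>) * (1 + (norm y)\<^sup>2)" .
      qed
      show "P - \<epsilon> \<le> (\<integral>w. Sform S (X (n + N) w) (Y (n + N) w) \<partial>\<Omega>)" for n
      proof -
        have "N \<le> s (n + N)" using seq_suble[OF s, of "n + N"] by linarith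
        then have "inverse (real (Suc (s (n + N)))) \<le> inverse (real (Suc N))" by (intro le_imp_inverse_le) auto
        moreover have "(\<integral>w. Sform S (X (n + N) w) (Y (n + N) w) \<partial>\<Omega>) = val (\<gamma>s (s (n + N)))"
          using integral_W[OF Sm, of "n + N"] unfolding X_def Y_def val_def by simp
        ultimately show ?thesis using \<gamma>s(2)[of "s (n + N)"] N by linarith
      qed
    qed
  qed
  have "P \<le> (\<integral>\<omega>. Sform S (X' \<omega>) (Y' \<omega>) \<partial>\<Omega>)"
    by (rule field_le_epsilon) (use P_le in \<open>simp add: diff_le_eq\<close>)
  also have "\<dots> = val (distr \<Omega> borel (\<lambda>\<omega>. (X' \<omega>, Y' \<omega>)))"
    unfolding val_def by (subst integral_distr[OF pair_m Sm]) simp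
  finally have "val \<gamma> \<le> val (distr \<Omega> borel (\<lambda>\<omega>. (X' \<omega>, Y' \<omega>)))" if "\<gamma> \<in> Gamma \<nu>" for \<gamma>
    using cSup_upper[OF imageI[OF that] bdd] unfolding P_def by linarith
  then show ?thesis using G unfolding optimal_plan_def val_def by auto
qed

section \<open>Strong duality\<close>

text \<open>A version clamped to the interval from \<open>a\<close> to \<open>b\<close>: the bounds
  hold at every point, so that denominators formed from it can be estimated pointwise.\<close>

lemma bounded_cond_exp:
  fixes k :: "'w \<Rightarrow> real"
  assumes "prob_space M" "subalgebra M F" and k: "k \<in> borel_measurable M" "\<And>w. a \<le> k w" "\<And>w. k w \<le> b"
  shows "\<exists>k'\<in>borel_measurable F. (\<forall>w. a \<le> k' w \<and> k' w \<le> b) \<and>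
    (\<forall>\<theta>\<in>borel_measurable F. integrable M \<theta> \<longrightarrow> integrable M (\<lambda>w. \<theta> w * k w) \<and> integrable M (\<lambda>w. \<theta> w * k' w)
      \<and> (\<integral>w. \<theta> w * k' w \<partial>M) = (\<integral>w. \<theta> w * k w \<partial>M))"
proof -
  interpret prob_space M by fact
  interpret finite_measure_subalgebra M F by (rule prob_space_subalgebra) fact+
  have ab: "a \<le> b" using k(2,3) order_trans by blast
  define k' where "k' w = max a (min b (real_cond_exp M F k w))" for w
  have b: "\<bar>r\<bar> \<le> \<bar>a\<bar> + \<bar>b\<bar>" if "a \<le> r" "r \<le> b" for r using that by auto
  have ik: "integrable M k"
    by (rule integrable_const_bound[of _ "\<bar>a\<bar> + \<bar>b\<bar>"]) (use k b in auto)
  have "AE w in M. a \<le> real_cond_exp M F k w" "AE w in M. real_cond_exp M F k w \<le> b"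
    using real_cond_exp_ge_c[OF ik] real_cond_exp_le_c[OF ik] k(2,3) by auto
  then have AE: "AE w in M. real_cond_exp M F k w = k' w"
    by eventually_elim (auto simp: k'_def)
  have k'm: "k' \<in> borel_measurable F" unfolding k'_def by measurable
  have k'M: "k' \<in> borel_measurable M" by (rule measurable_from_subalg[OF subalg k'm])
  have k'b: "a \<le> k' w" "k' w \<le> b" for w using ab by (auto simp: k'_def)
  have "integrable M (\<lambda>w. \<theta> w * k w) \<and> integrable M (\<lambda>w. \<theta> w * k' w) \<and> (\<integral>w. \<theta> w * k' w \<partial>M) = (\<integral>w. \<theta> w * k w \<partial>M)"
    if \<theta>: "\<theta> \<in> borel_measurable F" "integrable M \<theta>" for \<theta>
  proof -
    have i: "integrable M (\<lambda>w. \<theta> w * h w)" if h: "h \<in> borel_measurable M" "\<And>w. a \<le> h w" "\<And>w. h w \<le> b" for h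
    proof (rule Bochner_Integration.integrable_bound[of M "\<lambda>w. (\<bar>a\<bar> + \<bar>b\<bar>) * \<theta> w"])
      show "AE w in M. norm (\<theta> w * h w) \<le> norm ((\<bar>a\<bar> + \<bar>b\<bar>) * \<theta> w)"
      proof (intro always_eventually allI)
        fix w
        have "\<bar>h w\<bar> * \<bar>\<theta> w\<bar> \<le> (\<bar>a\<bar> + \<bar>b\<bar>) * \<bar>\<theta> w\<bar>" by (intro mult_right_mono b h) auto
        then show "norm (\<theta> w * h w) \<le> norm ((\<bar>a\<bar> + \<bar>b\<bar>) * \<theta> w)" by (simp add: abs_mult mult.commute)
      qed
    qed (use \<theta> h in auto)
    have "(\<integral>w. \<theta> w * k' w \<partial>M) = (\<integral>w. \<theta> w * real_cond_exp M F k w \<partial>M)"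
      by (intro integral_cong_AE) (use AE \<theta> k'M in auto)
    also have "\<dots> = (\<integral>w. \<theta> w * k w \<partial>M)" by (rule real_cond_exp_intg(2)[OF i[OF k] \<theta>(1) k(1)])
    finally show ?thesis using i[OF k] i[OF k'M k'b] by blast
  qed
  then show ?thesis using k'm k'b by blast
qed

text \<open>Each \<open>p\<close> is divided into a copy marked \<open>True\<close> of weight
  \<open>w p\<close> and a copy marked \<open>False\<close> with the rest. The mark records which
  mass is to be moved without changing the law of \<open>p\<close>.\<close>

lemma split_measure:
  fixes w :: "'a \<Rightarrow> real"
  assumes \<gamma>: "prob_space \<gamma>" and w: "w \<in> borel_measurable \<gamma>" "\<And>p. 0 \<le> w p" "\<And>p. w p \<le> 1"
  defines "N \<equiv> density (\<gamma> \<Otimes>\<^sub>M count_space (UNIV :: bool set)) (\<lambda>(p, b). ennreal (if b then w p else 1 - w p))"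
  shows "prob_space N"
    and "\<And>h :: 'a \<times> bool \<Rightarrow> real. h \<in> borel_measurable (\<gamma> \<Otimes>\<^sub>M count_space (UNIV :: bool set)) \<Longrightarrow>
      integrable \<gamma> (\<lambda>p. w p * h (p, True)) \<Longrightarrow> integrable \<gamma> (\<lambda>p. (1 - w p) * h (p, False)) \<Longrightarrow> integrable N h"
    and "\<And>h :: 'a \<times> bool \<Rightarrow> real. h \<in> borel_measurable (\<gamma> \<Otimes>\<^sub>M count_space (UNIV :: bool set)) \<Longrightarrow>
      integrable \<gamma> (\<lambda>p. w p * h (p, True)) \<Longrightarrow> integrable \<gamma> (\<lambda>p. (1 - w p) * h (p, False)) \<Longrightarrow>
      (\<integral>x. h x \<partial>N) = (\<integral>p. w p * h (p, True) + (1 - w p) * h (p, False) \<partial>\<gamma>)"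
proof -
  interpret prob_space \<gamma> by (rule \<gamma>)
  interpret c: sigma_finite_measure "count_space (UNIV :: bool set)" by (rule sigma_finite_measure_count_space_finite) simp
  interpret pair_sigma_finite \<gamma> "count_space (UNIV :: bool set)" by unfold_locales
  let ?P = "\<gamma> \<Otimes>\<^sub>M count_space (UNIV :: bool set)"
  define d where "d = (\<lambda>(p, b). if b then w p else 1 - w p)"
  have d: "d \<in> borel_measurable ?P" unfolding d_def using w(1) by measurable
  have d0: "0 \<le> d x" for x unfolding d_def using w by (auto split: prod.split)
  have N: "N = density ?P (\<lambda>x. ennreal (d x))" unfolding N_def d_def by (intro arg_cong2[of _ _ _ _ density]) auto
  show "prob_space N"
  proof
    have "emeasure N (space N) = (\<integral>\<^sup>+x. ennreal (d x) \<partial>?P)"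
      unfolding N using d by (subst emeasure_density) (auto intro!: nn_integral_cong)
    also have "\<dots> = (\<integral>\<^sup>+p. \<integral>\<^sup>+b. ennreal (d (p, b)) \<partial>count_space UNIV \<partial>\<gamma>)"
      by (rule c.nn_integral_fst[symmetric]) (use d in measurable)
    also have "\<dots> = (\<integral>\<^sup>+p. 1 \<partial>\<gamma>)"
      by (intro nn_integral_cong) (use w in \<open>simp add: nn_integral_count_space_finite UNIV_bool d_def ennreal_plus[symmetric] del: ennreal_plus\<close>)
    finally show "emeasure N (space N) = 1" by (simp add: emeasure_space_1)
  qed
  fix h :: "'a \<times> bool \<Rightarrow> real"
  assume h: "h \<in> borel_measurable ?P" "integrable \<gamma> (\<lambda>p. w p * h (p, True))" "integrable \<gamma> (\<lambda>p. (1 - w p) * h (p, False))"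
  have i: "integrable ?P (\<lambda>x. d x * h x)"
  proof (rule Fubini_integrable)
    show "(\<lambda>x. d x * h x) \<in> borel_measurable ?P" using d h(1) by measurable
    have "(\<integral>b. norm (d (p, b) * h (p, b)) \<partial>count_space UNIV) = norm (w p * h (p, True)) + norm ((1 - w p) * h (p, False))" for p
      by (simp add: lebesgue_integral_count_space_finite UNIV_bool d_def)
    then show "integrable \<gamma> (\<lambda>p. \<integral>b. norm (d (p, b) * h (p, b)) \<partial>count_space UNIV)"
      using h(2,3) by (auto intro!: Bochner_Integration.integrable_add integrable_norm simp del: real_norm_def)
    show "AE p in \<gamma>. integrable (count_space UNIV) (\<lambda>b. d (p, b) * h (p, b))"
      by (simp add: integrable_count_space)
  qed
  show "integrable N h" unfolding N using i d d0 h(1) by (subst integrable_density) auto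
  have "(\<integral>x. h x \<partial>N) = (\<integral>x. d x * h x \<partial>?P)" unfolding N using d d0 h(1) by (subst integral_density) auto
  also have "\<dots> = (\<integral>p. \<integral>b. d (p, b) * h (p, b) \<partial>count_space UNIV \<partial>\<gamma>)" by (rule integral_fst'[OF i, symmetric])
  also have "\<dots> = (\<integral>p. w p * h (p, True) + (1 - w p) * h (p, False) \<partial>\<gamma>)"
    by (simp add: lebesgue_integral_count_space_finite UNIV_bool d_def add.commute)
  finally show "(\<integral>x. h x \<partial>N) = (\<integral>p. w p * h (p, True) + (1 - w p) * h (p, False) \<partial>\<gamma>)" .
qed

text \<open>Moves the fraction \<open>\<epsilon> g\<close> of the mass of an optimal plan to the new atom \<open>\<integral> g y d\<gamma>\<close> and restores the
  martingale property of the remainder by moving \<open>x\<close> to its new barycenter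
  \<open>(x - \<epsilon> E[g y | x]) / (1 - \<epsilon> E[g | x])\<close>. The claim is the derivative at \<open>\<epsilon> = 0\<close>.\<close>
lemma optimal_plan_variation:
  fixes \<gamma> :: "((real^'n) \<times> (real^'n)) measure" and g :: "(real^'n) \<times> (real^'n) \<Rightarrow> real"
  assumes sym: "transpose S = S" and opt: "optimal_plan \<nu> S \<gamma>"
    and g: "g \<in> borel_measurable borel" "\<And>p. 0 \<le> g p" "\<And>p. g p \<le> K" "1 \<le> K"
    and R: "\<And>p. norm (snd p) > R \<Longrightarrow> g p = 0" "0 \<le> R" and g1: "(\<integral>p. g p \<partial>\<gamma>) = 1"
  shows "Sform S (\<integral>p. g p *\<^sub>R snd p \<partial>\<gamma>) (\<integral>p. g p *\<^sub>R snd p \<partial>\<gamma>) / 2 \<le> (\<integral>p. g p * tang S (fst p) (snd p) \<partial>\<gamma>)"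
proof -
  have \<gamma>: "\<gamma> \<in> Gamma \<nu>" using opt by (simp add: optimal_plan_def)
  note prob = GammaD(2)[OF \<gamma>] and L = GammaD(3,4)[OF \<gamma>]
  interpret prob_space \<gamma> by (rule prob)
  have m\<gamma>: "borel_measurable \<gamma> = (borel_measurable borel :: ((real^'n) \<times> (real^'n) \<Rightarrow> 'b::topological_space) set)"
    by (rule measurable_cong_sets[OF GammaD(1)[OF \<gamma>] refl])
  have gm: "g \<in> borel_measurable \<gamma>" using g(1) unfolding m\<gamma> .
  have fstm: "fst \<in> borel_measurable \<gamma>" and sndm: "snd \<in> borel_measurable \<gamma>" using L by (auto simp: L2vec_def)
  \<comment> \<open>The conditional expectations given \<open>x\<close> are taken with respect to
    this algebra: \<open>gh\<close> is that of \<open>g\<close>, and \<open>yh\<close> that of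
    \<open>g y\<close>, assembled from its components.\<close>
  define F where "F = vimage_algebra UNIV (fst :: (real^'n) \<times> (real^'n) \<Rightarrow> real^'n) borel"
  have sub: "subalgebra \<gamma> F"
    using vimage_algebra_subalgebra[OF fstm] GammaD(6)[OF \<gamma>] by (simp add: F_def)
  have fstF: "fst \<in> borel_measurable F" unfolding F_def by (rule measurable_vimage_algebra1) simp
  note toM = measurable_from_subalg[OF sub]
  from bounded_cond_exp[OF prob sub gm g(2,3)] obtain gh where ghF: "gh \<in> borel_measurable F"
    and gh_bd: "\<forall>p. 0 \<le> gh p \<and> gh p \<le> K"
    and gh_test: "\<forall>\<theta>\<in>borel_measurable F. integrable \<gamma> \<theta> \<longrightarrow> integrable \<gamma> (\<lambda>p. \<theta> p * g p) \<and> integrable \<gamma> (\<lambda>p. \<theta> p * gh p)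
      \<and> (\<integral>p. \<theta> p * gh p \<partial>\<gamma>) = (\<integral>p. \<theta> p * g p \<partial>\<gamma>)"
    by (elim bexE conjE)
  note gh = ghF conjunct1[OF spec[OF gh_bd]] conjunct2[OF spec[OF gh_bd]]
  have gh_eq: "(\<integral>p. \<theta> p * gh p \<partial>\<gamma>) = (\<integral>p. \<theta> p * g p \<partial>\<gamma>)"
    and gh_int: "integrable \<gamma> (\<lambda>p. \<theta> p * gh p) \<and> integrable \<gamma> (\<lambda>p. \<theta> p * g p)"
    if "\<theta> \<in> borel_measurable F" "integrable \<gamma> \<theta>" for \<theta>
    using bspec[OF gh_test that(1)] that(2) by simp_all
  have comp_bd: "\<bar>g p * snd p $ i\<bar> \<le> K * R" for p i
  proof (cases "norm (snd p) > R")
    case False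
    have "\<bar>g p\<bar> * \<bar>snd p $ i\<bar> \<le> K * R"
      using g(2,3)[of p] False component_le_norm_cart[of "snd p" i] R(2) by (intro mult_mono) auto
    then show ?thesis by (simp add: abs_mult)
  qed (use R g in auto)
  have "\<exists>k'\<in>borel_measurable F. (\<forall>w. - (K * R) \<le> k' w \<and> k' w \<le> K * R) \<and>
    (\<forall>\<theta>\<in>borel_measurable F. integrable \<gamma> \<theta> \<longrightarrow> integrable \<gamma> (\<lambda>w. \<theta> w * (g w * snd w $ i)) \<and> integrable \<gamma> (\<lambda>w. \<theta> w * k' w)
      \<and> (\<integral>w. \<theta> w * k' w \<partial>\<gamma>) = (\<integral>w. \<theta> w * (g w * snd w $ i) \<partial>\<gamma>))" for i
    by (rule bounded_cond_exp[OF prob sub])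
      (use comp_bd in \<open>auto simp: abs_le_iff minus_le_iff intro!: borel_measurable_times gm measurable_vec_component sndm\<close>)
  then have "\<forall>i. \<exists>k'. k' \<in> borel_measurable F \<and> (\<forall>w. - (K * R) \<le> k' w \<and> k' w \<le> K * R) \<and>
    (\<forall>\<theta>\<in>borel_measurable F. integrable \<gamma> \<theta> \<longrightarrow> integrable \<gamma> (\<lambda>w. \<theta> w * (g w * snd w $ i)) \<and> integrable \<gamma> (\<lambda>w. \<theta> w * k' w)
      \<and> (\<integral>w. \<theta> w * k' w \<partial>\<gamma>) = (\<integral>w. \<theta> w * (g w * snd w $ i) \<partial>\<gamma>))" by blast
  then obtain yc where yc0: "\<forall>i. yc i \<in> borel_measurable F \<and> (\<forall>w. - (K * R) \<le> yc i w \<and> yc i w \<le> K * R) \<and>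
    (\<forall>\<theta>\<in>borel_measurable F. integrable \<gamma> \<theta> \<longrightarrow> integrable \<gamma> (\<lambda>w. \<theta> w * (g w * snd w $ i)) \<and> integrable \<gamma> (\<lambda>w. \<theta> w * yc i w)
      \<and> (\<integral>w. \<theta> w * yc i w \<partial>\<gamma>) = (\<integral>w. \<theta> w * (g w * snd w $ i) \<partial>\<gamma>))"
    by (rule choice[THEN exE])
  then have yc: "yc i \<in> borel_measurable F" "- (K * R) \<le> yc i w" "yc i w \<le> K * R" for i w by blast+
  have yc_eq: "integrable \<gamma> (\<lambda>w. \<theta> w * (g w * snd w $ i)) \<and> integrable \<gamma> (\<lambda>w. \<theta> w * yc i w)
      \<and> (\<integral>w. \<theta> w * yc i w \<partial>\<gamma>) = (\<integral>w. \<theta> w * (g w * snd w $ i) \<partial>\<gamma>)"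
    if "\<theta> \<in> borel_measurable F" "integrable \<gamma> \<theta>" for \<theta> i
    using spec[OF yc0, of i] that by blast
  define yh :: "(real^'n) \<times> (real^'n) \<Rightarrow> real^'n" where "yh p = (\<chi> i. yc i p)" for p
  have yhF: "yh \<in> borel_measurable F" by (rule borel_measurable_vecI) (use yc(1) in \<open>simp add: yh_def\<close>)
  define B where "B = real CARD('n) * (K * R)"
  have yhB: "norm (yh p) \<le> B" for p
  proof -
    have "norm (yh p) \<le> (\<Sum>i\<in>UNIV. \<bar>yh p $ i\<bar>)" by (rule norm_le_l1_cart)
    also have "\<dots> \<le> (\<Sum>i\<in>(UNIV::'n set). K * R)" using yc(2,3) by (intro sum_mono) (auto simp: yh_def abs_le_iff minus_le_iff)
    finally show ?thesis by (simp add: B_def)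
  qed
  have Lyh: "L2vec \<gamma> yh" by (rule L2vec_bounded[OF finite_measure_axioms toM[OF yhF] yhB])
  have gsnd_bd: "norm (g p *\<^sub>R snd p) \<le> K * R" for p
  proof (cases "norm (snd p) > R")
    case False
    then show ?thesis using g(2,3)[of p] R(2) by (auto intro!: mult_mono)
  qed (use R g in auto)
  have Lgs: "L2vec \<gamma> (\<lambda>p. g p *\<^sub>R snd p)"
    by (rule L2vec_bounded[OF finite_measure_axioms borel_measurable_scaleR[OF gm sndm] gsnd_bd])
  have yh_eq: "(\<integral>p. \<theta> p \<bullet> yh p \<partial>\<gamma>) = (\<integral>p. \<theta> p \<bullet> (g p *\<^sub>R snd p) \<partial>\<gamma>)" if \<theta>: "\<theta> \<in> borel_measurable F" "L2vec \<gamma> \<theta>" for \<theta>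
  proof -
    have i: "integrable \<gamma> (\<lambda>p. \<theta> p $ i)" for i
      using integrable_bounded_linear[OF bounded_linear_vec_nth L2vec_integrable[OF finite_measure_axioms \<theta>(2)]] .
    have m: "(\<lambda>p. \<theta> p $ i) \<in> borel_measurable F" for i by (rule measurable_vec_component[OF \<theta>(1)])
    show ?thesis unfolding inner_vec_def using yc_eq[OF m i]
      by (simp add: yh_def Bochner_Integration.integral_sum)
  qed
  define x1 where "x1 = (\<integral>p. g p *\<^sub>R snd p \<partial>\<gamma>)"
  have x1_eq: "(\<integral>p. u \<bullet> (g p *\<^sub>R snd p) \<partial>\<gamma>) = u \<bullet> x1" for u
    unfolding x1_def using L2vec_integrable[OF finite_measure_axioms Lgs] by (rule integral_inner_right)
  define a where "a p = Sform S (fst p) (fst p)" for p :: "(real^'n) \<times> (real^'n)"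
  define b where "b p = Sform S (fst p) (yh p)" for p
  define d where "d p = Sform S (yh p) (yh p)" for p
  have ia: "integrable \<gamma> a" and ib: "integrable \<gamma> b" and id: "integrable \<gamma> d"
    unfolding a_def b_def d_def by (intro L2vec_Sform L Lyh)+
  have aF: "a \<in> borel_measurable F" unfolding a_def by (rule measurable_Sform[OF fstF fstF])
  \<comment> \<open>The optimality inequality at step \<open>\<epsilon>\<close>, divided by
    \<open>\<epsilon>\<close>. The restriction \<open>\<epsilon> * K \<le> 1/2\<close> keeps the
    retained fraction \<open>den\<close> at least 1/2.\<close>
  have main: "Sform S x1 x1 \<le> (\<integral>p. (2 * b p - a p * gh p - \<epsilon> * d p) / (1 - \<epsilon> * gh p) \<partial>\<gamma>)"
    if \<epsilon>: "0 < \<epsilon>" "\<epsilon> * K \<le> 1/2" for \<epsilon>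
  proof -
    define den where "den p = 1 - \<epsilon> * gh p" for p
    have den: "1/2 \<le> den p" "den p \<le> 1" for p
    proof -
      have "\<epsilon> * gh p \<le> \<epsilon> * K" using gh(3) \<epsilon> by (intro mult_left_mono) auto
      then show "1/2 \<le> den p" using \<epsilon> unfolding den_def by linarith
      show "den p \<le> 1" using gh(2)[of p] \<epsilon> by (simp add: den_def)
    qed
    have w01: "0 \<le> \<epsilon> * g p" "\<epsilon> * g p \<le> 1" for p
    proof -
      have "\<epsilon> * g p \<le> \<epsilon> * K" using g(3) \<epsilon> by (intro mult_left_mono) auto
      then show "\<epsilon> * g p \<le> 1" using \<epsilon> by linarith
    qed (use g(2) \<epsilon> in simp)
    have denF: "den \<in> borel_measurable F" unfolding den_def using gh(1) by measurable
    define Z where "Z p = (fst p - \<epsilon> *\<^sub>R yh p) /\<^sub>R den p" for p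
    have ZF: "Z \<in> borel_measurable F"
      unfolding Z_def using fstF yhF denF by (intro borel_measurable_scaleR borel_measurable_inverse borel_measurable_diff) auto
    have LD: "L2vec \<gamma> (\<lambda>p. fst p - \<epsilon> *\<^sub>R yh p)" by (intro L2vec_diff L2vec_scaleR L Lyh)
    have LZ: "L2vec \<gamma> Z"
    proof (rule L2vec_le[OF L2vec_scaleR[OF LD, of 2] toM[OF ZF]])
      show "AE p in \<gamma>. norm (Z p) \<le> norm (2 *\<^sub>R (fst p - \<epsilon> *\<^sub>R yh p))"
      proof (intro always_eventually allI)
        fix p
        have "inverse (den p) \<le> inverse (1/2)" using den(1)[of p] by (intro le_imp_inverse_le) auto
        then have "\<bar>inverse (den p)\<bar> \<le> 2" using den(1)[of p] by simp
        then show "norm (Z p) \<le> norm (2 *\<^sub>R (fst p - \<epsilon> *\<^sub>R yh p))"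
          unfolding Z_def by (simp add: mult_right_mono del: abs_inverse)
      qed
    qed
    have denZ: "den p *\<^sub>R Z p = fst p - \<epsilon> *\<^sub>R yh p" for p using den(1)[of p] by (simp add: Z_def)
    \<comment> \<open>The two balance identities say that the remaining mass, weighted by
      \<open>1 - \<epsilon> * g\<close>, has the same moments against functions of \<open>x\<close>
      whether \<open>y\<close> or its new barycenter \<open>Z\<close> is integrated.\<close>
    have bal_snd: "integrable \<gamma> (\<lambda>p. (1 - \<epsilon> * g p) * (\<theta> p \<bullet> snd p))"
      "(\<integral>p. (1 - \<epsilon> * g p) * (\<theta> p \<bullet> snd p) \<partial>\<gamma>) = (\<integral>p. \<theta> p \<bullet> (fst p - \<epsilon> *\<^sub>R yh p) \<partial>\<gamma>)"
      if \<theta>: "\<theta> \<in> borel_measurable F" "L2vec \<gamma> \<theta>" for \<theta>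
    proof -
      note i = L2vec_inner[OF \<theta>(2) L(1)] L2vec_inner[OF \<theta>(2) L(2)] L2vec_inner[OF \<theta>(2) Lgs] L2vec_inner[OF \<theta>(2) Lyh]
      have e: "(1 - \<epsilon> * g p) * (\<theta> p \<bullet> snd p) = \<theta> p \<bullet> snd p - \<epsilon> * (\<theta> p \<bullet> (g p *\<^sub>R snd p))" for p
        by (simp add: algebra_simps)
      show "integrable \<gamma> (\<lambda>p. (1 - \<epsilon> * g p) * (\<theta> p \<bullet> snd p))" unfolding e using i by (intro Bochner_Integration.integrable_diff integrable_mult_right)
      have "(\<integral>p. (1 - \<epsilon> * g p) * (\<theta> p \<bullet> snd p) \<partial>\<gamma>) = (\<integral>p. \<theta> p \<bullet> snd p \<partial>\<gamma>) - \<epsilon> * (\<integral>p. \<theta> p \<bullet> (g p *\<^sub>R snd p) \<partial>\<gamma>)"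
        unfolding e using i by (subst Bochner_Integration.integral_diff) auto
      also have "\<dots> = (\<integral>p. \<theta> p \<bullet> fst p \<partial>\<gamma>) - \<epsilon> * (\<integral>p. \<theta> p \<bullet> yh p \<partial>\<gamma>)"
        using Gamma_test_fst[OF \<gamma> \<theta>(2) \<theta>(1)[unfolded F_def]] yh_eq[OF \<theta>] by simp
      also have "\<dots> = (\<integral>p. \<theta> p \<bullet> (fst p - \<epsilon> *\<^sub>R yh p) \<partial>\<gamma>)"
        using i by (simp add: inner_diff_right)
      finally show "(\<integral>p. (1 - \<epsilon> * g p) * (\<theta> p \<bullet> snd p) \<partial>\<gamma>) = (\<integral>p. \<theta> p \<bullet> (fst p - \<epsilon> *\<^sub>R yh p) \<partial>\<gamma>)" .
    qed
    have bal_Z: "integrable \<gamma> (\<lambda>p. (1 - \<epsilon> * g p) * (\<theta> p \<bullet> Z p))"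
      "(\<integral>p. (1 - \<epsilon> * g p) * (\<theta> p \<bullet> Z p) \<partial>\<gamma>) = (\<integral>p. \<theta> p \<bullet> (fst p - \<epsilon> *\<^sub>R yh p) \<partial>\<gamma>)"
      if \<theta>: "\<theta> \<in> borel_measurable F" "L2vec \<gamma> \<theta>" for \<theta>
    proof -
      have i: "integrable \<gamma> (\<lambda>p. \<theta> p \<bullet> Z p)" by (rule L2vec_inner[OF \<theta>(2) LZ])
      have m: "(\<lambda>p. \<theta> p \<bullet> Z p) \<in> borel_measurable F" by (rule borel_measurable_inner[OF \<theta>(1) ZF])
      note j = gh_int[OF m i]
      have e: "(1 - \<epsilon> * g p) * (\<theta> p \<bullet> Z p) = \<theta> p \<bullet> Z p - \<epsilon> * (\<theta> p \<bullet> Z p * g p)" for p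
        by (simp add: algebra_simps)
      show "integrable \<gamma> (\<lambda>p. (1 - \<epsilon> * g p) * (\<theta> p \<bullet> Z p))" unfolding e using i j by auto
      have "(\<integral>p. (1 - \<epsilon> * g p) * (\<theta> p \<bullet> Z p) \<partial>\<gamma>) = (\<integral>p. \<theta> p \<bullet> Z p \<partial>\<gamma>) - \<epsilon> * (\<integral>p. \<theta> p \<bullet> Z p * g p \<partial>\<gamma>)"
        unfolding e using i j by (subst Bochner_Integration.integral_diff) auto
      also have "\<dots> = (\<integral>p. \<theta> p \<bullet> Z p \<partial>\<gamma>) - \<epsilon> * (\<integral>p. \<theta> p \<bullet> Z p * gh p \<partial>\<gamma>)"
        unfolding gh_eq[OF m i] ..
      also have "\<dots> = (\<integral>p. \<theta> p \<bullet> Z p - \<epsilon> * (\<theta> p \<bullet> Z p * gh p) \<partial>\<gamma>)" using i j by simp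
      also have "\<dots> = (\<integral>p. \<theta> p \<bullet> (den p *\<^sub>R Z p) \<partial>\<gamma>)"
        by (intro Bochner_Integration.integral_cong) (auto simp: den_def algebra_simps)
      finally show "(\<integral>p. (1 - \<epsilon> * g p) * (\<theta> p \<bullet> Z p) \<partial>\<gamma>) = (\<integral>p. \<theta> p \<bullet> (fst p - \<epsilon> *\<^sub>R yh p) \<partial>\<gamma>)"
        unfolding denZ .
    qed
    define N where "N = density (\<gamma> \<Otimes>\<^sub>M count_space (UNIV :: bool set)) (\<lambda>(p, b). ennreal (if b then \<epsilon> * g p else 1 - \<epsilon> * g p))"
    have wm: "(\<lambda>p. \<epsilon> * g p) \<in> borel_measurable \<gamma>" using gm by measurable
    note split = split_measure[OF prob wm w01, folded N_def]
    have mN: "measurable N borel = measurable (\<gamma> \<Otimes>\<^sub>M count_space (UNIV :: bool set)) (borel :: 'b::topological_space measure)"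
      by (rule measurable_cong_sets) (simp_all add: N_def)
    define X where "X = (\<lambda>(p, b). if b then x1 else Z p)"
    define Y :: "((real^'n) \<times> (real^'n)) \<times> bool \<Rightarrow> real^'n" where "Y = (\<lambda>(p, b). snd p)"
    have Xm: "X \<in> borel_measurable N" unfolding mN X_def using toM[OF ZF] by measurable
    have Ym: "Y \<in> borel_measurable N" unfolding mN Y_def using sndm by measurable
    have gi: "integrable \<gamma> (\<lambda>p. \<epsilon> * g p)" by (rule integrable_const_bound[of _ 1]) (use w01 wm in auto)
    have bounded_mult: "integrable \<gamma> (\<lambda>p. \<epsilon> * g p * h p)" "integrable \<gamma> (\<lambda>p. (1 - \<epsilon> * g p) * h p)" if h: "integrable \<gamma> h" for h :: "_ \<Rightarrow> real"
    proof -
      show *: "integrable \<gamma> (\<lambda>p. \<epsilon> * g p * h p)"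
      proof (rule Bochner_Integration.integrable_bound[OF h])
        show "AE p in \<gamma>. norm (\<epsilon> * g p * h p) \<le> norm (h p)"
        proof (intro always_eventually allI)
          fix p
          have "\<bar>\<epsilon> * g p\<bar> * \<bar>h p\<bar> \<le> 1 * \<bar>h p\<bar>" using w01[of p] by (intro mult_right_mono) auto
          then show "norm (\<epsilon> * g p * h p) \<le> norm (h p)" by (simp add: abs_mult)
        qed
      qed (use wm h in auto)
      show "integrable \<gamma> (\<lambda>p. (1 - \<epsilon> * g p) * h p)" using h * by (simp add: left_diff_distrib)
    qed
    interpret N: prob_space N by (rule split(1))
    have LX: "L2vec N X"
      unfolding L2vec_def
    proof (intro conjI Xm split(2))
      show "integrable \<gamma> (\<lambda>p. (1 - \<epsilon> * g p) * (norm (X (p, False)))\<^sup>2)"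
        using bounded_mult(2) LZ by (simp add: X_def L2vec_def)
    qed (use Xm gi in \<open>auto simp: X_def mN[symmetric]\<close>)
    have LY: "L2vec N Y"
      unfolding L2vec_def
    proof (intro conjI Ym split(2))
      show "integrable \<gamma> (\<lambda>p. (1 - \<epsilon> * g p) * (norm (Y (p, False)))\<^sup>2)" "integrable \<gamma> (\<lambda>p. \<epsilon> * g p * (norm (Y (p, True)))\<^sup>2)"
        using bounded_mult L(2) by (simp_all add: Y_def L2vec_def)
    qed (use Ym in \<open>auto simp: mN[symmetric]\<close>)
    have law: "distr N borel Y = \<nu>"
    proof (rule measure_eqI)
      have \<nu>: "prob_space \<nu>" "sets \<nu> = sets borel" unfolding GammaD(5)[OF \<gamma>, symmetric] by (auto intro: prob_space_distr[OF sndm])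
      interpret \<nu>: prob_space \<nu> by (rule \<nu>)
      interpret dY: prob_space "distr N borel Y" by (rule N.prob_space_distr[OF Ym])
      show "sets (distr N borel Y) = sets \<nu>" using \<nu> by simp
      fix A assume "A \<in> sets (distr N borel Y)"
      then have A [measurable]: "A \<in> sets borel" by simp
      have iA: "(\<lambda>x. indicat_real A (Y x)) \<in> borel_measurable N" by (rule measurable_compose[OF Ym]) measurable
      have ii: "integrable \<gamma> (\<lambda>p. indicat_real A (snd p))"
        by (rule integrable_const_bound[of _ 1]) (use sndm in \<open>auto intro!: measurable_compose[OF sndm] simp: indicator_def\<close>)
      have "measure (distr N borel Y) A = (\<integral>y. indicat_real A y \<partial>distr N borel Y)" by simp
      also have "\<dots> = (\<integral>x. indicat_real A (Y x) \<partial>N)" by (rule integral_distr[OF Ym]) simp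
      also have "\<dots> = (\<integral>p. \<epsilon> * g p * indicat_real A (Y (p, True)) + (1 - \<epsilon> * g p) * indicat_real A (Y (p, False)) \<partial>\<gamma>)"
        by (rule split(3)) (use iA bounded_mult[OF ii] in \<open>auto simp: mN[symmetric] Y_def\<close>)
      also have "\<dots> = (\<integral>p. indicat_real A (snd p) \<partial>\<gamma>)" by (simp add: Y_def algebra_simps)
      also have "\<dots> = (\<integral>y. indicat_real A y \<partial>\<nu>)" unfolding GammaD(5)[OF \<gamma>, symmetric] by (rule integral_distr[OF sndm, symmetric]) simp
      also have "\<dots> = measure \<nu> A" using \<nu> A by simp
      finally show "emeasure (distr N borel Y) A = emeasure \<nu> A" by (simp add: dY.emeasure_eq_measure \<nu>.emeasure_eq_measure)
    qed
    have gsu: "(\<integral>p. \<epsilon> * g p * (u \<bullet> snd p) \<partial>\<gamma>) = \<epsilon> * (u \<bullet> x1)" and gsu_i: "integrable \<gamma> (\<lambda>p. \<epsilon> * g p * (u \<bullet> snd p))" for u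
    proof -
      have "\<epsilon> * g p * (u \<bullet> snd p) = \<epsilon> * (u \<bullet> (g p *\<^sub>R snd p))" for p by simp
      then show "(\<integral>p. \<epsilon> * g p * (u \<bullet> snd p) \<partial>\<gamma>) = \<epsilon> * (u \<bullet> x1)" using x1_eq[of u] by (simp only: integral_mult_right_zero)
      show "integrable \<gamma> (\<lambda>p. \<epsilon> * g p * (u \<bullet> snd p))"
        using bounded_mult(1)[OF integrable_inner_right[OF L2vec_integrable[OF finite_measure_axioms L(2)]]] .
    qed
    have G: "distr N borel (\<lambda>x. (X x, Y x)) \<in> Gamma \<nu>"
    proof (rule GammaI[OF split(1) LX LY law])
      fix A :: "(real^'n) set" and u :: "real^'n" assume A [measurable]: "A \<in> sets borel"
      define \<theta> where "\<theta> p = indicator A (Z p) *\<^sub>R u" for p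
      have \<theta>F: "\<theta> \<in> borel_measurable F" unfolding \<theta>_def using ZF by (intro borel_measurable_scaleR measurable_compose[OF ZF]) auto
      have L\<theta>: "L2vec \<gamma> \<theta>"
        by (rule L2vec_bounded[OF finite_measure_axioms toM[OF \<theta>F], of "norm u"]) (auto simp: \<theta>_def indicator_def)
      \<comment> \<open>The atom contributes a constant factor. \<open>Z\<close> may also take the
        value \<open>x1\<close>, but the identity is additive over the two marks, so such a merging
        is harmless.\<close>
      define c where "c = indicat_real A x1"
      have ip: "(\<lambda>x. (indicator A (X x) *\<^sub>R u) \<bullet> H x) \<in> borel_measurable N" if "H \<in> borel_measurable N" for H :: "_ \<Rightarrow> real^'n"
        using that by (intro borel_measurable_inner borel_measurable_scaleR measurable_compose[OF Xm]) auto
      have "(\<integral>x. (indicator A (X x) *\<^sub>R u) \<bullet> X x \<partial>N) =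
        (\<integral>p. \<epsilon> * g p * (c * (u \<bullet> x1)) + (1 - \<epsilon> * g p) * (\<theta> p \<bullet> Z p) \<partial>\<gamma>)"
        using split(3)[OF ip[OF Xm, unfolded mN]] gi bal_Z(1)[OF \<theta>F L\<theta>] by (simp add: X_def \<theta>_def c_def)
      also have "\<dots> = (\<integral>p. \<epsilon> * g p \<partial>\<gamma>) * (c * (u \<bullet> x1)) + (\<integral>p. \<theta> p \<bullet> (fst p - \<epsilon> *\<^sub>R yh p) \<partial>\<gamma>)"
        using gi bal_Z[OF \<theta>F L\<theta>] by (subst Bochner_Integration.integral_add) auto
      also have "\<dots> = c * (\<epsilon> * (u \<bullet> x1)) + (\<integral>p. \<theta> p \<bullet> (fst p - \<epsilon> *\<^sub>R yh p) \<partial>\<gamma>)" using g1 by simp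
      also have "\<dots> = (\<integral>p. c * (\<epsilon> * g p * (u \<bullet> snd p)) + (1 - \<epsilon> * g p) * (\<theta> p \<bullet> snd p) \<partial>\<gamma>)"
        unfolding gsu[symmetric] bal_snd(2)[OF \<theta>F L\<theta>, symmetric]
        using gsu_i[of u] bal_snd(1)[OF \<theta>F L\<theta>] by (subst Bochner_Integration.integral_add) auto
      also have "\<dots> = (\<integral>p. \<epsilon> * g p * (c * (u \<bullet> snd p)) + (1 - \<epsilon> * g p) * (\<theta> p \<bullet> snd p) \<partial>\<gamma>)"
        by (simp add: ac_simps)
      also have "\<dots> = (\<integral>x. (indicator A (X x) *\<^sub>R u) \<bullet> Y x \<partial>N)"
      proof -
        have "integrable \<gamma> (\<lambda>p. \<epsilon> * g p * (c * (u \<bullet> snd p)))"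
          using integrable_mult_right[OF gsu_i[of u], of c] by (simp add: ac_simps)
        then show ?thesis
          using split(3)[OF ip[OF Ym, unfolded mN]] bal_snd(1)[OF \<theta>F L\<theta>] by (simp add: X_def Y_def \<theta>_def c_def)
      qed
      finally show "(\<integral>x. (indicator A (X x) *\<^sub>R u) \<bullet> X x \<partial>N) = (\<integral>x. (indicator A (X x) *\<^sub>R u) \<bullet> Y x \<partial>N)" .
    qed
    have SZF: "(\<lambda>p. S *v Z p) \<in> borel_measurable F"
      by (rule measurable_matrix_vector[OF ZF])
    have LSZ: "L2vec \<gamma> (\<lambda>p. S *v Z p)" by (rule L2vec_matrix[OF LZ])
    have pm: "(\<lambda>x. (X x, Y x)) \<in> borel_measurable N" unfolding borel_prod[symmetric] by (rule measurable_Pair[OF Xm Ym])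
    note fs = borel_measurable_fst_snd[where 'a = "real^'n" and 'b = "real^'n"]
    have SXY: "(\<lambda>x. Sform S (X x) (Y x)) \<in> borel_measurable N" by (rule measurable_Sform[OF Xm Ym])
    have "(\<integral>p. Sform S (fst p) (snd p) \<partial>distr N borel (\<lambda>x. (X x, Y x))) = (\<integral>x. Sform S (X x) (Y x) \<partial>N)"
      by (subst integral_distr[OF pm measurable_Sform[OF fs]]) simp
    also have "\<dots> = (\<integral>p. \<epsilon> * g p * ((S *v x1) \<bullet> snd p) + (1 - \<epsilon> * g p) * ((S *v Z p) \<bullet> snd p) \<partial>\<gamma>)"
      using split(3)[OF SXY[unfolded mN]] gsu_i[of "S *v x1"] bal_snd(1)[OF SZF LSZ] unfolding X_def Y_def
      by (simp add: Sform_eq_inner[OF sym])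
    also have "\<dots> = \<epsilon> * ((S *v x1) \<bullet> x1) + (\<integral>p. (S *v Z p) \<bullet> (fst p - \<epsilon> *\<^sub>R yh p) \<partial>\<gamma>)"
      using gsu_i[of "S *v x1"] bal_snd[OF SZF LSZ] gsu[of "S *v x1"] by (subst Bochner_Integration.integral_add) auto
    finally have val: "(\<integral>p. Sform S (fst p) (snd p) \<partial>distr N borel (\<lambda>x. (X x, Y x))) = \<epsilon> * Sform S x1 x1 + (\<integral>p. Sform S (Z p) (fst p - \<epsilon> *\<^sub>R yh p) \<partial>\<gamma>)"
      by (simp add: Sform_eq_inner[OF sym])
    have "(\<integral>p. Sform S (fst p) (snd p) \<partial>distr N borel (\<lambda>x. (X x, Y x))) \<le> (\<integral>p. Sform S (fst p) (snd p) \<partial>\<gamma>)"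
      using opt G unfolding optimal_plan_def by auto
    then have "\<epsilon> * Sform S x1 x1 \<le> (\<integral>p. a p \<partial>\<gamma>) - (\<integral>p. Sform S (Z p) (fst p - \<epsilon> *\<^sub>R yh p) \<partial>\<gamma>)"
      unfolding val Gamma_Sform_eq[OF \<gamma> sym] a_def by linarith
    also have "\<dots> = (\<integral>p. a p - Sform S (Z p) (fst p - \<epsilon> *\<^sub>R yh p) \<partial>\<gamma>)"
      using ia L2vec_Sform[OF LZ LD] by simp
    \<comment> \<open>Over the common denominator the terms of order zero cancel and a factor
      \<open>\<epsilon>\<close> can be divided out.\<close>
    also have "\<dots> = (\<integral>p. \<epsilon> * ((2 * b p - a p * gh p - \<epsilon> * d p) / (1 - \<epsilon> * gh p)) \<partial>\<gamma>)"
    proof (intro Bochner_Integration.integral_cong refl)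
      fix p
      have "Sform S (Z p) (fst p - \<epsilon> *\<^sub>R yh p) = (a p - 2 * \<epsilon> * b p + \<epsilon>\<^sup>2 * d p) / den p"
        using Sform_commute[OF sym, of "yh p" "fst p"]
        by (simp add: Z_def a_def b_def d_def Sform_simps power2_eq_square divide_inverse algebra_simps)
      then show "a p - Sform S (Z p) (fst p - \<epsilon> *\<^sub>R yh p) = \<epsilon> * ((2 * b p - a p * gh p - \<epsilon> * d p) / (1 - \<epsilon> * gh p))"
        using den(1)[of p] unfolding den_def by (simp add: field_simps power2_eq_square)
    qed
    also have "\<dots> = \<epsilon> * (\<integral>p. (2 * b p - a p * gh p - \<epsilon> * d p) / (1 - \<epsilon> * gh p) \<partial>\<gamma>)"
      by (rule integral_mult_right_zero)
    finally show ?thesis using \<epsilon>(1) by simp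
  qed
  \<comment> \<open>Chosen so that \<open>\<epsilon> n * K \<le> 1/2\<close> for every
    \<open>n\<close>; \<open>K \<ge> 1\<close> also gives \<open>\<epsilon> n \<le> 1\<close>, and
    the quotients get an integrable bound independent of \<open>n\<close>.\<close>
  define \<epsilon> where "\<epsilon> n = inverse (2 * K + real n)" for n
  have \<epsilon>: "0 < \<epsilon> n" "\<epsilon> n * K \<le> 1/2" "\<epsilon> n \<le> 1" for n
  proof -
    show "0 < \<epsilon> n" using g(4) by (simp add: \<epsilon>_def)
    have "\<epsilon> n \<le> inverse (2 * K)" unfolding \<epsilon>_def using g(4) by (intro le_imp_inverse_le) auto
    then have "\<epsilon> n * K \<le> inverse (2 * K) * K" using g(4) by (intro mult_right_mono) auto
    then show "\<epsilon> n * K \<le> 1/2" using g(4) by simp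
    have "inverse (2 * K + real n) \<le> inverse 1" using g(4) by (intro le_imp_inverse_le) auto
    then show "\<epsilon> n \<le> 1" by (simp add: \<epsilon>_def)
  qed
  have \<epsilon>0: "\<epsilon> \<longlonglongrightarrow> 0"
    unfolding \<epsilon>_def
    by (intro tendsto_inverse_0_at_top filterlim_tendsto_add_at_top[OF tendsto_const] filterlim_real_sequentially)
  have igh: "integrable \<gamma> (\<lambda>p. a p * gh p)" using gh_int[OF aF ia] by blast
  have lim: "(\<lambda>n. \<integral>p. (2 * b p - a p * gh p - \<epsilon> n * d p) / (1 - \<epsilon> n * gh p) \<partial>\<gamma>) \<longlonglongrightarrow> (\<integral>p. 2 * b p - a p * gh p \<partial>\<gamma>)"
  proof (rule integral_dominated_convergence[where w = "\<lambda>p. 2 * (\<bar>2 * b p\<bar> + \<bar>a p * gh p\<bar> + \<bar>d p\<bar>)"])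
    show "AE p in \<gamma>. (\<lambda>n. (2 * b p - a p * gh p - \<epsilon> n * d p) / (1 - \<epsilon> n * gh p)) \<longlonglongrightarrow> 2 * b p - a p * gh p"
    proof (intro always_eventually allI)
      fix p
      have "(\<lambda>n. (2 * b p - a p * gh p - \<epsilon> n * d p) / (1 - \<epsilon> n * gh p)) \<longlonglongrightarrow> (2 * b p - a p * gh p - 0 * d p) / (1 - 0 * gh p)"
        by (intro tendsto_intros \<epsilon>0) auto
      then show "(\<lambda>n. (2 * b p - a p * gh p - \<epsilon> n * d p) / (1 - \<epsilon> n * gh p)) \<longlonglongrightarrow> 2 * b p - a p * gh p" by simp
    qed
    show "AE p in \<gamma>. norm ((2 * b p - a p * gh p - \<epsilon> n * d p) / (1 - \<epsilon> n * gh p)) \<le> 2 * (\<bar>2 * b p\<bar> + \<bar>a p * gh p\<bar> + \<bar>d p\<bar>)" for n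
    proof (intro always_eventually allI)
      fix p
      have "\<epsilon> n * gh p \<le> \<epsilon> n * K" using gh(3) \<epsilon>(1)[of n] by (intro mult_left_mono) auto
      then have den: "1/2 \<le> 1 - \<epsilon> n * gh p" using \<epsilon>(2)[of n] by linarith
      have "\<bar>\<epsilon> n * d p\<bar> \<le> \<bar>d p\<bar>" using \<epsilon>(1,3)[of n] by (simp add: abs_mult mult_left_le_one_le)
      then have num: "\<bar>2 * b p - a p * gh p - \<epsilon> n * d p\<bar> \<le> \<bar>2 * b p\<bar> + \<bar>a p * gh p\<bar> + \<bar>d p\<bar>" by linarith
      have "\<bar>2 * b p - a p * gh p - \<epsilon> n * d p\<bar> / (1 - \<epsilon> n * gh p) \<le> (\<bar>2 * b p\<bar> + \<bar>a p * gh p\<bar> + \<bar>d p\<bar>) / (1/2)"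
        using num den by (intro frac_le) auto
      then show "norm ((2 * b p - a p * gh p - \<epsilon> n * d p) / (1 - \<epsilon> n * gh p)) \<le> 2 * (\<bar>2 * b p\<bar> + \<bar>a p * gh p\<bar> + \<bar>d p\<bar>)"
        using den by (simp add: abs_divide)
    qed
    show "integrable \<gamma> (\<lambda>p. 2 * (\<bar>2 * b p\<bar> + \<bar>a p * gh p\<bar> + \<bar>d p\<bar>))"
      using ib igh id by (intro integrable_mult_right Bochner_Integration.integrable_add integrable_abs) auto
    show "(\<lambda>p. 2 * b p - a p * gh p) \<in> borel_measurable \<gamma>" using ib igh by auto
    show "(\<lambda>p. (2 * b p - a p * gh p - \<epsilon> n * d p) / (1 - \<epsilon> n * gh p)) \<in> borel_measurable \<gamma>" for n
      using ib igh id toM[OF gh(1)] by (intro borel_measurable_divide borel_measurable_diff) auto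
  qed
  have "Sform S x1 x1 \<le> (\<integral>p. 2 * b p - a p * gh p \<partial>\<gamma>)"
    by (rule LIMSEQ_le_const[OF lim]) (use main[OF \<epsilon>(1,2)] in blast)
  also have "\<dots> = 2 * (\<integral>p. b p \<partial>\<gamma>) - (\<integral>p. a p * gh p \<partial>\<gamma>)" using ib igh by simp
  also have "(\<integral>p. b p \<partial>\<gamma>) = (\<integral>p. (S *v fst p) \<bullet> (g p *\<^sub>R snd p) \<partial>\<gamma>)"
  proof -
    have "(\<lambda>p. S *v fst p) \<in> borel_measurable F"
      by (rule measurable_matrix_vector[OF fstF])
    from yh_eq[OF this L2vec_matrix[OF L(1)]] show ?thesis by (simp add: b_def Sform_eq_inner[OF sym])
  qed
  also have "(\<integral>p. a p * gh p \<partial>\<gamma>) = (\<integral>p. a p * g p \<partial>\<gamma>)" by (rule gh_eq[OF aF ia])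
  also have "2 * (\<integral>p. (S *v fst p) \<bullet> (g p *\<^sub>R snd p) \<partial>\<gamma>) - (\<integral>p. a p * g p \<partial>\<gamma>)
      = (\<integral>p. 2 * (g p * tang S (fst p) (snd p)) \<partial>\<gamma>)"
  proof -
    have "integrable \<gamma> (\<lambda>p. (S *v fst p) \<bullet> (g p *\<^sub>R snd p))" by (rule L2vec_inner[OF L2vec_matrix[OF L(1)] Lgs])
    moreover have "integrable \<gamma> (\<lambda>p. a p * g p)" using gh_int[OF aF ia] by blast
    moreover have "2 * (g p * tang S (fst p) (snd p)) = 2 * ((S *v fst p) \<bullet> (g p *\<^sub>R snd p)) - a p * g p" for p
      by (simp add: a_def Sform_eq_inner[OF sym] algebra_simps)
    ultimately show ?thesis by simp
  qed
  finally show ?thesis unfolding x1_def by simp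
qed

text \<open>The averages of \<open>(y, \<phi>)\<close> over admissible densities form a convex set,
  which the variation inequality places above the form. A maximal monotone set below it is compared
  with the plan by concentrating the density where a tangent would exceed
  \<open>\<phi>\<close>.\<close>

theorem optimal_plan_dual:
  fixes \<gamma> :: "((real^'n) \<times> (real^'n)) measure"
  assumes sym: "transpose S = S" and opt: "optimal_plan \<nu> S \<gamma>"
  shows "\<exists>G\<in>maxmon S. AE p in \<gamma>. \<forall>x\<in>G. tang S x (snd p) \<le> tang S (fst p) (snd p)"
proof -
  have \<gamma>: "\<gamma> \<in> Gamma \<nu>" using opt by (simp add: optimal_plan_def)
  note L = GammaD(3,4)[OF \<gamma>]
  interpret prob_space \<gamma> by (rule GammaD(2)[OF \<gamma>])
  have m\<gamma>: "borel_measurable \<gamma> = (borel_measurable borel :: ((real^'n) \<times> (real^'n) \<Rightarrow> 'b::topological_space) set)"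
    by (rule measurable_cong_sets[OF GammaD(1)[OF \<gamma>] refl])
  note fs = borel_measurable_fst_snd[where 'a = "real^'n" and 'b = "real^'n"]
  define \<phi> where "\<phi> p = tang S (fst p) (snd p)" for p :: "(real^'n) \<times> (real^'n)"
  have i\<phi>: "integrable \<gamma> \<phi>" unfolding \<phi>_def using L2vec_Sform[OF L] L2vec_Sform[OF L(1,1)] by auto
  have \<phi>m: "\<phi> \<in> borel_measurable borel"
    unfolding \<phi>_def by (intro borel_measurable_diff borel_measurable_divide measurable_Sform fs borel_measurable_const)
  \<comment> \<open>Bounded densities supported on bounded \<open>y\<close>: the class for which the
    variation inequality is available, still rich enough to contain normalized indicators.\<close>
  define adm where "adm g \<longleftrightarrow> g \<in> borel_measurable borel \<and> (\<forall>p. 0 \<le> g p) \<and>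
    (\<exists>K R. 1 \<le> K \<and> 0 \<le> R \<and> (\<forall>p. g p \<le> K) \<and> (\<forall>p. norm (snd p) > R \<longrightarrow> g p = 0)) \<and> (\<integral>p. g p \<partial>\<gamma>) = 1"
    for g :: "(real^'n) \<times> (real^'n) \<Rightarrow> real"
  have adm_int: "integrable \<gamma> (\<lambda>p. g p *\<^sub>R h p)" if g: "adm g" and h: "integrable \<gamma> h"
    for g and h :: "(real^'n) \<times> (real^'n) \<Rightarrow> 'c::{banach, second_countable_topology}"
  proof -
    obtain K where K: "1 \<le> K" "\<And>p. g p \<le> K" using g unfolding adm_def by blast
    have g0: "\<And>p. 0 \<le> g p" and gm: "g \<in> borel_measurable \<gamma>" using g unfolding adm_def m\<gamma> by auto
    show ?thesis
    proof (rule Bochner_Integration.integrable_bound)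
      show "integrable \<gamma> (\<lambda>p. K *\<^sub>R h p)" using h by simp
      show "AE p in \<gamma>. norm (g p *\<^sub>R h p) \<le> norm (K *\<^sub>R h p)"
        using g0 K by (intro always_eventually allI) (auto intro!: mult_right_mono)
    qed (use gm h in auto)
  qed
  have adm_int0: "integrable \<gamma> g" if "adm g" for g using adm_int[OF that, of "\<lambda>_. 1 :: real"] by simp
  have isnd: "integrable \<gamma> snd" by (rule L2vec_integrable[OF finite_measure_axioms L(2)])
  define E0 where "E0 = {(\<integral>p. g p *\<^sub>R snd p \<partial>\<gamma>, \<integral>p. g p * \<phi> p \<partial>\<gamma>) | g. adm g}"
  have "convex E0"
  proof (rule convexI)
    fix e1 e2 and u v :: real assume "e1 \<in> E0" "e2 \<in> E0" and uv: "0 \<le> u" "0 \<le> v" "u + v = 1"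
    then obtain g1 g2 where g: "adm g1" "adm g2"
      and e: "e1 = (\<integral>p. g1 p *\<^sub>R snd p \<partial>\<gamma>, \<integral>p. g1 p * \<phi> p \<partial>\<gamma>)" "e2 = (\<integral>p. g2 p *\<^sub>R snd p \<partial>\<gamma>, \<integral>p. g2 p * \<phi> p \<partial>\<gamma>)"
      unfolding E0_def by blast
    define g where "g p = u * g1 p + v * g2 p" for p
    obtain K1 R1 where 1: "1 \<le> K1" "0 \<le> R1" "\<And>p. g1 p \<le> K1" "\<And>p. norm (snd p) > R1 \<Longrightarrow> g1 p = 0"
      using g(1) unfolding adm_def by blast
    obtain K2 R2 where 2: "1 \<le> K2" "0 \<le> R2" "\<And>p. g2 p \<le> K2" "\<And>p. norm (snd p) > R2 \<Longrightarrow> g2 p = 0"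
      using g(2) unfolding adm_def by blast
    have nn: "0 \<le> g1 p" "0 \<le> g2 p" for p using g unfolding adm_def by blast+
    have one: "(\<integral>p. g1 p \<partial>\<gamma>) = 1" "(\<integral>p. g2 p \<partial>\<gamma>) = 1" using g unfolding adm_def by blast+
    have "adm g"
      unfolding adm_def
    proof (intro conjI allI exI impI)
      show "g \<in> borel_measurable borel" using g unfolding adm_def g_def by (intro borel_measurable_add borel_measurable_times) auto
      show "0 \<le> g p" for p using nn uv unfolding g_def by simp
      show "1 \<le> K1 + K2" "0 \<le> R1 + R2" using 1 2 by auto
      show "g p \<le> K1 + K2" for p
      proof -
        have "u * g1 p \<le> 1 * K1" using 1(3)[of p] 1(1) uv nn(1)[of p] by (intro mult_mono) auto
        moreover have "v * g2 p \<le> 1 * K2" using 2(3)[of p] 2(1) uv nn(2)[of p] by (intro mult_mono) auto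
        ultimately show ?thesis unfolding g_def by simp
      qed
      show "g p = 0" if "norm (snd p) > R1 + R2" for p using that 1(2) 2(2) 1(4)[of p] 2(4)[of p] unfolding g_def by simp
      show "(\<integral>p. g p \<partial>\<gamma>) = 1"
        unfolding g_def using adm_int0[OF g(1)] adm_int0[OF g(2)] uv by (simp add: one)
    qed
    moreover have "u *\<^sub>R e1 + v *\<^sub>R e2 = (\<integral>p. g p *\<^sub>R snd p \<partial>\<gamma>, \<integral>p. g p * \<phi> p \<partial>\<gamma>)"
    proof -
      have "(\<integral>p. g p *\<^sub>R snd p \<partial>\<gamma>) = (\<integral>p. u *\<^sub>R (g1 p *\<^sub>R snd p) + v *\<^sub>R (g2 p *\<^sub>R snd p) \<partial>\<gamma>)"
        by (simp add: g_def scaleR_add_left)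
      also have "\<dots> = u *\<^sub>R (\<integral>p. g1 p *\<^sub>R snd p \<partial>\<gamma>) + v *\<^sub>R (\<integral>p. g2 p *\<^sub>R snd p \<partial>\<gamma>)"
        using adm_int[OF g(1) isnd] adm_int[OF g(2) isnd] by (simp del: scaleR_scaleR)
      finally have A: "(\<integral>p. g p *\<^sub>R snd p \<partial>\<gamma>) = u *\<^sub>R (\<integral>p. g1 p *\<^sub>R snd p \<partial>\<gamma>) + v *\<^sub>R (\<integral>p. g2 p *\<^sub>R snd p \<partial>\<gamma>)" .
      have "(\<integral>p. g p * \<phi> p \<partial>\<gamma>) = (\<integral>p. u * (g1 p * \<phi> p) + v * (g2 p * \<phi> p) \<partial>\<gamma>)"
        by (simp add: g_def algebra_simps)
      also have "\<dots> = u * (\<integral>p. g1 p * \<phi> p \<partial>\<gamma>) + v * (\<integral>p. g2 p * \<phi> p \<partial>\<gamma>)"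
        using adm_int[OF g(1) i\<phi>] adm_int[OF g(2) i\<phi>] by simp
      finally show ?thesis unfolding e A by simp
    qed
    ultimately show "u *\<^sub>R e1 + v *\<^sub>R e2 \<in> E0" unfolding E0_def by blast
  qed
  have adm_normalized: "adm (\<lambda>p. indicator A p / prob A)"
    if A: "A \<in> sets borel" "prob A > 0" and R: "0 \<le> R" "\<And>p. p \<in> A \<Longrightarrow> norm (snd p) \<le> R" for A R
    unfolding adm_def
  proof (intro conjI allI exI impI)
    show "(\<lambda>p. indicator A p / prob A) \<in> borel_measurable borel" using A by measurable
    show "1 \<le> 1 / prob A" using A(2) prob_le_1[of A] by simp
    show "indicator A p / prob A \<le> 1 / prob A" for p using A(2) by (auto simp: indicator_def)
    show "indicator A p / prob A = 0" if "norm (snd p) > R" for p using R(2)[of p] that by (auto simp: indicator_def)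
    have "A \<in> sets \<gamma>" using A(1) GammaD(1)[OF \<gamma>] by simp
    then show "(\<integral>p. indicator A p / prob A \<partial>\<gamma>) = 1" using A(2) by simp
  qed (use R in auto)
  have "E0 \<noteq> {}"
  proof -
    define A where "A n = {p :: (real^'n) \<times> (real^'n). norm (snd p) \<le> real n}" for n
    have An: "A n \<in> sets borel" for n unfolding A_def using fs by measurable
    then have An': "A n \<in> sets \<gamma>" for n using GammaD(1)[OF \<gamma>] by simp
    have "(\<Union>n. A n) = space \<gamma>"
      unfolding GammaD(6)[OF \<gamma>] A_def using real_arch_simple by auto
    moreover have "incseq A" unfolding A_def by (intro monoI) auto
    ultimately have "(\<lambda>n. prob (A n)) \<longlonglongrightarrow> 1"
      using finite_Lim_measure_incseq[of A] An' by (auto simp: prob_space)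
    then have "\<forall>\<^sub>F n in sequentially. prob (A n) > 0" by (rule order_tendstoD) simp
    then obtain n where "prob (A n) > 0" by (auto simp: eventually_sequentially)
    then have "adm (\<lambda>p. indicator (A n) p / prob (A n))"
      by (intro adm_normalized[OF An, of n "real n"]) (auto simp: A_def)
    then show ?thesis unfolding E0_def by blast
  qed
  moreover have "Sform S y y / 2 \<le> r" if yr: "(y, r) \<in> E0" for y r
  proof -
    obtain g where g: "adm g" and y: "y = (\<integral>p. g p *\<^sub>R snd p \<partial>\<gamma>)" and r: "r = (\<integral>p. g p * \<phi> p \<partial>\<gamma>)"
      using yr unfolding E0_def by blast
    obtain K R where KR: "1 \<le> K" "0 \<le> R" "\<And>p. g p \<le> K" "\<And>p. norm (snd p) > R \<Longrightarrow> g p = 0"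
      using g unfolding adm_def by blast
    have "g \<in> borel_measurable borel" "\<And>p. 0 \<le> g p" "(\<integral>p. g p \<partial>\<gamma>) = 1" using g unfolding adm_def by blast+
    note gg = optimal_plan_variation[OF sym opt this(1,2) KR(3,1,4,2) this(3)]
    show ?thesis unfolding y r \<phi>_def by (rule gg)
  qed
  ultimately have "\<exists>G\<in>maxmon S. \<forall>x\<in>G. \<forall>(y, r)\<in>E0. tang S x y \<le> r"
    by (rule exists_maxmon_below[OF sym \<open>convex E0\<close>])
  then obtain G where G: "G \<in> maxmon S" and GE0: "\<forall>x\<in>G. \<forall>(y, r)\<in>E0. tang S x y \<le> r" by (rule bexE)
  have GE: "tang S x (\<integral>p. g p *\<^sub>R snd p \<partial>\<gamma>) \<le> (\<integral>p. g p * \<phi> p \<partial>\<gamma>)" if x: "x \<in> G" and g: "adm g" for x g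
  proof -
    have "(\<integral>p. g p *\<^sub>R snd p \<partial>\<gamma>, \<integral>p. g p * \<phi> p \<partial>\<gamma>) \<in> E0" unfolding E0_def using g by blast
    from bspec[OF bspec[OF GE0 x] this] show ?thesis by simp
  qed
  have AEx: "AE p in \<gamma>. tang S x (snd p) \<le> \<phi> p" if x: "x \<in> G" for x
  proof -
    define l where "l p = tang S x (snd p)" for p :: "(real^'n) \<times> (real^'n)"
    have lm: "l \<in> borel_measurable borel"
      unfolding l_def by (intro borel_measurable_diff measurable_Sform fs borel_measurable_const)
    have il: "integrable \<gamma> l"
      unfolding l_def Sform_eq_inner[OF sym] using isnd by auto
    \<comment> \<open>The violation set is cut to bounded \<open>y\<close> to make its normalized
      indicator admissible; positive measure would give \<open>\<phi> - l\<close> a strictly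
      negative average.\<close>
    define A where "A n = {p. \<phi> p < l p \<and> norm (snd p) \<le> real n}" for n :: nat
    have An: "A n \<in> sets borel" for n unfolding A_def using \<phi>m lm fs by measurable
    then have An': "A n \<in> sets \<gamma>" for n using GammaD(1)[OF \<gamma>] by simp
    have A0: "prob (A n) = 0" for n
    proof (rule ccontr)
      assume "prob (A n) \<noteq> 0"
      then have pos: "prob (A n) > 0" by (simp add: less_le)
      define g where "g p = indicator (A n) p / prob (A n)" for p
      have g: "adm g" unfolding g_def by (rule adm_normalized[OF An pos, of "real n"]) (auto simp: A_def)
      have "tang S x (\<integral>p. g p *\<^sub>R snd p \<partial>\<gamma>) \<le> (\<integral>p. g p * \<phi> p \<partial>\<gamma>)"
        by (rule GE[OF x g])
      moreover have "tang S x (\<integral>p. g p *\<^sub>R snd p \<partial>\<gamma>) = (\<integral>p. g p * l p \<partial>\<gamma>)"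
      proof -
        have "(\<integral>p. g p * l p \<partial>\<gamma>) = (\<integral>p. (S *v x) \<bullet> (g p *\<^sub>R snd p) - g p * (Sform S x x / 2) \<partial>\<gamma>)"
          unfolding l_def Sform_eq_inner[OF sym] by (simp add: algebra_simps)
        also have "\<dots> = (S *v x) \<bullet> (\<integral>p. g p *\<^sub>R snd p \<partial>\<gamma>) - Sform S x x / 2"
          using adm_int[OF g isnd] adm_int0[OF g] g unfolding adm_def
          by (subst Bochner_Integration.integral_diff) (auto simp del: inner_scaleR_right)
        finally show ?thesis by (simp add: Sform_eq_inner[OF sym])
      qed
      ultimately have "0 \<le> (\<integral>p. g p * (\<phi> p - l p) \<partial>\<gamma>)"
        using adm_int[OF g i\<phi>] adm_int[OF g il] by (simp add: right_diff_distrib)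
      moreover have i: "integrable \<gamma> (\<lambda>p. g p * (l p - \<phi> p))"
        using adm_int[OF g i\<phi>] adm_int[OF g il] by (simp add: right_diff_distrib)
      moreover have nn: "AE p in \<gamma>. 0 \<le> g p * (l p - \<phi> p)"
        using pos by (intro always_eventually allI) (auto simp: g_def A_def indicator_def)
      moreover have "(\<integral>p. g p * (\<phi> p - l p) \<partial>\<gamma>) = - (\<integral>p. g p * (l p - \<phi> p) \<partial>\<gamma>)"
        by (subst Bochner_Integration.integral_minus[symmetric]) (simp add: algebra_simps)
      moreover have "0 \<le> (\<integral>p. g p * (l p - \<phi> p) \<partial>\<gamma>)" by (rule integral_nonneg_AE[OF nn])
      ultimately have "(\<integral>p. g p * (l p - \<phi> p) \<partial>\<gamma>) = 0" by linarith
      then have "AE p in \<gamma>. g p * (l p - \<phi> p) = 0" using integral_nonneg_eq_0_iff_AE[OF i nn] by simp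
      then have "AE p in \<gamma>. p \<notin> A n"
        by eventually_elim (use pos in \<open>auto simp: g_def A_def indicator_def\<close>)
      then have "A n \<in> null_sets \<gamma>" using AE_iff_null_sets[OF An'] by simp
      then show False using pos by (simp add: null_sets_def measure_def)
    qed
    have "AE p in \<gamma>. p \<notin> A n" for n
      using A0[of n] An'[of n] by (intro AE_not_in) (simp add: null_sets_def emeasure_eq_measure)
    then have "AE p in \<gamma>. \<forall>n. p \<notin> A n" by (simp add: AE_all_countable)
    then show ?thesis
    proof eventually_elim
      case (elim p)
      obtain n :: nat where "norm (snd p) \<le> real n" using real_arch_simple by blast
      then have "\<not> \<phi> p < l p" using spec[OF elim, of n] by (simp add: A_def)
      then show ?case by (simp add: l_def)
    qed
  qed
  \<comment> \<open>The null set in \<open>AEx\<close> depends on \<open>x\<close>; a dense sequence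
    and continuity make it uniform over \<open>G\<close>.\<close>
  obtain g :: "nat \<Rightarrow> real^'n" where g: "range g \<subseteq> G" "G \<subseteq> closure (range g)"
    using countable_dense_subset[OF maxmon_nonempty[OF G]] by blast
  have "AE p in \<gamma>. \<forall>k. tang S (g k) (snd p) \<le> \<phi> p"
    using AEx g(1) by (subst AE_all_countable) blast
  then have "AE p in \<gamma>. \<forall>x\<in>G. tang S x (snd p) \<le> tang S (fst p) (snd p)"
  proof eventually_elim
    case (elim p)
    show ?case
    proof
      fix x assume "x \<in> G"
      then have "x \<in> closure (range g)" using g(2) by blast
      moreover have "continuous_on UNIV (\<lambda>a. tang S a (snd p))" by (intro continuous_intros) auto
      ultimately show "tang S x (snd p) \<le> tang S (fst p) (snd p)"
        by (rule closure_le) (use elim in \<open>auto simp: \<phi>_def\<close>)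
    qed
  qed
  then show ?thesis using G by blast
qed

section \<open>The projection multifunction\<close>

text \<open>Maximizers in a compact set have convergent subsequences, and the inequalities defining
  them pass to joint limits.\<close>

lemma closed_PG_hit_compact:
  assumes G: "closed G" and K: "compact K"
  shows "closed {y. PG S G y \<inter> K \<noteq> {}}"
proof (unfold closed_sequential_limits, intro allI impI, elim conjE)
  fix y l assume y: "\<forall>n::nat. y n \<in> {y. PG S G y \<inter> K \<noteq> {}}" and lim: "y \<longlonglongrightarrow> l"
  then have "\<forall>n. \<exists>a. a \<in> PG S G (y n) \<and> a \<in> K" by blast
  then obtain a where a: "\<And>n. a n \<in> PG S G (y n)" "\<And>n. a n \<in> K" by metis
  obtain b r where b: "b \<in> K" and r: "strict_mono (r :: nat \<Rightarrow> nat)" and ab: "(a \<circ> r) \<longlonglongrightarrow> b"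
    using seq_compactE[OF K[unfolded compact_eq_seq_compact_metric], of a] a(2) by blast
  have al: "(\<lambda>n. a (r n)) \<longlonglongrightarrow> b" using ab by (simp add: comp_def)
  have yl: "(\<lambda>n. y (r n)) \<longlonglongrightarrow> l" using LIMSEQ_subseq_LIMSEQ[OF lim r] by (simp add: comp_def)
  have "b \<in> G" by (rule closed_sequentially[OF G _ al]) (use a(1) in \<open>auto simp: PG_def\<close>)
  moreover have "tang S g l \<le> tang S b l" if g: "g \<in> G" for g
  proof (rule LIMSEQ_le)
    show "(\<lambda>n. tang S g (y (r n))) \<longlonglongrightarrow> tang S g l" "(\<lambda>n. tang S (a (r n)) (y (r n))) \<longlonglongrightarrow> tang S b l"
      by (intro tendsto_intros al yl, simp)+
    show "\<exists>N. \<forall>n\<ge>N. tang S g (y (r n)) \<le> tang S (a (r n)) (y (r n))"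
      using a(1) g by (auto simp: PG_def)
  qed
  ultimately have "b \<in> PG S G l" by (simp add: PG_def)
  then show "l \<in> {y. PG S G y \<inter> K \<noteq> {}}" using b by blast
qed

text \<open>An open set is a countable union of compact boxes, and hitting a box is a closed
  condition.\<close>

lemma borel_PG_hit_open:
  assumes G: "closed G" and U: "open U"
  shows "{y. PG S G y \<inter> U \<noteq> {}} \<in> sets borel"
proof -
  obtain \<D> where D: "countable \<D>" "\<And>X. X \<in> \<D> \<Longrightarrow> \<exists>a b. X = cbox a b" "\<Union>\<D> = U"
    using open_countable_Union_open_cbox[OF U] by metis
  have "{y. PG S G y \<inter> U \<noteq> {}} = (\<Union>X\<in>\<D>. {y. PG S G y \<inter> X \<noteq> {}})" using D(3) by blast
  moreover have "{y. PG S G y \<inter> X \<noteq> {}} \<in> sets borel" if X: "X \<in> \<D>" for X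
    using D(2)[OF X] closed_PG_hit_compact[OF G, of X S] by (metis borel_closed compact_cbox)
  ultimately show ?thesis using D(1) by auto
qed

lemma space_sigmaPG [simp]: "space (sigmaPG S G) = UNIV"
  by (simp add: sigmaPG_def)

lemma sets_sigmaPG: "sets (sigmaPG S G) = sigma_sets UNIV {{y. PG S G y \<inter> U \<noteq> {}} | U. open U}"
  by (simp add: sigmaPG_def)

lemma sigmaPG_hit_open: "open U \<Longrightarrow> {y. PG S G y \<inter> U \<noteq> {}} \<in> sets (sigmaPG S G)"
  unfolding sets_sigmaPG by blast

lemma sigmaPG_sub_borel:
  assumes "closed G"
  shows "sets (sigmaPG S G) \<subseteq> sets borel"
  unfolding sets_sigmaPG
  by (rule sets.sigma_sets_subset[of _ borel, simplified]) (use borel_PG_hit_open[OF assms] in auto)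

text \<open>Every generator is described by \<open>PG S G y\<close> alone, and complements and
  countable unions inherit this. Functions measurable for this algebra thus depend on
  \<open>y\<close> only through its projection set.\<close>

lemma sigmaPG_saturated:
  assumes "A \<in> sets (sigmaPG S G)" "PG S G y = PG S G z"
  shows "y \<in> A \<longleftrightarrow> z \<in> A"
  using assms(1) unfolding sets_sigmaPG
proof (induction rule: sigma_sets.induct)
  case (Basic a)
  then show ?case using assms(2) by auto
qed auto

text \<open>The pointwise infimum over \<open>m\<close> is bounded by every \<open>w m\<close>, so
  its integral is zero. Working with the infimum avoids passing to an almost surely convergent
  subsequence.\<close>

lemma AE_small_of_integral_tendsto_0:
  fixes w :: "nat \<Rightarrow> 'a \<Rightarrow> real"
  assumes w: "\<And>m. integrable M (w m)" "\<And>m. AE p in M. 0 \<le> w m p" and lim: "(\<lambda>m. \<integral>p. w m p \<partial>M) \<longlonglongrightarrow> 0"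
  shows "AE p in M. \<forall>\<epsilon>>0. \<exists>m. w m p < \<epsilon>"
proof -
  have [measurable]: "w m \<in> borel_measurable M" for m using w(1) by simp
  have le: "(\<integral>\<^sup>+p. (INF m. ennreal (w m p)) \<partial>M) \<le> ennreal (\<integral>p. w m p \<partial>M)" for m
  proof -
    have "(\<integral>\<^sup>+p. (INF m. ennreal (w m p)) \<partial>M) \<le> (\<integral>\<^sup>+p. ennreal (w m p) \<partial>M)"
      by (intro nn_integral_mono INF_lower) simp
    then show ?thesis using nn_integral_eq_integral[OF w] by simp
  qed
  have "(\<lambda>m. ennreal (\<integral>p. w m p \<partial>M)) \<longlonglongrightarrow> ennreal 0" by (rule tendsto_ennrealI[OF lim])
  then have "(\<integral>\<^sup>+p. (INF m. ennreal (w m p)) \<partial>M) \<le> ennreal 0"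
    by (rule LIMSEQ_le_const) (use le in blast)
  then have "AE p in M. (INF m. ennreal (w m p)) = 0"
    by (subst (asm) ennreal_0) (simp add: nn_integral_0_iff_AE)
  moreover have "AE p in M. \<forall>m. 0 \<le> w m p" using w(2) by (simp add: AE_all_countable)
  ultimately show ?thesis
  proof eventually_elim
    case (elim p)
    show ?case
    proof (intro allI impI)
      fix \<epsilon> :: real assume e: "\<epsilon> > 0"
      then have "(INF m. ennreal (w m p)) < ennreal \<epsilon>" unfolding elim(1) by simp
      then obtain m where "ennreal (w m p) < ennreal \<epsilon>" by (auto simp: INF_less_iff)
      then have "w m p < \<epsilon>" using e elim(2) by (simp add: ennreal_less_iff)
      then show "\<exists>m. w m p < \<epsilon>" by blast
    qed
  qed
qed

text \<open>At a point of \<open>G\<close> psi_G equals the form and is attained at the point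
  itself; a competitor ties exactly when its difference to the point is isotropic.\<close>

lemma PG_of_mem:
  assumes sym: "transpose S = S" and G: "G \<in> maxmon S" and z: "z \<in> G"
  shows "x \<in> PG S G z \<longleftrightarrow> x \<in> G \<and> Sform S (x - z) (x - z) = 0"
proof -
  have "tang S g z \<le> tang S z z" if "g \<in> G" for g
    using tang_eq[OF sym, of g z] maxmon_monotone[OF G that z] by (simp add: field_simps)
  moreover have "tang S x z = tang S z z - Sform S (x - z) (x - z) / 2"
    using tang_eq[OF sym, of x z] by simp
  ultimately show ?thesis
    unfolding PG_iff using z maxmon_monotone[OF G, of x z] by (auto simp: antisym)
qed

text \<open>For \<open>z\<close> in P_G(y) and \<open>x\<close> in P_G(z),
  \<open>S(x-z, z-y)\<close> is the amount by which the tangent at \<open>x\<close> misses the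
  maximum at \<open>y\<close>. For a selection \<open>x\<close> depending on \<open>z\<close> its
  mean would vanish by the martingale property, and nonnegativity puts \<open>x\<close> into P_G(y).
  The converse inclusion holds because points of P_G(y) differ by isotropic vectors.\<close>

theorem PG_fst_eq_PG_snd:
  fixes \<gamma> :: "((real^'n) \<times> (real^'n)) measure"
  assumes sym: "transpose S = S" and G: "G \<in> maxmon S" and \<gamma>: "\<gamma> \<in> Gamma \<nu>"
    and mem: "AE p in \<gamma>. fst p \<in> PG S G (snd p)"
    and iso: "AE y in \<nu>. \<forall>a\<in>PG S G y. \<forall>b\<in>PG S G y. Sform S (a - b) (a - b) = 0"
  shows "AE p in \<gamma>. PG S G (fst p) = PG S G (snd p)"
proof -
  interpret prob_space \<gamma> by (rule GammaD(2)[OF \<gamma>])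
  note L = GammaD(3,4)[OF \<gamma>]
  have fstm: "fst \<in> borel_measurable \<gamma>" and sndm: "snd \<in> borel_measurable \<gamma>" using L by (auto simp: L2vec_def)
  have cG: "closed G" by (rule closed_maxmon[OF G])
  have isoS: "AE p in \<gamma>. \<forall>a\<in>PG S G (snd p). \<forall>b\<in>PG S G (snd p). Sform S (a - b) (a - b) = 0"
    using iso unfolding GammaD(5)[OF \<gamma>, symmetric] by (rule AE_distrD[OF sndm])
  obtain K where K: "K > 0" "\<And>x y. \<bar>Sform S x y\<bar> \<le> K * norm x * norm y" using Sform_bound[of S] by blast
  obtain e :: "nat \<Rightarrow> real^'n" where e: "closure (range e) = UNIV" using countable_dense_subset[of "UNIV :: (real^'n) set"] by auto
  have dense: "\<exists>k. dist (e k) x < r" if "r > 0" for x r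
    using closure_approachable[of x "range e"] e that by auto
  have LD: "L2vec \<gamma> (\<lambda>p. fst p - snd p)" by (rule L2vec_diff[OF L])
  have nonneg: "0 \<le> Sform S (x - z) (z - y)" and eq0: "Sform S (x - z) (z - y) = 0 \<Longrightarrow> x \<in> PG S G y"
    if z: "z \<in> PG S G y" and x: "x \<in> PG S G z" for x y z
  proof -
    have zG: "z \<in> G" using z by (simp add: PG_iff)
    then have xG: "x \<in> G" and x0: "Sform S (x - z) (x - z) = 0" using PG_of_mem[OF sym G zG] x by auto
    have id: "Sform S (x - z) (z - y) = tang S z y - tang S x y"
      using x0 Sform_commute[OF sym, of z x] by (simp add: Sform_simps field_simps)
    show "0 \<le> Sform S (x - z) (z - y)" unfolding id using z xG by (simp add: PG_iff)
    show "x \<in> PG S G y" if "Sform S (x - z) (z - y) = 0" using that z xG unfolding id by (simp add: PG_iff)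
  qed
  \<comment> \<open>The selection argument for approximate selections inside a bounded open
    \<open>U\<close>. Boundedness makes them square-integrable; small sets \<open>U\<close> later
    reach every point of P_G(z) and not just a selected one.\<close>
  have near: "AE p in \<gamma>. PG S G (fst p) \<inter> U \<noteq> {} \<longrightarrow> (\<forall>\<epsilon>>0. \<exists>x\<in>PG S G (fst p) \<inter> U. Sform S (x - fst p) (fst p - snd p) < \<epsilon>)"
    if U: "open U" and c: "\<And>x. x \<in> U \<Longrightarrow> norm x \<le> c" for U c
  proof -
    define r where "r m = inverse (real (Suc m))" for m
    have r: "0 < r m" "r m \<le> 1" for m by (auto simp: r_def inverse_le_1_iff)
    define hit where "hit m k z \<longleftrightarrow> PG S G z \<inter> (U \<inter> ball (e k) (r m)) \<noteq> {}" for m k z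
    define H where "H z \<longleftrightarrow> PG S G z \<inter> U \<noteq> {}" for z
    \<comment> \<open>The first dense point whose \<open>r m\<close>-ball meets P_G(z) inside
      \<open>U\<close>: a Borel function of \<open>z\<close> that stays within \<open>r m\<close> of
      a point of P_G(z).\<close>
    define \<kappa> where "\<kappa> m z = (LEAST k. hit m k z)" for m z
    have hit_ex: "\<exists>k. hit m k z" if Hz: "H z" for m z
    proof -
      obtain x where x: "x \<in> PG S G z" "x \<in> U" using Hz unfolding H_def by blast
      obtain k where "dist (e k) x < r m" using dense[OF r(1)] by blast
      then have "x \<in> ball (e k) (r m)" by simp
      then show ?thesis using x unfolding hit_def by blast
    qed
    have hit_\<kappa>: "hit m (\<kappa> m z) z" if Hz: "H z" for m z
      unfolding \<kappa>_def by (rule LeastI_ex) (rule hit_ex[OF Hz])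
    have [measurable]: "Measurable.pred borel (hit m k)" for m k
      unfolding pred_def hit_def using borel_PG_hit_open[OF cG open_Int[OF U open_ball]] by simp
    have [measurable]: "Measurable.pred borel H"
      unfolding pred_def H_def using borel_PG_hit_open[OF cG U, of S] by simp
    have \<kappa>m: "\<kappa> m \<in> measurable borel (count_space UNIV)" for m unfolding \<kappa>_def by measurable
    have e\<kappa>: "(\<lambda>z. e (\<kappa> m z)) \<in> borel_measurable borel" for m by (rule measurable_compose[OF \<kappa>m]) simp
    define \<theta> where "\<theta> m z = (if H z then e (\<kappa> m z) - z else 0)" for m z
    have \<theta>m: "\<theta> m \<in> borel_measurable borel" for m
    proof -
      note e\<kappa>[measurable]
      show ?thesis unfolding \<theta>_def by measurable
    qed
    have L\<theta>: "L2vec \<gamma> (\<lambda>p. \<theta> m (fst p))" for m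
    proof -
      define f1 where "f1 z = (if H z then e (\<kappa> m z) else 0)" for z
      define f2 where "f2 z = (if H z then z else 0)" for z
      note e\<kappa>[measurable]
      have f: "f1 \<in> borel_measurable borel" "f2 \<in> borel_measurable borel" unfolding f1_def f2_def by measurable
      have "norm (f1 z) \<le> \<bar>c\<bar> + 1" for z
      proof (cases "H z")
        case True
        then obtain x where x: "x \<in> U" "dist (e (\<kappa> m z)) x < r m" using hit_\<kappa>[of z m] unfolding hit_def mem_ball[symmetric] by blast
        have "norm (e (\<kappa> m z)) \<le> norm x + dist (e (\<kappa> m z)) x" by (simp add: dist_norm norm_triangle_sub)
        then show ?thesis using x c[of x] r(2)[of m] True by (simp add: f1_def)
      qed (simp add: f1_def)
      then have "L2vec \<gamma> (\<lambda>p. f1 (fst p))"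
        by (intro L2vec_bounded[OF finite_measure_axioms measurable_compose[OF fstm f(1)]])
      moreover have "L2vec \<gamma> (\<lambda>p. f2 (fst p))"
        by (rule L2vec_le[OF L(1) measurable_compose[OF fstm f(2)]]) (auto simp: f2_def)
      ultimately have "L2vec \<gamma> (\<lambda>p. f1 (fst p) - f2 (fst p))" by (rule L2vec_diff)
      moreover have "f1 z - f2 z = \<theta> m z" for z by (simp add: f1_def f2_def \<theta>_def)
      ultimately show ?thesis by simp
    qed
    \<comment> \<open>The second summand pays for replacing a point of P_G(z) by
      \<open>e (\<kappa> m z)\<close>. It makes \<open>w m\<close> nonnegative almost everywhere,
      while its integral vanishes with \<open>r m\<close>.\<close>
    define w where "w m p = Sform S (\<theta> m (fst p)) (fst p - snd p) + K * r m * norm (fst p - snd p)" for m p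
    have iS: "integrable \<gamma> (\<lambda>p. Sform S (\<theta> m (fst p)) (fst p - snd p))" for m by (rule L2vec_Sform[OF L\<theta> LD])
    have iN: "integrable \<gamma> (\<lambda>p. norm (fst p - snd p))" using L2vec_integrable[OF finite_measure_axioms LD] by (rule integrable_norm)
    have iw: "integrable \<gamma> (w m)" for m unfolding w_def using iS iN by auto
    have S\<theta>: "(\<lambda>z. S *v \<theta> m z) \<in> borel_measurable borel" for m
      by (rule measurable_matrix_vector[OF \<theta>m])
    have intS0: "(\<integral>p. Sform S (\<theta> m (fst p)) (fst p - snd p) \<partial>\<gamma>) = 0" for m
    proof -
      have LS: "L2vec \<gamma> (\<lambda>p. S *v \<theta> m (fst p))" by (rule L2vec_matrix[OF L\<theta>])
      show ?thesis
        using Gamma_test[OF \<gamma> S\<theta> LS] L2vec_inner[OF LS L(1)] L2vec_inner[OF LS L(2)]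
        by (simp add: Sform_eq_inner[OF sym] inner_diff_right)
    qed
    have int_w: "(\<integral>p. w m p \<partial>\<gamma>) = K * r m * (\<integral>p. norm (fst p - snd p) \<partial>\<gamma>)" for m
      unfolding w_def using iS[of m] iN intS0[of m] by simp
    have step: "\<exists>x\<in>PG S G z \<inter> U. Sform S (x - z) (z - y) \<le> w m (z, y)" if Hz: "H z" for m z y
    proof -
      obtain x where x: "x \<in> PG S G z" "x \<in> U" "dist (e (\<kappa> m z)) x < r m" using hit_\<kappa>[OF Hz, of m] unfolding hit_def mem_ball[symmetric] by blast
      have "Sform S (x - e (\<kappa> m z)) (z - y) \<le> K * norm (x - e (\<kappa> m z)) * norm (z - y)" using K(2) abs_le_D1 by blast
      also have "\<dots> \<le> K * r m * norm (z - y)"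
        using x(3) K(1) by (intro mult_right_mono mult_left_mono) (auto simp: dist_norm norm_minus_commute)
      finally have "Sform S (x - z) (z - y) \<le> w m (z, y)" using Hz by (simp add: w_def \<theta>_def Sform_simps)
      then show ?thesis using x by blast
    qed
    have w_nonneg: "AE p in \<gamma>. 0 \<le> w m p" for m
      using mem
    proof eventually_elim
      case (elim p)
      show ?case
      proof (cases "H (fst p)")
        case True
        then obtain x where "x \<in> PG S G (fst p)" "Sform S (x - fst p) (fst p - snd p) \<le> w m (fst p, snd p)"
          using step by blast
        then show ?thesis using nonneg[OF elim, of x] by simp
      next
        case False
        then show ?thesis using K(1) r(1)[of m] by (simp add: w_def \<theta>_def Sform_simps)
      qed
    qed
    have "r \<longlonglongrightarrow> 0" unfolding r_def by (rule LIMSEQ_inverse_real_of_nat)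
    then have "(\<lambda>m. K * r m * (\<integral>p. norm (fst p - snd p) \<partial>\<gamma>)) \<longlonglongrightarrow> K * 0 * (\<integral>p. norm (fst p - snd p) \<partial>\<gamma>)"
      by (intro tendsto_intros)
    then have "AE p in \<gamma>. \<forall>\<epsilon>>0. \<exists>m. w m p < \<epsilon>"
      by (intro AE_small_of_integral_tendsto_0 iw w_nonneg) (simp add: int_w)
    then show ?thesis
    proof eventually_elim
      case (elim p)
      show ?case
      proof (intro impI allI)
        fix \<epsilon> :: real assume H: "PG S G (fst p) \<inter> U \<noteq> {}" and "\<epsilon> > 0"
        then obtain m where m: "w m p < \<epsilon>" using elim by blast
        obtain x where "x \<in> PG S G (fst p) \<inter> U" "Sform S (x - fst p) (fst p - snd p) \<le> w m (fst p, snd p)"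
          using step[of "fst p" "snd p" m] H unfolding H_def by blast
        then show "\<exists>x\<in>PG S G (fst p) \<inter> U. Sform S (x - fst p) (fst p - snd p) < \<epsilon>" using m by force
      qed
    qed
  qed
  define V where "V i n = ball (e i) (inverse (real (Suc n)))" for i n
  have "AE p in \<gamma>. PG S G (fst p) \<inter> V i n \<noteq> {} \<longrightarrow> (\<forall>\<epsilon>>0. \<exists>x\<in>PG S G (fst p) \<inter> V i n. Sform S (x - fst p) (fst p - snd p) < \<epsilon>)" for i n
  proof (rule near)
    show "open (V i n)" by (simp add: V_def)
    show "norm x \<le> norm (e i) + inverse (real (Suc n))" if "x \<in> V i n" for x
      using that norm_triangle_sub[of x "e i"] by (simp add: V_def dist_norm norm_minus_commute)
  qed
  then have "AE p in \<gamma>. \<forall>i n. PG S G (fst p) \<inter> V i n \<noteq> {} \<longrightarrow> (\<forall>\<epsilon>>0. \<exists>x\<in>PG S G (fst p) \<inter> V i n. Sform S (x - fst p) (fst p - snd p) < \<epsilon>)"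
    by (simp add: AE_all_countable)
  then show ?thesis
    using mem isoS
  proof eventually_elim
    case (elim p)
    define z where "z = fst p"
    define y where "y = snd p"
    have zy: "z \<in> PG S G y" using elim(2) by (simp add: z_def y_def)
    then have zG: "z \<in> G" by (simp add: PG_iff)
    have "x \<in> PG S G y" if x: "x \<in> PG S G z" for x
    proof (rule eq0[OF zy x])
      have "Sform S (x - z) (z - y) \<le> 0 + \<epsilon>" if \<epsilon>: "\<epsilon> > 0" for \<epsilon>
      proof -
        define c where "c = norm (z - y) + 1"
        \<comment> \<open>Two points of a ball of radius below \<open>\<delta>\<close> are less than
          \<open>2 * \<delta>\<close> apart, and \<open>K * (2 * \<delta>) * c\<close> equals
          \<open>\<epsilon> / 2\<close>. The \<open>+ 1\<close> in \<open>c\<close> keeps the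
          denominator positive when \<open>z = y\<close>.\<close>
        define \<delta> where "\<delta> = \<epsilon> / (4 * K * c)"
        have pos: "c > 0" unfolding c_def by (rule add_nonneg_pos) auto
        have \<delta>: "\<delta> > 0" unfolding \<delta>_def using \<epsilon> K(1) pos by (intro divide_pos_pos mult_pos_pos) auto
        obtain n where n: "inverse (real (Suc n)) < \<delta>" using reals_Archimedean[OF \<delta>] by blast
        obtain i where i: "dist (e i) x < inverse (real (Suc n))" using dense[of "inverse (real (Suc n))"] by auto
        have "PG S G z \<inter> V i n \<noteq> {}" using x i unfolding V_def by auto
        then obtain x' where x': "x' \<in> V i n" "Sform S (x' - z) (z - y) < \<epsilon> / 2"
          using elim(1) \<epsilon> unfolding z_def y_def by (meson IntE half_gt_zero)
        have "dist x x' \<le> dist x (e i) + dist (e i) x'" by (rule dist_triangle)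
        also have "\<dots> < 2 * \<delta>" using i x'(1) n unfolding V_def by (simp add: dist_commute)
        finally have d: "norm (x - x') \<le> 2 * \<delta>" by (simp add: dist_norm)
        have "Sform S (x - x') (z - y) \<le> K * norm (x - x') * norm (z - y)" using K(2) abs_le_D1 by blast
        also have "\<dots> \<le> K * (2 * \<delta>) * c"
          using d K(1) \<delta> by (intro mult_mono mult_left_mono) (auto simp: c_def)
        also have "\<dots> = \<epsilon> / 2" unfolding \<delta>_def using K(1) pos by (simp add: field_simps)
        finally have "Sform S (x - x') (z - y) \<le> \<epsilon> / 2" .
        moreover have "Sform S (x - z) (z - y) = Sform S (x - x') (z - y) + Sform S (x' - z) (z - y)"
          by (simp add: Sform_simps)
        ultimately show ?thesis using x'(2) by linarith
      qed
      then have "Sform S (x - z) (z - y) \<le> 0" by (rule field_le_epsilon)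
      then show "Sform S (x - z) (z - y) = 0" using nonneg[OF zy x] by linarith
    qed
    moreover have "x \<in> PG S G z" if x: "x \<in> PG S G y" for x
      using elim(3) x zy unfolding y_def[symmetric] by (subst PG_of_mem[OF sym G zG]) (auto simp: PG_iff)
    ultimately show ?case unfolding z_def y_def by blast
  qed
qed

section \<open>Conditional expectation given the projection\<close>

text \<open>Doob-Dynkin factorization: rational superlevel sets of \<open>f\<close> are preimages of
  sets \<open>A c\<close>, and the supremum of the \<open>c\<close> with \<open>y\<close> in
  \<open>A c\<close> rebuilds the value. It is formed in the extended reals because off the range of
  \<open>Y\<close> it may be infinite.\<close>

lemma vimage_algebra_factor_real:
  fixes f :: "'w \<Rightarrow> real"
  assumes f: "f \<in> borel_measurable (vimage_algebra \<Omega> Y N)" and Y: "\<And>w. w \<in> \<Omega> \<Longrightarrow> Y w \<in> space N"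
  shows "\<exists>\<xi>\<in>borel_measurable N. \<forall>w\<in>\<Omega>. f w = \<xi> (Y w)"
proof -
  have YN: "Y \<in> \<Omega> \<rightarrow> space N" using Y by blast
  have "\<exists>A. A \<in> sets N \<and> {w \<in> \<Omega>. real_of_rat c < f w} = Y -` A \<inter> \<Omega>" for c :: rat
  proof -
    have "{w \<in> space (vimage_algebra \<Omega> Y N). real_of_rat c < f w} \<in> sets (vimage_algebra \<Omega> Y N)"
      using f by measurable
    then show ?thesis unfolding sets_vimage_algebra2[OF YN] by auto
  qed
  then obtain A where A: "\<And>c. A c \<in> sets N" "\<And>c :: rat. {w \<in> \<Omega>. real_of_rat c < f w} = Y -` A c \<inter> \<Omega>" by metis
  define \<xi> where "\<xi> y = (SUP c :: rat. if y \<in> A c then ereal (real_of_rat c) else - \<infinity>)" for y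
  have \<xi>m: "\<xi> \<in> borel_measurable N"
    unfolding \<xi>_def
  proof (rule borel_measurable_SUP)
    fix c :: rat
    have "{y \<in> space N. y \<in> A c} \<in> sets N" using A(1)[of c] sets.sets_into_space[OF A(1)[of c]] by (simp add: Collect_conj_eq Int_absorb1)
    then show "(\<lambda>y. if y \<in> A c then ereal (real_of_rat c) else - \<infinity>) \<in> borel_measurable N"
      by (intro measurable_If) auto
  qed auto
  have "\<xi> (Y w) = ereal (f w)" if w: "w \<in> \<Omega>" for w
  proof (rule antisym)
    have mem: "Y w \<in> A c \<longleftrightarrow> real_of_rat c < f w" for c using A(2)[of c] w by blast
    show "\<xi> (Y w) \<le> ereal (f w)" unfolding \<xi>_def by (rule SUP_least) (auto simp: mem)
    show "ereal (f w) \<le> \<xi> (Y w)"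
    proof (rule dense_ge)
      fix x assume x: "\<xi> (Y w) < x"
      show "ereal (f w) \<le> x"
      proof (rule ccontr)
        assume "\<not> ereal (f w) \<le> x"
        then have "x < ereal (f w)" by simp
        moreover have "x \<noteq> - \<infinity>" using x by auto
        ultimately obtain r where r: "x = ereal r" "r < f w" by (cases x) auto
        obtain c where c: "r < real_of_rat c" "real_of_rat c < f w" using of_rat_dense[OF r(2)] by blast
        have "ereal (real_of_rat c) \<le> \<xi> (Y w)"
          unfolding \<xi>_def by (rule SUP_upper2[of c]) (use c mem in auto)
        then have "ereal (real_of_rat c) < ereal r" using x r by (metis le_less_trans)
        then show False using c by simp
      qed
    qed
  qed
  then show ?thesis using \<xi>m by (intro bexI[of _ "\<lambda>y. real_of_ereal (\<xi> y)"]) auto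
qed

lemma vimage_algebra_factor:
  fixes X :: "'w \<Rightarrow> real^'n"
  assumes X: "X \<in> borel_measurable (vimage_algebra \<Omega> Y N)" and Y: "\<And>w. w \<in> \<Omega> \<Longrightarrow> Y w \<in> space N"
  shows "\<exists>\<xi>\<in>borel_measurable N. \<forall>w\<in>\<Omega>. X w = \<xi> (Y w)"
proof -
  have "\<exists>\<xi>. \<xi> \<in> borel_measurable N \<and> (\<forall>w\<in>\<Omega>. X w $ i = \<xi> (Y w))" for i
    using vimage_algebra_factor_real[OF measurable_vec_component[OF X] Y, of i] by blast
  then have "\<forall>i. \<exists>\<xi>. \<xi> \<in> borel_measurable N \<and> (\<forall>w\<in>\<Omega>. X w $ i = \<xi> (Y w))" by blast
  then obtain \<xi> where \<xi>: "\<forall>i. \<xi> i \<in> borel_measurable N \<and> (\<forall>w\<in>\<Omega>. X w $ i = \<xi> i (Y w))"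
    by (rule choice[THEN exE])
  show ?thesis
  proof (intro bexI ballI)
    show "X w = (\<lambda>y. \<chi> i. \<xi> i y) (Y w)" if "w \<in> \<Omega>" for w using \<xi> that by (simp add: vec_eq_iff)
    show "(\<lambda>y. \<chi> i. \<xi> i y) \<in> borel_measurable N" by (rule borel_measurable_vecI) (use \<xi> in simp)
  qed
qed

lemma real_cond_exp_inner:
  fixes X Y :: "'w \<Rightarrow> real^'n"
  assumes "prob_space M" "subalgebra M F" and X: "integrable M X" "X \<in> borel_measurable F" and Y: "integrable M Y"
    and eq: "\<And>A. A \<in> sets F \<Longrightarrow> set_lebesgue_integral M A X = set_lebesgue_integral M A Y"
  shows "AE w in M. real_cond_exp M F (\<lambda>w. u \<bullet> Y w) w = u \<bullet> X w"
proof -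
  interpret prob_space M by fact
  interpret finite_measure_subalgebra M F by (rule prob_space_subalgebra) fact+
  show ?thesis
  proof (rule real_cond_exp_charact)
    fix A assume A: "A \<in> sets F"
    then have "A \<in> sets M" using subalg by (auto simp: subalgebra_def)
    then show "set_lebesgue_integral M A (\<lambda>w. u \<bullet> Y w) = set_lebesgue_integral M A (\<lambda>w. u \<bullet> X w)"
      using set_integral_inner[OF X(1)] set_integral_inner[OF Y] eq[OF A] by simp
  qed (use X Y in \<open>auto intro: borel_measurable_inner\<close>)
qed

text \<open>Conditional Jensen for the square, one component at a time.\<close>

lemma cond_exp_L2vec:
  fixes X Y :: "'w \<Rightarrow> real^'n"
  assumes "prob_space M" "subalgebra M F" and X: "integrable M X" "X \<in> borel_measurable F" and Y: "L2vec M Y"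
    and eq: "\<And>A. A \<in> sets F \<Longrightarrow> set_lebesgue_integral M A X = set_lebesgue_integral M A Y"
  shows "L2vec M X"
proof -
  interpret prob_space M by fact
  interpret finite_measure_subalgebra M F by (rule prob_space_subalgebra) fact+
  have iY: "integrable M Y" by (rule L2vec_integrable[OF finite_measure_axioms Y])
  have "integrable M (\<lambda>w. (X w $ i)\<^sup>2)" for i
  proof -
    have iYi: "integrable M (\<lambda>w. axis i 1 \<bullet> Y w)" using iY by (rule integrable_inner_right)
    have "integrable M (\<lambda>w. (axis i 1 \<bullet> Y w)\<^sup>2)"
    proof (rule Bochner_Integration.integrable_bound[of M "\<lambda>w. (norm (Y w))\<^sup>2"])
      show "AE w in M. norm ((axis i 1 \<bullet> Y w)\<^sup>2) \<le> norm ((norm (Y w))\<^sup>2)"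
        by (intro always_eventually allI) (simp add: inner_axis' abs_le_square_iff[symmetric] component_le_norm_cart)
    qed (use Y iYi in \<open>auto simp: L2vec_def\<close>)
    moreover have "convex_on UNIV (\<lambda>x::real. x\<^sup>2)" by (rule convex_power2)
    ultimately have "integrable M (\<lambda>w. (real_cond_exp M F (\<lambda>w. axis i 1 \<bullet> Y w) w)\<^sup>2)"
      by (intro integrable_convex_cond_exp[OF iYi, of UNIV _ _ "\<lambda>x. x\<^sup>2"]) auto
    moreover have "AE w in M. real_cond_exp M F (\<lambda>w. axis i 1 \<bullet> Y w) w = axis i 1 \<bullet> X w"
      by (rule real_cond_exp_inner[OF assms(1,2) X iY]) (rule eq)
    then have "AE w in M. (real_cond_exp M F (\<lambda>w. axis i 1 \<bullet> Y w) w)\<^sup>2 = (X w $ i)\<^sup>2"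
      by eventually_elim (simp add: inner_axis')
    ultimately show ?thesis
      using borel_measurable_power[OF measurable_vec_component[OF borel_measurable_integrable[OF X(1)]], of i 2]
      by (subst (asm) integrable_cong_AE) auto
  qed
  moreover have "(norm x)\<^sup>2 = (\<Sum>i\<in>UNIV. (x $ i)\<^sup>2)" for x :: "real^'n"
    unfolding power2_norm_eq_inner inner_vec_def by (simp add: power2_eq_square)
  ultimately show ?thesis using X(1) by (simp add: L2vec_def)
qed

lemma sigmaPG_measurable_PG:
  fixes \<xi> :: "real^'n \<Rightarrow> real^'m"
  assumes "\<xi> \<in> borel_measurable (sigmaPG S G)" "PG S G y = PG S G z"
  shows "\<xi> y = \<xi> z"
proof -
  have "\<xi> -` {\<xi> z} \<inter> space (sigmaPG S G) \<in> sets (sigmaPG S G)"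
    by (rule measurable_sets[OF assms(1)]) simp
  from sigmaPG_saturated[OF this assms(2)] show ?thesis by simp
qed

text \<open>If P_G(y) meets a ball of radius \<open>r\<close> around \<open>p\<close>, the tangent
  at \<open>p\<close> is maximal at \<open>y\<close> up to an error of order \<open>r\<close>. This
  event lies in the conditioning algebra and the inequality is affine in \<open>y\<close> and
  \<open>norm y\<close>, so it passes to conditional expectations. Letting \<open>r\<close> tend to
  \<open>0\<close> with centres approaching a point of P_G(y) removes the error.\<close>

lemma PG_subset_PG_cond_exp:
  fixes \<nu> :: "(real^'n) measure"
  assumes \<nu>: "prob_space \<nu>" "sets \<nu> = sets borel" and L: "L2vec \<nu> (\<lambda>y. y)"
    and sym: "transpose S = S" and G: "G \<in> maxmon S"
    and \<xi>: "\<xi> \<in> borel_measurable (sigmaPG S G)" "integrable \<nu> \<xi>"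
    and eq: "\<And>A. A \<in> sets (sigmaPG S G) \<Longrightarrow> set_lebesgue_integral \<nu> A \<xi> = set_lebesgue_integral \<nu> A (\<lambda>y. y)"
  shows "AE y in \<nu>. \<forall>a\<in>PG S G y. \<forall>g\<in>G. tang S g (\<xi> y) \<le> tang S a (\<xi> y)"
proof -
  interpret prob_space \<nu> by (rule \<nu>)
  define F where "F = sigmaPG S G"
  have space: "space \<nu> = UNIV" using sets_eq_imp_space_eq[OF \<nu>(2)] by simp
  have sub: "subalgebra \<nu> F"
    using sigmaPG_sub_borel[OF closed_maxmon[OF G], of S] \<nu>(2) space by (simp add: subalgebra_def F_def)
  interpret finite_measure_subalgebra \<nu> F by (rule prob_space_subalgebra[OF \<nu>(1) sub])
  have iid: "integrable \<nu> (\<lambda>y. y)" by (rule L2vec_integrable[OF finite_measure_axioms L])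
  have inorm: "integrable \<nu> (\<lambda>y. norm y)" using iid by (rule integrable_norm)
  obtain K where K: "K > 0" "\<And>x y. \<bar>Sform S x y\<bar> \<le> K * norm x * norm y" using Sform_bound[of S] by blast
  define N where "N = real_cond_exp \<nu> F norm"
  have cond: "AE y in \<nu>. real_cond_exp \<nu> F (\<lambda>y. u \<bullet> y) y = u \<bullet> \<xi> y" for u
    by (rule real_cond_exp_inner[OF \<nu>(1) sub \<xi>(2) \<xi>(1)[folded F_def] iid eq[folded F_def]])
  obtain e :: "nat \<Rightarrow> real^'n" where e: "closure (range e) = UNIV" using countable_dense_subset[of "UNIV :: (real^'n) set"] by auto
  have dense: "\<exists>k. dist (e k) x < r" if "r > 0" for x r
    using closure_approachable[of x "range e"] e that by auto
  obtain g :: "nat \<Rightarrow> real^'n" where g: "range g \<subseteq> G" "G \<subseteq> closure (range g)"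
    using countable_dense_subset[OF maxmon_nonempty[OF G]] by blast
  have step: "AE y in \<nu>. PG S G y \<inter> ball p r \<noteq> {} \<longrightarrow> tang S b (\<xi> y) \<le> tang S p (\<xi> y) + K * r * (N y + norm p + r)"
    if r: "r > 0" and b: "b \<in> G" for p r b
  proof -
    define A where "A = {y. PG S G y \<inter> ball p r \<noteq> {}}"
    have AF: "A \<in> sets F" unfolding A_def F_def by (rule sigmaPG_hit_open) simp
    have AM: "A \<in> sets \<nu>" using AF sub by (auto simp: subalgebra_def)
    define u where "u = S *v (b - p)"
    define c where "c = Sform S p p / 2 - Sform S b b / 2 - K * r * (norm p + r)"
    \<comment> \<open>The approximate inequality is \<open>h \<le> 0\<close> on \<open>A\<close>,
      arranged as a linear term, a constant and a multiple of \<open>norm y\<close>, whose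
      conditional expectations are handled separately.\<close>
    define h where "h y = u \<bullet> y + (c - K * r * norm y)" for y
    have h_eq: "h y = tang S b y - tang S p y - K * r * (norm y + norm p + r)" for y
      unfolding h_def u_def c_def by (simp add: Sform_eq_inner[OF sym, symmetric] Sform_simps algebra_simps)
    have i1: "integrable \<nu> (\<lambda>y. u \<bullet> y)" using iid by (rule integrable_inner_right)
    have i2: "integrable \<nu> (\<lambda>y. c - K * r * norm y)" using inorm by auto
    have ih: "integrable \<nu> h" unfolding h_def by (intro Bochner_Integration.integrable_add i1 i2)
    have iAh: "integrable \<nu> (\<lambda>y. indicator A y * h y)" using integrable_mult_indicator[OF AM ih] by simp
    have le0: "indicator A y * h y \<le> 0" for y
    proof (cases "y \<in> A")
      case True
      then obtain a where a: "a \<in> PG S G y" "norm (a - p) < r" unfolding A_def by (auto simp: dist_norm norm_minus_commute)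
      have "tang S b y \<le> tang S a y" using a b by (simp add: PG_iff)
      also have "tang S a y = tang S p y + Sform S (a - p) y - Sform S (a - p) p - Sform S (a - p) (a - p) / 2"
        using Sform_commute[OF sym, of p a] by (simp add: Sform_simps field_simps)
      also have "\<dots> \<le> tang S p y + K * r * norm y + K * r * norm p + K * r * r"
      proof -
        have le: "\<bar>Sform S (a - p) v\<bar> \<le> K * r * norm v" for v
          by (rule order_trans[OF K(2)]) (use a K(1) in \<open>auto intro!: mult_right_mono mult_left_mono\<close>)
        have "K * r * norm (a - p) \<le> K * r * r" using a K(1) r by (intro mult_left_mono) auto
        then have "\<bar>Sform S (a - p) (a - p)\<bar> \<le> K * r * r" using le[of "a - p"] by linarith
        moreover have "0 \<le> K * r * r" using K(1) r by simp
        ultimately show ?thesis using le[of y] le[of p] by linarith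
      qed
      finally have "h y \<le> 0" unfolding h_eq by (simp add: algebra_simps)
      then show ?thesis using True by simp
    qed simp
    have "AE y in \<nu>. real_cond_exp \<nu> F (\<lambda>y. indicator A y * h y) y \<le> 0"
      by (rule real_cond_exp_le_c[OF iAh]) (use le0 in auto)
    moreover have "AE y in \<nu>. real_cond_exp \<nu> F (\<lambda>y. indicator A y * h y) y = indicator A y * real_cond_exp \<nu> F h y"
      by (rule real_cond_exp_mult) (use AF ih iAh in auto)
    moreover have "AE y in \<nu>. real_cond_exp \<nu> F h y = real_cond_exp \<nu> F (\<lambda>y. u \<bullet> y) y + real_cond_exp \<nu> F (\<lambda>y. c - K * r * norm y) y"
      unfolding h_def by (rule real_cond_exp_add[OF i1 i2])
    moreover have "AE y in \<nu>. real_cond_exp \<nu> F (\<lambda>y. c - K * r * norm y) y = real_cond_exp \<nu> F (\<lambda>y. c) y - real_cond_exp \<nu> F (\<lambda>y. K * r * norm y) y"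
      by (rule real_cond_exp_diff) (use inorm in auto)
    moreover have "AE y in \<nu>. real_cond_exp \<nu> F (\<lambda>y. c) y = c" by (rule real_cond_exp_F_meas) auto
    moreover have "AE y in \<nu>. real_cond_exp \<nu> F (\<lambda>y. K * r * norm y) y = K * r * N y"
      unfolding N_def by (rule real_cond_exp_cmult[OF inorm])
    ultimately show ?thesis
      using cond[of u]
    proof eventually_elim
      case (elim y)
      show ?case
      proof
        assume "PG S G y \<inter> ball p r \<noteq> {}"
        then have "indicat_real A y = 1" by (simp add: A_def)
        then have "u \<bullet> \<xi> y + (c - K * r * N y) \<le> 0" using elim by simp
        moreover have "u \<bullet> \<xi> y + c = tang S b (\<xi> y) - tang S p (\<xi> y) - K * r * (norm p + r)"
          unfolding u_def c_def by (simp add: Sform_eq_inner[OF sym, symmetric] Sform_simps)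
        ultimately show "tang S b (\<xi> y) \<le> tang S p (\<xi> y) + K * r * (N y + norm p + r)" by (simp add: algebra_simps)
      qed
    qed
  qed
  define r where "r n = inverse (real (Suc n))" for n
  have r0: "0 < r n" for n by (simp add: r_def)
  have "AE y in \<nu>. \<forall>n i k. PG S G y \<inter> ball (e i) (r n) \<noteq> {} \<longrightarrow>
      tang S (g k) (\<xi> y) \<le> tang S (e i) (\<xi> y) + K * r n * (N y + norm (e i) + r n)"
    by (intro AE_all_countable[THEN iffD2] allI step[OF r0]) (use g(1) in blast)
  then show ?thesis
  proof eventually_elim
    case (elim y)
    show ?case
    proof (intro ballI)
      fix a b assume a: "a \<in> PG S G y" and b: "b \<in> G"
      have "\<forall>n. \<exists>i. dist (e i) a < r n" using dense r0 by blast
      then obtain i where i: "\<And>n. dist (e (i n)) a < r n" by metis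
      have rl: "r \<longlonglongrightarrow> 0" unfolding r_def by (rule LIMSEQ_inverse_real_of_nat)
      have el: "(\<lambda>n. e (i n)) \<longlonglongrightarrow> a"
        by (rule metric_tendsto_imp_tendsto[OF rl]) (use i r0 in \<open>auto simp: less_imp_le intro!: always_eventually\<close>)
      have k: "tang S (g k) (\<xi> y) \<le> tang S a (\<xi> y)" for k
      proof (rule LIMSEQ_le_const)
        have "(\<lambda>n. tang S (e (i n)) (\<xi> y) + K * r n * (N y + norm (e (i n)) + r n)) \<longlonglongrightarrow> tang S a (\<xi> y) + K * 0 * (N y + norm a + 0)"
          by (intro tendsto_intros el rl) auto
        then show "(\<lambda>n. tang S (e (i n)) (\<xi> y) + K * r n * (N y + norm (e (i n)) + r n)) \<longlonglongrightarrow> tang S a (\<xi> y)" by simp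
        have "tang S (g k) (\<xi> y) \<le> tang S (e (i n)) (\<xi> y) + K * r n * (N y + norm (e (i n)) + r n)" for n
        proof -
          have "a \<in> ball (e (i n)) (r n)" using i by simp
          then have "PG S G y \<inter> ball (e (i n)) (r n) \<noteq> {}" using a by blast
          then show ?thesis using elim by blast
        qed
        then show "\<exists>M. \<forall>n\<ge>M. tang S (g k) (\<xi> y) \<le> tang S (e (i n)) (\<xi> y) + K * r n * (N y + norm (e (i n)) + r n)" by blast
      qed
      have "b \<in> closure (range g)" using b g(2) by blast
      moreover have "continuous_on UNIV (\<lambda>a. tang S a (\<xi> y))" by (intro continuous_intros) auto
      ultimately show "tang S b (\<xi> y) \<le> tang S a (\<xi> y)" by (rule closure_le) (use k in auto)
    qed
  qed
qed

section \<open>Optimal maps\<close>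

lemma eexpect_eq_integral:
  assumes \<Psi>: "integrable M \<Psi>" and f: "AE w in M. f w = ereal (\<Psi> w)"
  shows "eexpect M f = ereal (\<integral>w. \<Psi> w \<partial>M)"
proof -
  have 1: "(\<integral>\<^sup>+w. e2ennreal (f w) \<partial>M) = (\<integral>\<^sup>+w. ennreal (\<Psi> w) \<partial>M)"
    using f by (intro nn_integral_cong_AE) (auto elim!: eventually_mono simp: e2ennreal_ereal)
  have 2: "(\<integral>\<^sup>+w. e2ennreal (- f w) \<partial>M) = (\<integral>\<^sup>+w. ennreal (- \<Psi> w) \<partial>M)"
    using f by (intro nn_integral_cong_AE) (auto elim!: eventually_mono simp: e2ennreal_ereal)
  obtain r q where "0 \<le> r" "0 \<le> q" "(\<integral>\<^sup>+w. ennreal (\<Psi> w) \<partial>M) = ennreal r" "(\<integral>\<^sup>+w. ennreal (- \<Psi> w) \<partial>M) = ennreal q"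
    "(\<integral>w. \<Psi> w \<partial>M) = r - q"
    using integrableE[OF \<Psi>] by metis
  then show ?thesis unfolding eexpect_def 1 2 by simp
qed

text \<open>The lower bound \<open>q\<close> makes the negative part integrable, so no difference of
  infinities occurs and finiteness passes to the positive part.\<close>

lemma eexpect_finiteD:
  assumes f: "f \<in> borel_measurable M" and q: "integrable M q" "AE w in M. ereal (q w) \<le> f w" and fin: "eexpect M f < \<infinity>"
  shows "\<exists>\<Psi>. integrable M \<Psi> \<and> (AE w in M. f w = ereal (\<Psi> w))"
proof -
  have "(\<integral>\<^sup>+w. e2ennreal (- f w) \<partial>M) \<le> (\<integral>\<^sup>+w. ennreal (- q w) \<partial>M)"
  proof (rule nn_integral_mono_AE)
    show "AE w in M. e2ennreal (- f w) \<le> ennreal (- q w)"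
      using q(2)
    proof eventually_elim
      case (elim w)
      then have "- f w \<le> ereal (- q w)" by (metis ereal_minus_le_minus uminus_ereal.simps(1))
      then show ?case using e2ennreal_mono by (metis e2ennreal_ereal)
    qed
  qed
  moreover have "(\<integral>\<^sup>+w. ennreal (- q w) \<partial>M) \<noteq> \<infinity>" using q(1) by (auto simp: real_integrable_def)
  ultimately have neg: "(\<integral>\<^sup>+w. e2ennreal (- f w) \<partial>M) \<noteq> \<infinity>" by (auto simp: top_unique)
  have pos: "(\<integral>\<^sup>+w. e2ennreal (f w) \<partial>M) \<noteq> \<infinity>"
    using fin neg unfolding eexpect_def by (auto simp: less_top[symmetric] enn2ereal_eq_top_iff)
  have fe: "(\<lambda>w. e2ennreal (f w)) \<in> borel_measurable M" using f by measurable
  have "AE w in M. e2ennreal (f w) \<noteq> \<infinity>" by (rule nn_integral_PInf_AE[OF fe pos])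
  then have eq: "AE w in M. f w = ereal (real_of_ereal (f w))"
    using q(2)
  proof eventually_elim
    case (elim w)
    then show ?case by (cases "f w") (auto simp: e2ennreal_infty)
  qed
  have 1: "(\<integral>\<^sup>+w. e2ennreal (f w) \<partial>M) = (\<integral>\<^sup>+w. ennreal (real_of_ereal (f w)) \<partial>M)"
    using eq by (intro nn_integral_cong_AE) (auto elim!: eventually_mono, metis e2ennreal_ereal)
  have 2: "(\<integral>\<^sup>+w. e2ennreal (- f w) \<partial>M) = (\<integral>\<^sup>+w. ennreal (- real_of_ereal (f w)) \<partial>M)"
    using eq by (intro nn_integral_cong_AE) (auto elim!: eventually_mono, metis e2ennreal_ereal uminus_ereal.simps(1))
  have "integrable M (\<lambda>w. real_of_ereal (f w))"
    using f pos neg unfolding real_integrable_def 1 2 by simp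
  then show ?thesis using eq by blast
qed

lemma eexpect_le_integral:
  assumes f: "f \<in> borel_measurable M" and q: "integrable M q" "AE w in M. ereal (q w) \<le> f w"
    and \<Phi>: "integrable M \<Phi>" "AE w in M. f w \<le> ereal (\<Phi> w)"
  shows "eexpect M f \<le> ereal (\<integral>w. \<Phi> w \<partial>M)"
proof -
  have eq: "AE w in M. f w = ereal (real_of_ereal (f w)) \<and> q w \<le> real_of_ereal (f w) \<and> real_of_ereal (f w) \<le> \<Phi> w"
    using q(2) \<Phi>(2)
  proof eventually_elim
    case (elim w)
    then show ?case by (cases "f w") auto
  qed
  have i: "integrable M (\<lambda>w. real_of_ereal (f w))"
  proof (rule Bochner_Integration.integrable_bound[of M "\<lambda>w. \<bar>q w\<bar> + \<bar>\<Phi> w\<bar>"])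
    show "AE w in M. norm (real_of_ereal (f w)) \<le> norm (\<bar>q w\<bar> + \<bar>\<Phi> w\<bar>)"
      using eq
    proof eventually_elim
      case (elim w)
      then have "\<bar>real_of_ereal (f w)\<bar> \<le> \<bar>\<bar>q w\<bar> + \<bar>\<Phi> w\<bar>\<bar>" by linarith
      then show ?case by (simp only: real_norm_def)
    qed
  qed (use f q \<Phi> in auto)
  have "eexpect M f = ereal (\<integral>w. real_of_ereal (f w) \<partial>M)"
    by (rule eexpect_eq_integral[OF i]) (use eq in \<open>eventually_elim; simp\<close>)
  moreover have "(\<integral>w. real_of_ereal (f w) \<partial>M) \<le> (\<integral>w. \<Phi> w \<partial>M)"
    by (rule integral_mono_AE[OF i \<Phi>(1)]) (use eq in \<open>eventually_elim; simp\<close>)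
  ultimately show ?thesis by simp
qed

lemma eexpect_distr:
  assumes "Y \<in> measurable M N" "f \<in> borel_measurable N"
  shows "eexpect (distr M N Y) f = eexpect M (\<lambda>w. f (Y w))"
proof -
  have "(\<lambda>y. e2ennreal (f y)) \<in> borel_measurable N" "(\<lambda>y. e2ennreal (- f y)) \<in> borel_measurable N"
    using assms(2) by measurable
  then show ?thesis unfolding eexpect_def using assms(1) by (simp add: nn_integral_distr)
qed

lemma psiG_measurable:
  assumes "G \<noteq> {}"
  shows "psiG S G \<in> borel_measurable borel"
proof -
  obtain g :: "nat \<Rightarrow> real^'a" where g: "range g \<subseteq> G" "G \<subseteq> closure (range g)"
    using countable_dense_subset[OF assms] by blast
  have "psiG S G y = (SUP k. ereal (tang S (g k) y))" for y
  proof (rule antisym)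
    show "(SUP k. ereal (tang S (g k) y)) \<le> psiG S G y"
      unfolding psiG_def using g(1) by (intro SUP_least SUP_upper) auto
    show "psiG S G y \<le> (SUP k. ereal (tang S (g k) y))"
      unfolding psiG_def
    proof (rule SUP_least)
      fix x assume x: "x \<in> G"
      define s where "s = (SUP k. ereal (tang S (g k) y))"
      have le: "ereal (tang S (g k) y) \<le> s" for k unfolding s_def by (rule SUP_upper) simp
      have "ereal (tang S x y) \<le> s"
      proof (cases s)
        case (real c)
        have xc: "x \<in> closure (range g)" using x g(2) by blast
        have ct: "continuous_on UNIV (\<lambda>a. tang S a y)" by (intro continuous_intros) auto
        have "tang S x y \<le> c" by (rule closure_le[OF xc ct]) (use le real in auto)
        then show ?thesis using real by simp
      next
        case MInf
        then show ?thesis using le[of 0] by simp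
      qed simp
      then show "ereal (tang S x y) \<le> (SUP k. ereal (tang S (g k) y))" unfolding s_def .
    qed
  qed
  moreover have "(\<lambda>y. SUP k. ereal (tang S (g k) y)) \<in> borel_measurable borel"
  proof (rule borel_measurable_SUP)
    fix k
    have "(\<lambda>y. tang S (g k) y) \<in> borel_measurable borel" by (intro borel_measurable_continuous_onI continuous_intros) auto
    then show "(\<lambda>y. ereal (tang S (g k) y)) \<in> borel_measurable borel" by measurable
  qed auto
  ultimately show ?thesis by presburger
qed

lemma psiG_ge:
  assumes "transpose S = S" "G \<in> maxmon S"
  shows "ereal (Sform S y y / 2) \<le> psiG S G y"
proof -
  obtain g where g: "g \<in> G" "Sform S y y / 2 \<le> tang S g y" using maxmon_tang_above[OF assms] by blast
  then have "ereal (Sform S y y / 2) \<le> ereal (tang S g y)" by simp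
  also have "\<dots> \<le> psiG S G y" unfolding psiG_def using g(1) by (rule SUP_upper)
  finally show ?thesis .
qed

text \<open>The set obtained from the optimal plan competes in the dual problem with a value at most
  the primal one. An optimal \<open>G\<close> does no worse, so psi_G has a finite integral, and
  \<open>\<Psi>\<close> is its real-valued version.\<close>

lemma dual_attained:
  fixes \<nu> :: "(real^'n) measure"
  assumes \<nu>: "sets \<nu> = sets borel" and L: "L2vec \<nu> (\<lambda>y. y)"
    and sym: "transpose S = S" and dual: "dual_optimal \<nu> S G" and opt: "optimal_plan \<nu> S \<gamma>"
  shows "\<exists>\<Psi>. integrable \<nu> \<Psi> \<and> (AE y in \<nu>. \<forall>x\<in>G. tang S x y \<le> \<Psi> y) \<and>
    (\<integral>y. \<Psi> y \<partial>\<nu>) \<le> (\<integral>p. Sform S (fst p) (fst p) / 2 \<partial>\<gamma>)"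
proof -
  have G: "G \<in> maxmon S" and min: "\<And>G'. G' \<in> maxmon S \<Longrightarrow> eexpect \<nu> (psiG S G) \<le> eexpect \<nu> (psiG S G')"
    using dual unfolding dual_optimal_def by auto
  have \<gamma>: "\<gamma> \<in> Gamma \<nu>" using opt by (simp add: optimal_plan_def)
  note LL = GammaD(3,4)[OF \<gamma>]
  have sndm: "snd \<in> borel_measurable \<gamma>" using LL by (simp add: L2vec_def)
  obtain G' where G': "G' \<in> maxmon S" and AE: "AE p in \<gamma>. \<forall>x\<in>G'. tang S x (snd p) \<le> tang S (fst p) (snd p)"
    using optimal_plan_dual[OF sym opt] by blast
  have m: "psiG S H \<in> borel_measurable borel" if "H \<in> maxmon S" for H
    by (rule psiG_measurable[OF maxmon_nonempty[OF that]])
  have "eexpect \<nu> (psiG S G') = eexpect \<gamma> (\<lambda>p. psiG S G' (snd p))"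
    unfolding GammaD(5)[OF \<gamma>, symmetric] by (rule eexpect_distr[OF sndm m[OF G']])
  also have "\<dots> \<le> ereal (\<integral>p. tang S (fst p) (snd p) \<partial>\<gamma>)"
  proof (rule eexpect_le_integral)
    show "(\<lambda>p. psiG S G' (snd p)) \<in> borel_measurable \<gamma>" by (rule measurable_compose[OF sndm m[OF G']])
    show "integrable \<gamma> (\<lambda>p. Sform S (snd p) (snd p) / 2)" using L2vec_Sform[OF LL(2,2)] by simp
    show "AE p in \<gamma>. ereal (Sform S (snd p) (snd p) / 2) \<le> psiG S G' (snd p)"
      by (intro always_eventually allI psiG_ge[OF sym G'])
    show "integrable \<gamma> (\<lambda>p. tang S (fst p) (snd p))" using L2vec_Sform[OF LL] L2vec_Sform[OF LL(1,1)] by simp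
    show "AE p in \<gamma>. psiG S G' (snd p) \<le> ereal (tang S (fst p) (snd p))"
      using AE by eventually_elim (auto simp: psiG_def intro!: SUP_least)
  qed
  also have "(\<integral>p. tang S (fst p) (snd p) \<partial>\<gamma>) = (\<integral>p. Sform S (fst p) (fst p) / 2 \<partial>\<gamma>)"
    using L2vec_Sform[OF LL] L2vec_Sform[OF LL(1,1)] Gamma_Sform_eq[OF \<gamma> sym] by simp
  finally have le: "eexpect \<nu> (psiG S G) \<le> ereal (\<integral>p. Sform S (fst p) (fst p) / 2 \<partial>\<gamma>)"
    using min[OF G'] by (rule order_trans[rotated])
  have "\<exists>\<Psi>. integrable \<nu> \<Psi> \<and> (AE y in \<nu>. psiG S G y = ereal (\<Psi> y))"
  proof (rule eexpect_finiteD)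
    show "psiG S G \<in> borel_measurable \<nu>" using m[OF G] unfolding measurable_cong_sets[OF \<nu> refl] .
    show "integrable \<nu> (\<lambda>y. Sform S y y / 2)" using L2vec_Sform[OF L L] by simp
    show "AE y in \<nu>. ereal (Sform S y y / 2) \<le> psiG S G y" by (intro always_eventually allI psiG_ge[OF sym G])
    show "eexpect \<nu> (psiG S G) < \<infinity>" using le by (rule le_less_trans) simp
  qed
  then obtain \<Psi> where \<Psi>: "integrable \<nu> \<Psi>" "AE y in \<nu>. psiG S G y = ereal (\<Psi> y)" by blast
  have "(\<integral>y. \<Psi> y \<partial>\<nu>) \<le> (\<integral>p. Sform S (fst p) (fst p) / 2 \<partial>\<gamma>)"
    using le unfolding eexpect_eq_integral[OF \<Psi>] by simp
  moreover have "AE y in \<nu>. \<forall>x\<in>G. tang S x y \<le> \<Psi> y"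
    using \<Psi>(2)
  proof eventually_elim
    case (elim y)
    show ?case
    proof
      fix x assume "x \<in> G"
      then have "ereal (tang S x y) \<le> psiG S G y" unfolding psiG_def by (rule SUP_upper)
      then show "tang S x y \<le> \<Psi> y" unfolding elim by simp
    qed
  qed
  ultimately show ?thesis using \<Psi>(1) by blast
qed

lemma optimal_plan_mem_PG:
  fixes \<nu> :: "(real^'n) measure"
  assumes "sets \<nu> = sets borel" "L2vec \<nu> (\<lambda>y. y)" and sym: "transpose S = S"
    and dual: "dual_optimal \<nu> S G" and opt: "optimal_plan \<nu> S \<gamma>"
  shows "AE p in \<gamma>. fst p \<in> PG S G (snd p)"
proof -
  have G: "G \<in> maxmon S" using dual by (simp add: dual_optimal_def)
  have \<gamma>: "\<gamma> \<in> Gamma \<nu>" using opt by (simp add: optimal_plan_def)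
  obtain \<Psi> where "integrable \<nu> \<Psi>" "AE y in \<nu>. \<forall>x\<in>G. tang S x y \<le> \<Psi> y"
    "(\<integral>y. \<Psi> y \<partial>\<nu>) \<le> (\<integral>p. Sform S (fst p) (fst p) / 2 \<partial>\<gamma>)"
    using dual_attained[OF assms] by blast
  then show ?thesis by (rule weak_duality(2)[OF sym G \<gamma>])
qed

text \<open>The points of \<open>P(y)\<close> stay optimal at \<open>\<xi>(y)\<close>, so \<open>S(\<xi>,\<xi>)/2\<close> is at most the tangent at \<open>x\<close> evaluated in
  \<open>\<xi>\<close>; since \<open>\<xi>\<close> is the conditional expectation of both \<open>x\<close> and \<open>y\<close>, integration gives the claim.\<close>
lemma cond_exp_PG_value:
  fixes \<nu> :: "(real^'n) measure"
  assumes \<nu>: "prob_space \<nu>" "sets \<nu> = sets borel" and L: "L2vec \<nu> (\<lambda>y. y)"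
    and sym: "transpose S = S" and G: "G \<in> maxmon S"
    and \<xi>: "\<xi> \<in> borel_measurable (sigmaPG S G)" "L2vec \<nu> \<xi>"
    and eq: "\<And>A. A \<in> sets (sigmaPG S G) \<Longrightarrow> set_lebesgue_integral \<nu> A \<xi> = set_lebesgue_integral \<nu> A (\<lambda>y. y)"
    and \<gamma>: "\<gamma> \<in> Gamma \<nu>" and mem: "AE p in \<gamma>. fst p \<in> PG S G (snd p)" and same: "AE p in \<gamma>. PG S G (fst p) = PG S G (snd p)"
  shows "(\<integral>p. Sform S (fst p) (fst p) \<partial>\<gamma>) \<le> (\<integral>y. Sform S (\<xi> y) (\<xi> y) \<partial>\<nu>)"
proof -
  interpret prob_space \<nu> by (rule \<nu>)
  note LL = GammaD(3,4)[OF \<gamma>]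
  have fstm: "fst \<in> borel_measurable \<gamma>" and sndm: "snd \<in> borel_measurable \<gamma>" using LL by (auto simp: L2vec_def)
  have sb: "sets (sigmaPG S G) \<subseteq> sets borel" by (rule sigmaPG_sub_borel[OF closed_maxmon[OF G]])
  have \<xi>b: "\<xi> \<in> borel_measurable borel"
    using \<xi>(1) sb unfolding measurable_def by auto
  have sub: "subalgebra \<nu> (sigmaPG S G)"
    using sb \<nu>(2) sets_eq_imp_space_eq[OF \<nu>(2)] by (simp add: subalgebra_def)
  have L\<xi>s: "L2vec \<gamma> (\<lambda>p. \<xi> (snd p))"
    using \<xi>(2) unfolding GammaD(5)[OF \<gamma>, symmetric] L2vec_distr[OF sndm \<xi>b] .
  \<comment> \<open>This allows \<open>\<xi>\<close> to be read as a function of \<open>x\<close> as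
    well as of \<open>y\<close>, so that it can be tested both against the martingale property of
    \<open>\<gamma>\<close> and against the conditional expectation in \<open>\<nu>\<close>.\<close>
  have eq\<xi>: "AE p in \<gamma>. \<xi> (fst p) = \<xi> (snd p)"
    using same by eventually_elim (rule sigmaPG_measurable_PG[OF \<xi>(1)])
  have L\<xi>f: "L2vec \<gamma> (\<lambda>p. \<xi> (fst p))"
    by (rule L2vec_le[OF L\<xi>s measurable_compose[OF fstm \<xi>b]]) (use eq\<xi> in \<open>eventually_elim; simp\<close>)
  have S\<xi>b: "(\<lambda>x. S *v \<xi> x) \<in> borel_measurable borel"
    by (rule measurable_matrix_vector[OF \<xi>b])
  have S\<xi>F: "(\<lambda>x. S *v \<xi> x) \<in> borel_measurable (sigmaPG S G)"
    by (rule measurable_matrix_vector[OF \<xi>(1)])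
  have int_snd: "(\<integral>p. h (snd p) \<partial>\<gamma>) = (\<integral>y. h y \<partial>\<nu>)" if "h \<in> borel_measurable borel" for h :: "real^'n \<Rightarrow> real"
    unfolding GammaD(5)[OF \<gamma>, symmetric] using that by (intro integral_distr[symmetric] sndm)
  have "(\<integral>p. Sform S (fst p) (\<xi> (snd p)) \<partial>\<gamma>) = (\<integral>p. (S *v \<xi> (fst p)) \<bullet> fst p \<partial>\<gamma>)"
  proof (rule integral_cong_AE)
    show "AE p in \<gamma>. Sform S (fst p) (\<xi> (snd p)) = (S *v \<xi> (fst p)) \<bullet> fst p"
      using eq\<xi> by eventually_elim (simp add: Sform_def inner_commute)
  qed (use L2vec_Sform[OF LL(1) L\<xi>s, of S] L2vec_inner[OF L2vec_matrix[OF L\<xi>f] LL(1), of S] in auto)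
  also have "\<dots> = (\<integral>p. (S *v \<xi> (fst p)) \<bullet> snd p \<partial>\<gamma>)"
    by (rule Gamma_test[OF \<gamma> S\<xi>b L2vec_matrix[OF L\<xi>f]])
  also have "\<dots> = (\<integral>p. (S *v \<xi> (snd p)) \<bullet> snd p \<partial>\<gamma>)"
  proof (rule integral_cong_AE)
    show "AE p in \<gamma>. (S *v \<xi> (fst p)) \<bullet> snd p = (S *v \<xi> (snd p)) \<bullet> snd p" using eq\<xi> by eventually_elim simp
  qed (use L2vec_inner[OF L2vec_matrix[OF L\<xi>s] LL(2), of S] L2vec_inner[OF L2vec_matrix[OF L\<xi>f] LL(2), of S] in auto)
  also have "\<dots> = (\<integral>y. (S *v \<xi> y) \<bullet> y \<partial>\<nu>)" by (rule int_snd) (intro borel_measurable_inner S\<xi>b, simp)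
  also have "\<dots> = (\<integral>y. (S *v \<xi> y) \<bullet> \<xi> y \<partial>\<nu>)"
    by (rule cond_exp_test[OF \<nu>(1) sub \<xi>(2) L eq L2vec_matrix[OF \<xi>(2)] S\<xi>F, symmetric])
  finally have cross: "(\<integral>p. Sform S (fst p) (\<xi> (snd p)) \<partial>\<gamma>) = (\<integral>y. Sform S (\<xi> y) (\<xi> y) \<partial>\<nu>)"
    by (simp add: Sform_eq_inner[OF sym])
  have self: "(\<integral>p. Sform S (\<xi> (snd p)) (\<xi> (snd p)) \<partial>\<gamma>) = (\<integral>y. Sform S (\<xi> y) (\<xi> y) \<partial>\<nu>)"
    by (rule int_snd) (intro measurable_Sform \<xi>b)
  have "AE y in \<nu>. \<forall>a\<in>PG S G y. \<forall>g\<in>G. tang S g (\<xi> y) \<le> tang S a (\<xi> y)"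
    by (rule PG_subset_PG_cond_exp[OF \<nu> L sym G \<xi>(1) L2vec_integrable[OF finite_measure_axioms \<xi>(2)] eq])
  then have "AE p in \<gamma>. \<forall>a\<in>PG S G (snd p). \<forall>g\<in>G. tang S g (\<xi> (snd p)) \<le> tang S a (\<xi> (snd p))"
    unfolding GammaD(5)[OF \<gamma>, symmetric] by (rule AE_distrD[OF sndm])
  \<comment> \<open>Some tangent from \<open>G\<close> reaches the form at \<open>\<xi>\<close>, and
    the tangent at \<open>x\<close> is at least as large there because \<open>x\<close> belongs to
    P_G(y).\<close>
  then have "AE p in \<gamma>. Sform S (\<xi> (snd p)) (\<xi> (snd p)) / 2 \<le> tang S (fst p) (\<xi> (snd p))"
    using mem
  proof eventually_elim
    case (elim p)
    obtain g where "g \<in> G" "Sform S (\<xi> (snd p)) (\<xi> (snd p)) / 2 \<le> tang S g (\<xi> (snd p))"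
      using maxmon_tang_above[OF sym G] by blast
    then show ?case using elim by fastforce
  qed
  then have "(\<integral>p. Sform S (\<xi> (snd p)) (\<xi> (snd p)) / 2 \<partial>\<gamma>) \<le> (\<integral>p. tang S (fst p) (\<xi> (snd p)) \<partial>\<gamma>)"
    by (intro integral_mono_AE) (use L2vec_Sform[OF L\<xi>s L\<xi>s] L2vec_Sform[OF LL(1) L\<xi>s] L2vec_Sform[OF LL(1,1)] in auto)
  also have "\<dots> = (\<integral>p. Sform S (fst p) (\<xi> (snd p)) \<partial>\<gamma>) - (\<integral>p. Sform S (fst p) (fst p) \<partial>\<gamma>) / 2"
    using L2vec_Sform[OF LL(1) L\<xi>s] L2vec_Sform[OF LL(1,1)] by simp
  finally show ?thesis unfolding cross using self by simp
qed

theorem theorem4: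
  fixes M :: "'w measure" and S :: "real^'n^'n" and m :: nat and Y :: "'w \<Rightarrow> real^'n"
  assumes "prob_space M"
    and "S \<in> SymInv m"
    and "L2vec M Y"
    and "interior (convex hull (msupp (distr M borel Y))) \<noteq> {}"
    and A1: "\<forall>j C h. compact C \<longrightarrow> C \<subseteq> {x. x $ j = 1 \<and> Sform S x x > 0} \<longrightarrow> h \<in> Hclass j C
               \<longrightarrow> (AE w in M. h (S *v Y w) \<noteq> 0)"
  shows "(\<forall>G\<in>maxmon S. eexpect M (\<lambda>w. psiG S G (Y w)) < \<infinity> \<longrightarrow>
            Sigma1P S G \<in> null_sets (completion (distr M borel Y)))
       \<and> (\<forall>G X. dual_optimal (distr M borel Y) S G \<longrightarrow>
            is_cond_exp M (vimage_algebra (space M) Y (sigmaPG S G)) Y X \<longrightarrow>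
              optimal_map M S Y X
            \<and> optimal_plan (distr M borel Y) S (distr M borel (\<lambda>w. (X w, Y w)))
            \<and> (\<forall>Z. L2vec M Z \<and> optimal_plan (distr M borel Y) S (distr M borel (\<lambda>w. (Z w, Y w))) \<longrightarrow>
                  (AE w in M. Z w \<in> PG S G (Z w) \<and> PG S G (Z w) = PG S G (Y w))
                \<and> (\<exists>X'. X' \<in> measurable (vimage_algebra (space M) Z borel) borel \<and> (AE w in M. X w = X' w))
                \<and> is_cond_exp M (vimage_algebra (space M) X borel) Z X
                \<and> (AE w in M. Sform S (Z w - X w) (Z w - X w) = 0)))"
proof -
  interpret M: prob_space M by (rule assms(1))
  have sym: "transpose S = S" using assms(2) by (simp add: SymInv_def)
  note LY = assms(3)
  have Ym: "Y \<in> borel_measurable M" by (rule L2vec_measurable[OF LY])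
  define \<nu> where "\<nu> = distr M borel Y"
  have \<nu>: "prob_space \<nu>" "sets \<nu> = sets borel" unfolding \<nu>_def by (simp_all add: M.prob_space_distr[OF Ym])
  have L: "L2vec \<nu> (\<lambda>y. y)" unfolding \<nu>_def using L2vec_distr[OF Ym, of "\<lambda>y. y"] LY by simp
  have negl: "\<exists>N\<in>null_sets \<nu>. Sigma1P S G \<subseteq> N" if G: "G \<in> maxmon S" for G
  proof (rule Sigma1P_negligible[OF sym G \<nu>(2)])
    fix j :: 'n and C :: "(real^'n) set" and h :: "real^'n \<Rightarrow> real"
    assume h: "compact C" "C \<subseteq> {x. x $ j = 1 \<and> Sform S x x > 0}" "h \<in> Hclass j C"
    have m: "(\<lambda>y. h (S *v y)) \<in> borel_measurable borel"
      by (intro borel_measurable_continuous_onI continuous_on_compose2[OF Hclass_continuous[OF h(3)]]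
          linear_continuous_on matrix_vector_mul_bounded_linear) auto
    have "{y \<in> space borel. h (S *v y) \<noteq> 0} \<in> sets borel" using m by measurable
    moreover have "AE w in M. h (S *v Y w) \<noteq> 0" using A1 h by blast
    ultimately show "AE y in \<nu>. h (S *v y) \<noteq> 0" unfolding \<nu>_def by (subst AE_distr_iff[OF Ym]) simp_all
  qed
  \<comment> \<open>The singular set is only enclosed in a Borel null set, whence the
    completion.\<close>
  have part1: "Sigma1P S G \<in> null_sets (completion \<nu>)" if G: "G \<in> maxmon S" for G
    using negl[OF G] null_sets_completionI null_sets_completion_subset by metis
  have part2: "optimal_map M S Y X
            \<and> optimal_plan \<nu> S (distr M borel (\<lambda>w. (X w, Y w)))
            \<and> (\<forall>Z. L2vec M Z \<and> optimal_plan \<nu> S (distr M borel (\<lambda>w. (Z w, Y w))) \<longrightarrow>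
                  (AE w in M. Z w \<in> PG S G (Z w) \<and> PG S G (Z w) = PG S G (Y w))
                \<and> (\<exists>X'. X' \<in> measurable (vimage_algebra (space M) Z borel) borel \<and> (AE w in M. X w = X' w))
                \<and> is_cond_exp M (vimage_algebra (space M) X borel) Z X
                \<and> (AE w in M. Sform S (Z w - X w) (Z w - X w) = 0))"
    if dual: "dual_optimal \<nu> S G" and cond: "is_cond_exp M (vimage_algebra (space M) Y (sigmaPG S G)) Y X" for G X
  proof -
    have G: "G \<in> maxmon S" using dual by (simp add: dual_optimal_def)
    \<comment> \<open>The form in which the first part enters the second: almost surely all
      differences within P_G(Y) are isotropic.\<close>
    have iso: "AE y in \<nu>. \<forall>a\<in>PG S G y. \<forall>b\<in>PG S G y. Sform S (a - b) (a - b) = 0"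
    proof -
      obtain N where N: "N \<in> null_sets \<nu>" "Sigma1P S G \<subseteq> N" using negl[OF G] by blast
      show ?thesis
        using AE_not_in[OF N(1)]
      proof eventually_elim
        case (elim y)
        then have y: "y \<notin> Sigma1P S G" using N(2) by blast
        show ?case
        proof (intro ballI)
          fix a b assume ab: "a \<in> PG S G y" "b \<in> PG S G y"
          have ge: "0 \<le> Sform S (a - b) (a - b)" using maxmon_monotone[OF G] ab by (simp add: PG_iff)
          show "Sform S (a - b) (a - b) = 0"
          proof (cases "a = b")
            case False
            then have "y \<in> SigmaP S G" using ab unfolding SigmaP_def by fastforce
            then have "\<not> Sform S (a - b) (a - b) > 0" using y ab unfolding Sigma1P_def by blast
            then show ?thesis using ge by linarith
          qed (simp add: Sform_simps)
        qed
      qed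
    qed
    define F where "F = vimage_algebra (space M) Y (sigmaPG S G)"
    have sb: "sets (sigmaPG S G) \<subseteq> sets borel" by (rule sigmaPG_sub_borel[OF closed_maxmon[OF G]])
    have YF: "Y \<in> measurable M (sigmaPG S G)"
      using Ym sb unfolding measurable_def by auto
    have subF: "subalgebra M F" unfolding F_def by (rule vimage_algebra_subalgebra[OF YF])
    have XF: "X \<in> borel_measurable F" and iX: "integrable M X"
      and eqX: "\<And>A. A \<in> sets F \<Longrightarrow> set_lebesgue_integral M A X = set_lebesgue_integral M A Y"
      using cond unfolding is_cond_exp_def F_def by blast+
    have LX: "L2vec M X" by (rule cond_exp_L2vec[OF assms(1) subF iX XF LY eqX])
    have Xm: "X \<in> borel_measurable M" by (rule L2vec_measurable[OF LX])
    \<comment> \<open>Writing \<open>X\<close> as a function of \<open>Y\<close> moves the argument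
      from the sample space to the law \<open>\<nu>\<close>.\<close>
    obtain \<xi> where \<xi>: "\<xi> \<in> borel_measurable (sigmaPG S G)" and X\<xi>: "\<And>w. w \<in> space M \<Longrightarrow> X w = \<xi> (Y w)"
      using vimage_algebra_factor[OF XF[unfolded F_def]] by (metis UNIV_I space_sigmaPG)
    have \<xi>b: "\<xi> \<in> borel_measurable borel" using \<xi> sb unfolding measurable_def by auto
    have L\<xi>Y: "L2vec M (\<lambda>w. \<xi> (Y w))"
      by (rule L2vec_le[OF LX measurable_compose[OF Ym \<xi>b]]) (use X\<xi> in auto)
    have L\<xi>: "L2vec \<nu> \<xi>" unfolding \<nu>_def L2vec_distr[OF Ym \<xi>b] by (rule L\<xi>Y)
    have eq\<xi>: "set_lebesgue_integral \<nu> A \<xi> = set_lebesgue_integral \<nu> A (\<lambda>y. y)" if A: "A \<in> sets (sigmaPG S G)" for A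
    proof -
      have Ab: "A \<in> sets borel" using A sb by blast
      have YA: "Y -` A \<inter> space M \<in> sets F" unfolding F_def using A by (subst sets_vimage_algebra2) auto
      have "set_lebesgue_integral \<nu> A f = set_lebesgue_integral M (Y -` A \<inter> space M) (\<lambda>w. f (Y w))"
        if "f \<in> borel_measurable borel" for f :: "real^'n \<Rightarrow> real^'n"
        unfolding set_lebesgue_integral_def \<nu>_def
        using that Ab by (subst integral_distr[OF Ym]) (auto intro!: Bochner_Integration.integral_cong simp: indicator_def)
      from this[OF \<xi>b] this[of "\<lambda>y. y"]
      have "set_lebesgue_integral \<nu> A \<xi> = set_lebesgue_integral M (Y -` A \<inter> space M) (\<lambda>w. \<xi> (Y w))"
        "set_lebesgue_integral \<nu> A (\<lambda>y. y) = set_lebesgue_integral M (Y -` A \<inter> space M) Y" by simp_all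
      moreover have "set_lebesgue_integral M (Y -` A \<inter> space M) (\<lambda>w. \<xi> (Y w)) = set_lebesgue_integral M (Y -` A \<inter> space M) X"
        unfolding set_lebesgue_integral_def by (intro Bochner_Integration.integral_cong) (auto simp: X\<xi>)
      ultimately show ?thesis using eqX[OF YA] by simp
    qed
    have XB: "X -` B \<inter> space M \<in> sets F" if "B \<in> sets borel" for B
      using measurable_sets[OF XF that] by (simp add: F_def)
    \<comment> \<open>The algebra generated by \<open>X\<close> is contained in \<open>F\<close>, so
      its averages are inherited.\<close>
    have condX: "is_cond_exp M (vimage_algebra (space M) X borel) Y X"
      unfolding is_cond_exp_def
    proof (intro conjI ballI iX)
      show "X \<in> borel_measurable (vimage_algebra (space M) X borel)" by (rule measurable_vimage_algebra1) simp
      fix A assume "A \<in> sets (vimage_algebra (space M) X borel)"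
      then obtain B where "B \<in> sets borel" "A = X -` B \<inter> space M" by (auto simp: sets_vimage_algebra2)
      then show "set_lebesgue_integral M A X = set_lebesgue_integral M A Y" using eqX[OF XB] by simp
    qed
    have XY: "X \<in> measurable (vimage_algebra (space M) Y borel) borel"
    proof -
      have "(\<lambda>w. \<xi> (Y w)) \<in> measurable (vimage_algebra (space M) Y borel) borel"
        by (rule measurable_compose[OF measurable_vimage_algebra1 \<xi>b]) simp
      then show ?thesis by (subst measurable_cong[of _ _ "\<lambda>w. \<xi> (Y w)"]) (simp_all add: X\<xi>)
    qed
    have Xset: "X \<in> Xset M Y" unfolding Xset_def using LX XY condX by simp
    have pair_m: "(\<lambda>w. (V w, Y w)) \<in> borel_measurable M" if "V \<in> borel_measurable M" for V :: "'w \<Rightarrow> real^'n"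
      unfolding borel_prod[symmetric] by (rule measurable_Pair[OF that Ym])
    note fs = borel_measurable_fst_snd[where 'a = "real^'n" and 'b = "real^'n"]
    have val: "(\<integral>p. Sform S (fst p) (snd p) \<partial>distr M borel (\<lambda>w. (V w, Y w))) = (\<integral>w. Sform S (V w) (Y w) \<partial>M)"
      if "V \<in> borel_measurable M" for V :: "'w \<Rightarrow> real^'n"
      by (subst integral_distr[OF pair_m[OF that] measurable_Sform[OF fs]]) simp
    have Xset_Gamma: "distr M borel (\<lambda>w. (V w, Y w)) \<in> Gamma \<nu>" if V: "V \<in> Xset M Y" for V
    proof (rule GammaI[OF assms(1) _ LY \<nu>_def[symmetric]])
      show LV: "L2vec M V" using V by (simp add: Xset_def)
      have cV: "is_cond_exp M (vimage_algebra (space M) V borel) Y V" using V by (simp add: Xset_def)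
      fix A :: "(real^'n) set" and u :: "real^'n" assume A: "A \<in> sets borel"
      have VA: "V -` A \<inter> space M \<in> sets M" by (rule measurable_sets[OF L2vec_measurable[OF LV] A])
      have VA': "V -` A \<inter> space M \<in> sets (vimage_algebra (space M) V borel)" using A by (subst sets_vimage_algebra2) auto
      have "(\<integral>w. (indicator A (V w) *\<^sub>R u) \<bullet> H w \<partial>M) = u \<bullet> set_lebesgue_integral M (V -` A \<inter> space M) H"
        if "integrable M H" for H :: "'w \<Rightarrow> real^'n"
        unfolding set_integral_inner[OF that VA, symmetric] unfolding set_lebesgue_integral_def
        by (intro Bochner_Integration.integral_cong) (auto simp: indicator_def)
      then show "(\<integral>w. (indicator A (V w) *\<^sub>R u) \<bullet> V w \<partial>M) = (\<integral>w. (indicator A (V w) *\<^sub>R u) \<bullet> Y w \<partial>M)"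
        using cV VA' L2vec_integrable[OF M.finite_measure_axioms LV] L2vec_integrable[OF M.finite_measure_axioms LY]
        unfolding is_cond_exp_def by simp
    qed
    obtain \<gamma> where opt: "optimal_plan \<nu> S \<gamma>" using optimal_plan_exists[OF \<nu> L] by blast
    have \<gamma>: "\<gamma> \<in> Gamma \<nu>" using opt by (simp add: optimal_plan_def)
    have same: "AE p in \<delta>. PG S G (fst p) = PG S G (snd p)" and mem: "AE p in \<delta>. fst p \<in> PG S G (snd p)"
      if \<delta>: "optimal_plan \<nu> S \<delta>" for \<delta>
    proof -
      show "AE p in \<delta>. fst p \<in> PG S G (snd p)" by (rule optimal_plan_mem_PG[OF \<nu>(2) L sym dual \<delta>])
      then show "AE p in \<delta>. PG S G (fst p) = PG S G (snd p)"
        using \<delta> iso by (intro PG_fst_eq_PG_snd[OF sym G]) (auto simp: optimal_plan_def)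
    qed
    let ?\<pi> = "distr M borel (\<lambda>w. (X w, Y w))"
    have GX: "?\<pi> \<in> Gamma \<nu>" by (rule Xset_Gamma[OF Xset])
    \<comment> \<open>An arbitrary optimal plan is the benchmark: its reward is an integral of
      \<open>S(x,x)\<close>, which that of \<open>X\<close> dominates.\<close>
    have "(\<integral>p. Sform S (fst p) (snd p) \<partial>\<gamma>) \<le> (\<integral>y. Sform S (\<xi> y) (\<xi> y) \<partial>\<nu>)"
      unfolding Gamma_Sform_eq[OF \<gamma> sym]
      by (rule cond_exp_PG_value[OF \<nu> L sym G \<xi> L\<xi> eq\<xi> \<gamma> mem[OF opt] same[OF opt]])
    also have "\<dots> = (\<integral>w. Sform S (\<xi> (Y w)) (\<xi> (Y w)) \<partial>M)"
      unfolding \<nu>_def by (rule integral_distr[OF Ym measurable_Sform[OF \<xi>b \<xi>b]])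
    also have "\<dots> = (\<integral>w. Sform S (X w) (X w) \<partial>M)" by (intro Bochner_Integration.integral_cong) (simp_all add: X\<xi>)
    also have "\<dots> = (\<integral>p. Sform S (fst p) (fst p) \<partial>?\<pi>)"
      by (subst integral_distr[OF pair_m[OF Xm] measurable_Sform[OF fs(1) fs(1)]]) simp
    finally have "(\<integral>p. Sform S (fst p) (snd p) \<partial>\<gamma>) \<le> (\<integral>p. Sform S (fst p) (snd p) \<partial>?\<pi>)"
      unfolding Gamma_Sform_eq[OF GX sym] .
    then have optX: "optimal_plan \<nu> S ?\<pi>" using opt GX unfolding optimal_plan_def by fastforce
    have mapX: "optimal_map M S Y X"
      unfolding optimal_map_def
    proof (intro conjI ballI Xset)
      fix X' assume X': "X' \<in> Xset M Y"
      then have X'm: "X' \<in> borel_measurable M" by (simp add: Xset_def L2vec_def)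
      show "(1/2) * (\<integral>w. Sform S (X' w) (Y w) \<partial>M) \<le> (1/2) * (\<integral>w. Sform S (X w) (Y w) \<partial>M)"
        using bspec[OF conjunct2[OF optX[unfolded optimal_plan_def]] Xset_Gamma[OF X']]
        unfolding val[OF X'm] val[OF Xm] .
    qed
    have memX: "AE w in M. X w \<in> PG S G (Y w)" using AE_distrD[OF pair_m[OF Xm] mem[OF optX]] by simp
    have isoM: "AE w in M. \<forall>a\<in>PG S G (Y w). \<forall>b\<in>PG S G (Y w). Sform S (a - b) (a - b) = 0"
      using iso unfolding \<nu>_def by (rule AE_distrD[OF Ym])
    have "(AE w in M. Z w \<in> PG S G (Z w) \<and> PG S G (Z w) = PG S G (Y w))
                \<and> (\<exists>X'. X' \<in> measurable (vimage_algebra (space M) Z borel) borel \<and> (AE w in M. X w = X' w))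
                \<and> is_cond_exp M (vimage_algebra (space M) X borel) Z X
                \<and> (AE w in M. Sform S (Z w - X w) (Z w - X w) = 0)"
      if LZ: "L2vec M Z" and optZ: "optimal_plan \<nu> S (distr M borel (\<lambda>w. (Z w, Y w)))" for Z
    proof (intro conjI)
      have Zm: "Z \<in> borel_measurable M" by (rule L2vec_measurable[OF LZ])
      have GZ: "distr M borel (\<lambda>w. (Z w, Y w)) \<in> Gamma \<nu>" using optZ by (simp add: optimal_plan_def)
      have memZ: "AE w in M. Z w \<in> PG S G (Y w)" using AE_distrD[OF pair_m[OF Zm] mem[OF optZ]] by simp
      have sameZ: "AE w in M. PG S G (Z w) = PG S G (Y w)" using AE_distrD[OF pair_m[OF Zm] same[OF optZ]] by simp
      show "AE w in M. Z w \<in> PG S G (Z w) \<and> PG S G (Z w) = PG S G (Y w)"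
        using memZ sameZ by eventually_elim simp
      \<comment> \<open>\<open>\<xi>\<close> takes equal values at points with the same projection
        set, so it may be evaluated at \<open>Z\<close> in place of \<open>Y\<close>.\<close>
      have XZ: "AE w in M. X w = \<xi> (Z w)"
        using sameZ AE_space
      proof eventually_elim
        case (elim w)
        then show ?case using X\<xi> sigmaPG_measurable_PG[OF \<xi> elim(1)] by simp
      qed
      show "\<exists>X'. X' \<in> measurable (vimage_algebra (space M) Z borel) borel \<and> (AE w in M. X w = X' w)"
      proof (rule exI[of _ "\<lambda>w. \<xi> (Z w)"], rule conjI[OF _ XZ])
        show "(\<lambda>w. \<xi> (Z w)) \<in> measurable (vimage_algebra (space M) Z borel) borel"
          by (rule measurable_compose[OF measurable_vimage_algebra1 \<xi>b]) simp
      qed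
      \<comment> \<open>\<open>X\<close> and \<open>Z\<close> both lie in P_G(Y), whose points
        differ by isotropic vectors.\<close>
      show "AE w in M. Sform S (Z w - X w) (Z w - X w) = 0"
        using memX memZ isoM by eventually_elim blast
      show "is_cond_exp M (vimage_algebra (space M) X borel) Z X"
        unfolding is_cond_exp_def
      proof (intro conjI ballI iX)
        show "X \<in> borel_measurable (vimage_algebra (space M) X borel)" by (rule measurable_vimage_algebra1) simp
        fix A assume "A \<in> sets (vimage_algebra (space M) X borel)"
        then obtain B where B: "B \<in> sets borel" "A = X -` B \<inter> space M" by (auto simp: sets_vimage_algebra2)
        have AM: "A \<in> sets M" unfolding B(2) by (rule measurable_sets[OF Xm B(1)])
        have AF: "A \<in> sets F" unfolding B(2) by (rule XB[OF B(1)])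
        have "set_lebesgue_integral M A Y = set_lebesgue_integral M A Z"
        proof (rule set_integral_eqI[OF _ _ AM])
          show "integrable M Y" "integrable M Z" using L2vec_integrable[OF M.finite_measure_axioms] LY LZ by blast+
          fix u :: "real^'n"
          \<comment> \<open>Almost surely the event that \<open>X\<close> lies in \<open>B\<close>
            is the event that \<open>\<xi>\<close> at \<open>Z\<close> does, hence a test set for
            the martingale property of \<open>(Z, Y)\<close>. This exchanges \<open>Y\<close> for
            \<open>Z\<close> in the averages defining \<open>X\<close>.\<close>
          define \<theta> where "\<theta> z = indicat_real B (\<xi> z) *\<^sub>R u" for z
          have \<theta>m: "\<theta> \<in> borel_measurable borel"
            unfolding \<theta>_def using B(1) by (intro borel_measurable_scaleR measurable_compose[OF \<xi>b borel_measurable_indicator]) auto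
          have nb: "norm (\<theta> z) \<le> norm u" for z by (auto simp: \<theta>_def indicator_def)
          have L\<theta>Z: "L2vec M (\<lambda>w. \<theta> (Z w))"
            by (rule L2vec_bounded[OF M.finite_measure_axioms measurable_compose[OF Zm \<theta>m] nb])
          have "L2vec (distr M borel (\<lambda>w. (Z w, Y w))) (\<lambda>p. \<theta> (fst p))"
            using L\<theta>Z by (subst L2vec_distr[OF pair_m[OF Zm] measurable_compose[OF fs(1) \<theta>m]]) simp
          from Gamma_test[OF GZ \<theta>m this]
          have "(\<integral>w. \<theta> (Z w) \<bullet> Z w \<partial>M) = (\<integral>w. \<theta> (Z w) \<bullet> Y w \<partial>M)"
            by (subst (asm) (1 2) integral_distr[OF pair_m[OF Zm]])
              (auto intro!: borel_measurable_inner measurable_compose[OF fs(1) \<theta>m] fs)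
          moreover have "(\<integral>w. (indicator A w *\<^sub>R u) \<bullet> H w \<partial>M) = (\<integral>w. \<theta> (Z w) \<bullet> H w \<partial>M)"
            if LH: "L2vec M H" for H
          proof (rule integral_cong_AE)
            have LA: "L2vec M (\<lambda>w. indicator A w *\<^sub>R u)"
              by (rule L2vec_bounded[OF M.finite_measure_axioms, of _ "norm u"]) (use AM in \<open>auto simp: indicator_def\<close>)
            show "(\<lambda>w. (indicator A w *\<^sub>R u) \<bullet> H w) \<in> borel_measurable M" "(\<lambda>w. \<theta> (Z w) \<bullet> H w) \<in> borel_measurable M"
              by (rule borel_measurable_integrable[OF L2vec_inner[OF LA LH]], rule borel_measurable_integrable[OF L2vec_inner[OF L\<theta>Z LH]])
            show "AE w in M. (indicator A w *\<^sub>R u) \<bullet> H w = \<theta> (Z w) \<bullet> H w"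
              using XZ AE_space by eventually_elim (auto simp: \<theta>_def B(2) indicator_def)
          qed
          ultimately show "(\<integral>w. (indicator A w *\<^sub>R u) \<bullet> Y w \<partial>M) = (\<integral>w. (indicator A w *\<^sub>R u) \<bullet> Z w \<partial>M)"
            using LY LZ by simp
        qed
        then show "set_lebesgue_integral M A X = set_lebesgue_integral M A Z" using eqX[OF AF] by simp
      qed
    qed
    then show ?thesis using mapX optX by blast
  qed
  show ?thesis
    using part1 part2 unfolding \<nu>_def by blast
qed

end
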